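(* Let $n\ge 1$, let $G$ be a compact Hausdorff Abelian group with normalized Haar measure $\mu$ ($\mu(G)=1$), and let $\varphi:\mathbb{R}^n\to G$ be a continuous group homomorphism with $\varphi(\mathbb{R}^n)$ dense in $G$. Let $\tau(x)\omega:=\varphi(x)\,\omega$, let $\gamma:G^\wedge\to[0,\infty)$ be the function $\gamma(\chi)=2\pi\|y(\chi)\|$, and let $\mathcal{H}$ and $H^1_\gamma(G)$ be the spaces associated with $\tau$ and $\gamma$ (all defined in the context). Let $f:\mathbb{R}^n\times G\to\mathbb{C}$ be a stationary function. Then $f\in\mathcal{H}$ if and only if $f(0,\cdot)\in H^1_\gamma(G)$, and in this case $$\|f\|_{\mathcal{H}}=\|f(0,\cdot)\|_{H^1_\gamma(G)}.$$
   Context: $G^\wedge$ is the dual group of $G$, i.e. the group of continuous homomorphisms $\xi:G\to\mathbb{S}^1$; since $G$ is compact it is discrete, and its Haar measure $\nu$ is the counting measure. The Fourier transform is $\widehat{h}(\xi)=\int_G h(x)\overline{\xi(x)}\,d\mu(x)$. For $\chi\in G^\wedge$, $\chi\circ\varphi$ is a continuous character of $\mathbb{R}^n$, so there is a unique $y(\chi)\in\mathbb{R}^n$ with $\chi(\varphi(x))=e^{2\pi i\,y(\chi)\cdot x}$ for all $x\in\mathbb{R}^n$. Put $\gamma(\chi):=2\pi\|y(\chi)\|$ (Euclidean norm). $H^1_\gamma(G)$ is the set of $h\in L^2(G;\mu)$ with $\|h\|_{H^1_\gamma(G)}^2:=\int_{G^\wedge}(1+\gamma(\xi)^2)|\widehat{h}(\xi)|^2\,d\nu(\xi)<\infty$.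 A measurable function $f$ on $\mathbb{R}^n\times G$ is called stationary if for all $x,k\in\mathbb{R}^n$ one has $f(x+k,\omega)=f(x,\tau(k)\omega)$ for $\mu$-a.e. $\omega\in G$. (In particular $f(x,\omega)=f(0,\tau(x)\omega)$.) $\mathcal{H}$ is the space of stationary functions $f\in H^1_{\rm loc}(\mathbb{R}^n;L^2(G))$. The weak gradient $\nabla_y f$ in the $\mathbb{R}^n$ variable is again stationary, so $\nabla_y f(0,\cdot)$ makes sense in $L^2(G)$, and $\mathcal{H}$ is equipped with the norm $\|f\|_{\mathcal{H}}^2=\int_G|f(0,\omega)|^2d\mu(\omega)+\int_G|\nabla_y f(0,\omega)|^2d\mu(\omega)$. *)

theory Defs
  imports "HOL-Analysis.Analysis"
begin

text \<open>
  A compact Hausdorff Abelian group is a type of sort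
  \<open>{topological_ab_group_add, t2_space}\<close> whose universe is compact; the group law is thus
  written additively.
\<close>

text \<open>Regularity is part of the definition: if the group is not metrizable, invariance alone does
  not determine a Borel probability measure.\<close>

definition normalized_haar :: "'g::{topological_ab_group_add, t2_space} measure \<Rightarrow> bool" where
  "normalized_haar \<mu> \<longleftrightarrow>
     sets \<mu> = sets borel \<and>
     emeasure \<mu> UNIV = 1 \<and>
     (\<forall>a. \<forall>A\<in>sets borel. emeasure \<mu> ((\<lambda>\<omega>. a + \<omega>) ` A) = emeasure \<mu> A) \<and>
     (\<forall>A\<in>sets borel. emeasure \<mu> A = (INF U\<in>{U. open U \<and> A \<subseteq> U}. emeasure \<mu> U)) \<and>
     (\<forall>U. open U \<longrightarrow> emeasure \<mu> U = (SUP K\<in>{K. compact K \<and> K \<subseteq> U}. emeasure \<mu> K))"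

definition continuous_hom :: "('a::{topological_space, plus} \<Rightarrow> 'g::{topological_space, plus}) \<Rightarrow> bool" where
  "continuous_hom \<phi> \<longleftrightarrow> continuous_on UNIV \<phi> \<and> (\<forall>x y. \<phi> (x + y) = \<phi> x + \<phi> y)"

definition dual_group :: "('g::{topological_space, plus} \<Rightarrow> complex) set" where
  "dual_group = {\<xi>. continuous_on UNIV \<xi> \<and> range \<xi> \<subseteq> sphere 0 1 \<and> (\<forall>x y. \<xi> (x + y) = \<xi> x * \<xi> y)}"

definition fourier :: "'g measure \<Rightarrow> ('g \<Rightarrow> complex) \<Rightarrow> ('g \<Rightarrow> complex) \<Rightarrow> complex" where
  "fourier \<mu> h \<xi> = (\<integral>x. h x * cnj (\<xi> x) \<partial>\<mu>)"

definition frequency :: "(real^'n \<Rightarrow> 'g) \<Rightarrow> ('g \<Rightarrow> complex) \<Rightarrow> real^'n" where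
  "frequency \<phi> \<xi> = (THE y. \<forall>x. \<xi> (\<phi> x) = exp (2 * complex_of_real pi * \<i> * complex_of_real (y \<bullet> x)))"

definition gamma_of :: "(real^'n \<Rightarrow> 'g) \<Rightarrow> ('g \<Rightarrow> complex) \<Rightarrow> real" where
  "gamma_of \<phi> \<xi> = 2 * pi * norm (frequency \<phi> \<xi>)"

definition L2 :: "'a measure \<Rightarrow> ('a \<Rightarrow> complex) set" where
  "L2 M = {h \<in> borel_measurable M. integrable M (\<lambda>x. (cmod (h x))\<^sup>2)}"

definition H1_gamma ::
  "'g::{topological_space, plus} measure \<Rightarrow> (('g \<Rightarrow> complex) \<Rightarrow> real) \<Rightarrow> ('g \<Rightarrow> complex) set" where
  "H1_gamma \<mu> \<gamma> =
     {h \<in> L2 \<mu>. integrable (count_space dual_group) (\<lambda>\<xi>. (1 + (\<gamma> \<xi>)\<^sup>2) * (cmod (fourier \<mu> h \<xi>))\<^sup>2)}"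

definition H1_gamma_norm ::
  "'g::{topological_space, plus} measure \<Rightarrow> (('g \<Rightarrow> complex) \<Rightarrow> real) \<Rightarrow> ('g \<Rightarrow> complex) \<Rightarrow> real" where
  "H1_gamma_norm \<mu> \<gamma> h =
     sqrt (\<integral>\<xi>. (1 + (\<gamma> \<xi>)\<^sup>2) * (cmod (fourier \<mu> h \<xi>))\<^sup>2 \<partial>count_space dual_group)"

definition flow :: "(real^'n \<Rightarrow> 'g::plus) \<Rightarrow> real^'n \<Rightarrow> 'g \<Rightarrow> 'g" where
  "flow \<phi> x \<omega> = \<phi> x + \<omega>"

definition stationary ::
  "'g measure \<Rightarrow> (real^'n \<Rightarrow> 'g \<Rightarrow> 'g) \<Rightarrow> ((real^'n) \<times> 'g \<Rightarrow> 'b::topological_space) \<Rightarrow> bool" where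
  "stationary \<mu> \<tau> f \<longleftrightarrow>
     f \<in> borel_measurable (lborel \<Otimes>\<^sub>M \<mu>) \<and>
     (\<forall>x k. AE \<omega> in \<mu>. f (x + k, \<omega>) = f (x, \<tau> k \<omega>))"

primrec Ck :: "nat \<Rightarrow> (real^'n \<Rightarrow> real) \<Rightarrow> bool" where
  "Ck 0 \<psi> \<longleftrightarrow> continuous_on UNIV \<psi>"
| "Ck (Suc k) \<psi> \<longleftrightarrow>
     (\<forall>x. \<psi> differentiable (at x)) \<and> (\<forall>i. Ck k (\<lambda>x. frechet_derivative \<psi> (at x) (axis i 1)))"

definition test_functions :: "(real^'n \<Rightarrow> real) set" where
  "test_functions = {\<psi>. (\<forall>k. Ck k \<psi>) \<and> compact (closure {x. \<psi> x \<noteq> 0})}"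

text \<open>
  Elements of \<open>L\<^sup>2\<^sub>l\<^sub>o\<^sub>c(\<real>\<^sup>n; L\<^sup>2(G))\<close> are represented by jointly measurable functions on
  \<open>\<real>\<^sup>n \<times> G\<close>. The inner integral is the squared \<open>L\<^sup>2(G)\<close> norm of the section at \<open>x\<close>.
\<close>

definition L2_loc :: "'g measure \<Rightarrow> ((real^'n) \<times> 'g \<Rightarrow> 'b::real_normed_vector) set" where
  "L2_loc \<mu> = {f \<in> borel_measurable (lborel \<Otimes>\<^sub>M \<mu>).
     \<forall>K. compact K \<longrightarrow>
       (\<integral>\<^sup>+x\<in>K. (\<integral>\<^sup>+\<omega>. ennreal ((norm (f (x, \<omega>)))\<^sup>2) \<partial>\<mu>) \<partial>lborel) < \<infinity>}"

text \<open>
  The defining identity \<open>\<integral> \<partial>\<^sub>i\<psi>(x) f(x) dx = - \<integral> \<psi>(x) F\<^sub>i(x) dx\<close> is one between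
  \<open>L\<^sup>2(G)\<close>-valued Bochner integrals. By Fubini these are represented by the functions obtained
  by integrating in \<open>x\<close> for almost every fixed \<open>\<omega>\<close>, so equality in \<open>L\<^sup>2(G)\<close> is equality
  almost everywhere, with an exceptional set that may depend on \<open>\<psi>\<close>.
\<close>

definition weak_gradient ::
  "'g measure \<Rightarrow> ((real^'n) \<times> 'g \<Rightarrow> complex) \<Rightarrow> ((real^'n) \<times> 'g \<Rightarrow> complex^'n) \<Rightarrow> bool" where
  "weak_gradient \<mu> f F \<longleftrightarrow>
     (\<forall>\<psi>\<in>test_functions. \<forall>i. AE \<omega> in \<mu>.
        (\<integral>x. frechet_derivative \<psi> (at x) (axis i 1) *\<^sub>R f (x, \<omega>) \<partial>lborel) =
        - (\<integral>x. \<psi> x *\<^sub>R (F (x, \<omega>) $ i) \<partial>lborel))"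

definition H1_loc :: "'g measure \<Rightarrow> ((real^'n) \<times> 'g \<Rightarrow> complex) set" where
  "H1_loc \<mu> = {f \<in> L2_loc \<mu>. \<exists>F\<in>L2_loc \<mu>. weak_gradient \<mu> f F}"

definition stat_space ::
  "'g measure \<Rightarrow> (real^'n \<Rightarrow> 'g \<Rightarrow> 'g) \<Rightarrow> ((real^'n) \<times> 'g \<Rightarrow> complex) set" where
  "stat_space \<mu> \<tau> = {f. stationary \<mu> \<tau> f \<and> f \<in> H1_loc \<mu>}"

text \<open>
  The weak gradient is determined only up to null sets of \<open>\<real>\<^sup>n \<times> G\<close>, so its value at \<open>x = 0\<close>
  is read off from a stationary representative; that section does not depend, up to \<open>\<mu>\<close>-null
  sets, on which stationary representative is chosen.
\<close>

definition stat_grad ::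
  "'g measure \<Rightarrow> (real^'n \<Rightarrow> 'g \<Rightarrow> 'g) \<Rightarrow> ((real^'n) \<times> 'g \<Rightarrow> complex) \<Rightarrow> (real^'n) \<times> 'g \<Rightarrow> complex^'n" where
  "stat_grad \<mu> \<tau> f = (SOME F. F \<in> L2_loc \<mu> \<and> weak_gradient \<mu> f F \<and> stationary \<mu> \<tau> F)"

definition stat_norm ::
  "'g measure \<Rightarrow> (real^'n \<Rightarrow> 'g \<Rightarrow> 'g) \<Rightarrow> ((real^'n) \<times> 'g \<Rightarrow> complex) \<Rightarrow> real" where
  "stat_norm \<mu> \<tau> f =
     sqrt ((\<integral>\<omega>. (cmod (f (0, \<omega>)))\<^sup>2 \<partial>\<mu>) + (\<integral>\<omega>. (norm (stat_grad \<mu> \<tau> f (0, \<omega>)))\<^sup>2 \<partial>\<mu>))"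

end

theory Submission
  imports Defs
begin

text \<open>
  Stationarity means \<open>f (x, \<omega>) = h (\<phi> x + \<omega>)\<close> with \<open>h = f (0, _)\<close>, so the Fourier coefficient of
  the section at \<open>x\<close> is \<open>exp (2 \<pi> i y(\<xi>) \<bullet> x)\<close> times that of \<open>h\<close>. Testing the weak gradient
  against \<open>\<xi>\<close> and integrating by parts in \<open>x\<close> shows that its coefficients are
  \<open>2 \<pi> i y(\<xi>)\<close> times those of \<open>h\<close>. Bessel's inequality then bounds them for an arbitrary weak
  gradient. Conversely, Riesz--Fischer produces a stationary candidate with these coefficients, which
  is a weak gradient because an integrable function on the group whose Fourier coefficients vanish is
  zero. The norms agree by Plancherel's theorem.

  Uniqueness of Fourier coefficients rests on the existence of enough characters, obtained within the
  convolution algebra of continuous functions: normalized powers of a self-adjoint function converge to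
  an idempotent, an idempotent has value at least one at zero, hence minimal idempotents exist below
  each of them, and a minimal idempotent is multiplied by a scalar under every translation, that is, it
  is a character.
\<close>

subsection \<open>Invariance and Fubini on the group\<close>

text \<open>The group need not be second countable, and this shapes several steps. The Borel sets of
  \<open>'g \<times> 'g\<close> may exceed the product sigma-algebra, so joint measurability of a
  continuous kernel has to be obtained by approximation; the dual group may be uncountable, so all
  sums over it are unordered. Idempotents take the place of eigenspaces of compact operators: the
  value at zero of an idempotent is its squared norm and is additive over orthogonal splittings, so
  every proper step down costs at least one unit of a finite quantity.

  The gradient supplied by \<open>H1_loc\<close> carries no invariance, so it has no meaningful
  section at zero. The forward direction therefore bounds coefficients by averages of section norms
  over a bump, and only the summability obtained in this way yields a stationary gradient; its
  existence gives the choice in \<open>stat_grad\<close> a meaning. Test functions are real, so each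
  complex exponential enters through its cosine and sine parts.\<close>

lemma open_in_pair_measure:
  fixes W :: "('a::second_countable_topology \<times> 'b::topological_space) set"
  assumes "open W"
  shows "W \<in> sets (borel \<Otimes>\<^sub>M borel)"
proof -
  obtain B :: "'a set set" where B: "countable B" "topological_basis B"
    using ex_countable_basis by blast
  \<comment> \<open>Collecting all admissible open \<open>v\<close> for a basic set \<open>b\<close>
    into one open set leaves a union indexed by the countable basis alone. Only the first factor has
    to be second countable.\<close>
  define V where "V b = \<Union>{v. open v \<and> b \<times> v \<subseteq> W}" for b
  have "W = (\<Union>b\<in>B. b \<times> V b)"
  proof (intro equalityI subsetI)
    fix p assume p: "p \<in> W"
    obtain a v where av: "open a" "open v" "p \<in> a \<times> v" "a \<times> v \<subseteq> W"
      using open_prod_elim[OF assms p] by metis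
    obtain b where "b \<in> B" "fst p \<in> b" "b \<subseteq> a"
      using topological_basisE[OF B(2) av(1), of "fst p"] av(3) by (metis mem_Times_iff)
    moreover from this have "v \<subseteq> V b" using av unfolding V_def by blast
    ultimately show "p \<in> (\<Union>b\<in>B. b \<times> V b)" using av(3) by (cases p) auto
  qed (auto simp: V_def)
  moreover have "b \<times> V b \<in> sets (borel \<Otimes>\<^sub>M borel)" if "b \<in> B" for b
    using topological_basis_open[OF B(2) that] unfolding V_def by (intro pair_measureI borel_open) auto
  ultimately show ?thesis
    using sets.countable_UN'[of B "\<lambda>b. b \<times> V b" "borel \<Otimes>\<^sub>M borel"] B(1) by auto
qed

locale compact_haar =
  fixes \<mu> :: "'g::{topological_ab_group_add, t2_space} measure"
  assumes compact_univ: "compact (UNIV :: 'g set)"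
    and haar: "normalized_haar \<mu>"
begin

lemma sets_haar [measurable_cong, simp]: "sets \<mu> = sets borel"
  using haar unfolding normalized_haar_def by (elim conjE)

lemma space_haar [simp]: "space \<mu> = UNIV"
  using sets_eq_imp_space_eq[OF sets_haar] by simp

lemma emeasure_univ [simp]: "emeasure \<mu> UNIV = 1"
  using haar unfolding normalized_haar_def by (elim conjE)

lemma measure_univ [simp]: "measure \<mu> UNIV = 1"
  by (simp add: measure_def)

lemma finite_measure_haar: "finite_measure \<mu>"
  by (rule finite_measureI) simp

sublocale finite_measure \<mu>
  by (rule finite_measure_haar)

lemma translation_measurable [measurable]: "(+) a \<in> measurable \<mu> \<mu>"
proof -
  have "(+) a \<in> borel_measurable borel"
    by (intro borel_measurable_continuous_onI continuous_intros)
  then show ?thesis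
    by (simp add: measurable_cong_sets[OF sets_haar sets_haar])
qed

lemma emeasure_translation: "A \<in> sets borel \<Longrightarrow> emeasure \<mu> ((+) a ` A) = emeasure \<mu> A"
proof -
  from haar have "\<forall>a. \<forall>A\<in>sets borel. emeasure \<mu> ((\<lambda>\<omega>. a + \<omega>) ` A) = emeasure \<mu> A"
    unfolding normalized_haar_def by (elim conjE)
  then show "A \<in> sets borel \<Longrightarrow> emeasure \<mu> ((+) a ` A) = emeasure \<mu> A" by (elim allE ballE) auto
qed

lemma distr_translation: "distr \<mu> \<mu> ((+) a) = \<mu>"
proof (rule measure_eqI)
  fix A assume "A \<in> sets (distr \<mu> \<mu> ((+) a))"
  then have A: "A \<in> sets borel" by simp
  have "(+) a -` A = (+) (- a) ` A"
    by (force simp: image_iff algebra_simps)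
  moreover have "(+) a \<in> measurable \<mu> \<mu>"
    by (rule translation_measurable)
  ultimately show "emeasure (distr \<mu> \<mu> ((+) a)) A = emeasure \<mu> A"
    using A emeasure_translation[OF A, of "- a"] by (simp add: emeasure_distr)
qed simp

lemma nn_integral_translation:
  assumes "u \<in> borel_measurable borel"
  shows "(\<integral>\<^sup>+x. u (a + x) \<partial>\<mu>) = (\<integral>\<^sup>+x. u x \<partial>\<mu>)"
  using nn_integral_distr[of "(+) a" \<mu> \<mu> u] assms by (simp add: distr_translation)

lemma integral_translation:
  fixes u :: "'g \<Rightarrow> 'b::{banach, second_countable_topology}"
  assumes "u \<in> borel_measurable borel"
  shows "(\<integral>x. u (a + x) \<partial>\<mu>) = (\<integral>x. u x \<partial>\<mu>)"
  using integral_distr[of "(+) a" \<mu> \<mu> u] assms by (simp add: distr_translation)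

lemma continuous_bounded:
  fixes u :: "'g \<Rightarrow> 'b::real_normed_vector"
  assumes "continuous_on UNIV u"
  obtains B where "B > 0" "\<And>x. norm (u x) \<le> B"
  using compact_imp_bounded[OF compact_continuous_image[OF assms compact_univ]]
  unfolding bounded_pos by auto

lemma continuous_measurable [intro]:
  fixes u :: "'g \<Rightarrow> 'b::topological_space"
  assumes "continuous_on UNIV u"
  shows "u \<in> borel_measurable borel" "u \<in> borel_measurable \<mu>"
  using borel_measurable_continuous_onI[OF assms]
  by (auto simp: measurable_cong_sets[OF sets_haar refl])

lemma continuous_integrable [intro]:
  fixes u :: "'g \<Rightarrow> 'b::{banach, second_countable_topology}"
  assumes "continuous_on UNIV u"
  shows "integrable \<mu> u"
proof -
  obtain B where "\<And>x. norm (u x) \<le> B" using continuous_bounded[OF assms] by blast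
  then show ?thesis
    by (intro integrable_const_bound[where B=B]) (use assms in auto)
qed

lemma integrable_mult_continuous:
  fixes h u :: "'g \<Rightarrow> complex"
  assumes h: "integrable \<mu> h" and u: "continuous_on UNIV u"
  shows "integrable \<mu> (\<lambda>x. h x * u x)"
proof -
  obtain B where B: "B > 0" "\<And>x. norm (u x) \<le> B" using continuous_bounded[OF u] by blast
  have [measurable]: "h \<in> borel_measurable \<mu>" "u \<in> borel_measurable \<mu>"
    using h u by auto
  show ?thesis
  proof (rule Bochner_Integration.integrable_bound)
    show "integrable \<mu> (\<lambda>x. B *\<^sub>R h x)" using h by simp
    show "AE x in \<mu>. norm (h x * u x) \<le> norm (B *\<^sub>R h x)"
      using B by (auto simp: norm_mult mult.commute[of B] intro!: AE_I2 mult_left_mono)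
  qed auto
qed

lemma urysohn:
  assumes "closed S" "closed T" "S \<inter> T = {}"
  obtains f :: "'g \<Rightarrow> real" where "continuous_on UNIV f" "\<And>x. 0 \<le> f x \<and> f x \<le> 1"
    "\<And>x. x \<in> S \<Longrightarrow> f x = 0" "\<And>x. x \<in> T \<Longrightarrow> f x = 1"
proof -
  have "Hausdorff_space (euclidean :: 'g topology)"
    unfolding Hausdorff_space_def by (auto simp: disjnt_def) (meson hausdorff)
  then have "normal_space (euclidean :: 'g topology)"
    using compact_univ compact_Hausdorff_or_regular_imp_normal_space
    by (metis compact_space_def compactin_euclidean_iff topspace_euclidean)
  then obtain f :: "'g \<Rightarrow> real" where
    f: "continuous_map euclidean (top_of_set {0..1}) f" "f ` S \<subseteq> {0}" "f ` T \<subseteq> {1}"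
    using Urysohn_lemma[of euclidean S T 0 1] assms by (auto simp: disjnt_def)
  then show thesis
    by (intro that[of f]) (auto simp: continuous_map_in_subtopology)
qed

text \<open>Stone-Weierstrass: the functions that are both continuous and measurable for the product
  sigma-algebra form an algebra, functions of a single coordinate already separate points, and
  uniform limits stay measurable.\<close>

lemma continuous_pair_measurable_real:
  fixes K :: "'g \<times> 'g \<Rightarrow> real"
  assumes K: "continuous_on UNIV K"
  shows "K \<in> borel_measurable (\<mu> \<Otimes>\<^sub>M \<mu>)"
proof -
  define R where "R = {F :: 'g \<times> 'g \<Rightarrow> real. continuous_on UNIV F \<and> F \<in> borel_measurable (\<mu> \<Otimes>\<^sub>M \<mu>)}"
  have sep: "\<exists>F\<in>R. F p \<noteq> F q" if "p \<noteq> q" for p q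
  proof -
    have *: "\<exists>f::'g\<Rightarrow>real. continuous_on UNIV f \<and> f a \<noteq> f b" if "a \<noteq> b" for a b
      using urysohn[of "{a}" "{b}"] that by (metis closed_singleton disjoint_insert(1) inf_bot_right
          insertI1 singletonD zero_neq_one)
    consider "fst p \<noteq> fst q" | "snd p \<noteq> snd q" using \<open>p \<noteq> q\<close> by (auto simp: prod_eq_iff)
    then show ?thesis
    proof cases
      case 1
      then obtain f :: "'g\<Rightarrow>real" where f: "continuous_on UNIV f" "f (fst p) \<noteq> f (fst q)" using * by blast
      have [measurable]: "f \<in> borel_measurable \<mu>" using f by auto
      have "(\<lambda>z. f (fst z)) \<in> R" unfolding R_def
        by (auto intro!: continuous_on_compose2[OF f(1)] continuous_intros)
      then show ?thesis using f(2) by (intro bexI[of _ "\<lambda>z. f (fst z)"])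
    next
      case 2
      then obtain f :: "'g\<Rightarrow>real" where f: "continuous_on UNIV f" "f (snd p) \<noteq> f (snd q)" using * by blast
      have [measurable]: "f \<in> borel_measurable \<mu>" using f by auto
      have "(\<lambda>z. f (snd z)) \<in> R" unfolding R_def
        by (auto intro!: continuous_on_compose2[OF f(1)] continuous_intros)
      then show ?thesis using f(2) by (intro bexI[of _ "\<lambda>z. f (snd z)"])
    qed
  qed
  interpret function_ring_on R UNIV
    by unfold_locales
       (use compact_Times[OF compact_univ compact_univ] sep in \<open>auto simp: R_def intro!: continuous_intros\<close>)
  obtain F where F: "\<And>n::nat. F n \<in> R" "uniform_limit UNIV F K sequentially"
    using Stone_Weierstrass[OF K] by auto
  show ?thesis
  proof (rule borel_measurable_LIMSEQ_real)
    show "(\<lambda>n. F n p) \<longlonglongrightarrow> K p" for p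
      using tendsto_uniform_limitI[OF F(2)] by simp
  qed (use F(1) in \<open>auto simp: R_def\<close>)
qed

lemma continuous_pair_measurable:
  fixes K :: "'g \<times> 'g \<Rightarrow> complex"
  assumes "continuous_on UNIV K"
  shows "K \<in> borel_measurable (\<mu> \<Otimes>\<^sub>M \<mu>)"
  unfolding borel_measurable_complex_iff
  by (intro conjI continuous_pair_measurable_real continuous_intros assms)

text \<open>Compactness bounds the kernel, so Fubini applies although \<open>h\<close> is merely
  integrable. This generality is what later allows convolving an arbitrary integrable function with
  continuous ones.\<close>

lemma swap_integral:
  fixes K :: "'g \<Rightarrow> 'g \<Rightarrow> complex"
  assumes K: "continuous_on UNIV (\<lambda>p. K (fst p) (snd p))" and h: "integrable \<mu> h"
  shows "(\<integral>y. (\<integral>x. K x y \<partial>\<mu>) * h y \<partial>\<mu>) = (\<integral>x. (\<integral>y. K x y * h y \<partial>\<mu>) \<partial>\<mu>)"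
proof -
  interpret P: pair_sigma_finite \<mu> \<mu> ..
  have "compact (range (\<lambda>p. K (fst p) (snd p)))"
    using compact_continuous_image[OF K] compact_Times[OF compact_univ compact_univ] by simp
  then obtain B where B: "\<And>x y. norm (K x y) \<le> B"
    using compact_imp_bounded[of "range (\<lambda>p. K (fst p) (snd p))"] unfolding bounded_iff by force
  have [measurable]: "(\<lambda>p. K (fst p) (snd p)) \<in> borel_measurable (\<mu> \<Otimes>\<^sub>M \<mu>)" "h \<in> borel_measurable \<mu>"
    using continuous_pair_measurable[OF K] h by auto
  have "integrable (\<mu> \<Otimes>\<^sub>M \<mu>) (\<lambda>p. K (fst p) (snd p) * h (snd p))"
  proof (rule Bochner_Integration.integrable_bound)
    show "integrable (\<mu> \<Otimes>\<^sub>M \<mu>) (\<lambda>p. B *\<^sub>R (1 * h (snd p)))"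
      using h by (intro P.Fubini_integrable) auto
    show "AE p in \<mu> \<Otimes>\<^sub>M \<mu>. norm (K (fst p) (snd p) * h (snd p)) \<le> norm (B *\<^sub>R (1 * h (snd p)))"
      using order_trans[OF B abs_ge_self] by (auto simp: norm_mult intro!: AE_I2 mult_right_mono)
  qed auto
  then show ?thesis
    using P.Fubini_integral[of "\<lambda>x y. K x y * h y"] by (simp add: case_prod_beta')
qed

end

subsection \<open>The convolution algebra of continuous functions\<close>

lemma Cauchy_Schwarz_integral:
  fixes f g :: "'a \<Rightarrow> complex"
  assumes [measurable]: "f \<in> borel_measurable M" "g \<in> borel_measurable M"
    and f2: "integrable M (\<lambda>x. (cmod (f x))\<^sup>2)" and g2: "integrable M (\<lambda>x. (cmod (g x))\<^sup>2)"
  shows "integrable M (\<lambda>x. f x * g x)"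
    and "(\<integral>x. cmod (f x) * cmod (g x) \<partial>M)\<^sup>2 \<le> (\<integral>x. (cmod (f x))\<^sup>2 \<partial>M) * (\<integral>x. (cmod (g x))\<^sup>2 \<partial>M)"
    and "(cmod (\<integral>x. f x * g x \<partial>M))\<^sup>2 \<le> (\<integral>x. (cmod (f x))\<^sup>2 \<partial>M) * (\<integral>x. (cmod (g x))\<^sup>2 \<partial>M)"
proof -
  have le: "a * b \<le> a\<^sup>2 + b\<^sup>2" if "a \<ge> 0" "b \<ge> 0" for a b :: real
    using sum_squares_bound[of a b] mult_nonneg_nonneg[OF that] by linarith
  show fg: "integrable M (\<lambda>x. f x * g x)"
  proof (rule Bochner_Integration.integrable_bound)
    show "integrable M (\<lambda>x. (cmod (f x))\<^sup>2 + (cmod (g x))\<^sup>2)" using f2 g2 by simp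
  qed (auto simp: norm_mult le)
  then have fg': "integrable M (\<lambda>x. cmod (f x) * cmod (g x))"
    using integrable_norm[OF fg] by (simp add: norm_mult)
  define A B C where "A = (\<integral>x. (cmod (f x))\<^sup>2 \<partial>M)" and "B = (\<integral>x. (cmod (g x))\<^sup>2 \<partial>M)"
    and "C = (\<integral>x. cmod (f x) * cmod (g x) \<partial>M)"
  have nonneg: "0 \<le> s\<^sup>2 * A - 2 * s * t * C + t\<^sup>2 * B" for s t
  proof -
    have "0 \<le> (\<integral>x. (s * cmod (f x) - t * cmod (g x))\<^sup>2 \<partial>M)" by simp
    also have "\<dots> = (\<integral>x. s\<^sup>2 * (cmod (f x))\<^sup>2 - 2 * s * t * (cmod (f x) * cmod (g x)) + t\<^sup>2 * (cmod (g x))\<^sup>2 \<partial>M)"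
      by (intro Bochner_Integration.integral_cong) (auto simp: power2_eq_square algebra_simps)
    also have "\<dots> = s\<^sup>2 * A - 2 * s * t * C + t\<^sup>2 * B"
      using f2 g2 fg' unfolding A_def B_def C_def by simp
    finally show ?thesis .
  qed
  have B0: "B \<ge> 0" and C0: "C \<ge> 0" unfolding B_def C_def by simp_all
  show CS: "(\<integral>x. cmod (f x) * cmod (g x) \<partial>M)\<^sup>2 \<le> (\<integral>x. (cmod (f x))\<^sup>2 \<partial>M) * (\<integral>x. (cmod (g x))\<^sup>2 \<partial>M)"
    unfolding A_def[symmetric] B_def[symmetric] C_def[symmetric]
  proof (cases "B = 0")
    case False
    \<comment> \<open>The choice \<open>s = B\<close>, \<open>t = C\<close> turns the nonnegative
      quadratic form into \<open>B\<close> times its determinant.\<close>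
    have "0 \<le> B * (A * B - C\<^sup>2)"
      using nonneg[of B C] by (simp add: power2_eq_square algebra_simps)
    then show "C\<^sup>2 \<le> A * B" using False B0 by (simp add: zero_le_mult_iff)
  next
    case True
    have "C = 0"
    proof (rule ccontr)
      assume "C \<noteq> 0"
      \<comment> \<open>With \<open>B = 0\<close> the form is linear in \<open>t\<close>, and the
        chosen \<open>t\<close> makes it equal to -1.\<close>
      then show False
        using nonneg[of 1 "(A + 1) / (2 * C)"] True by (simp add: field_simps)
    qed
    then show "C\<^sup>2 \<le> A * B" using True by simp
  qed
  have "cmod (\<integral>x. f x * g x \<partial>M) \<le> C"
    unfolding C_def using integral_norm_bound[of M "\<lambda>x. f x * g x"] by (simp add: norm_mult)
  then show "(cmod (\<integral>x. f x * g x \<partial>M))\<^sup>2 \<le> (\<integral>x. (cmod (f x))\<^sup>2 \<partial>M) * (\<integral>x. (cmod (g x))\<^sup>2 \<partial>M)"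
    using CS unfolding C_def[symmetric] by (meson norm_ge_zero order_trans power_mono)
qed

context compact_haar
begin

lemma integral_translation_continuous:
  fixes u :: "'g \<Rightarrow> 'b::{banach, second_countable_topology}"
  assumes "continuous_on UNIV u"
  shows "(\<integral>x. u (a + x) \<partial>\<mu>) = (\<integral>x. u x \<partial>\<mu>)"
  by (intro integral_translation continuous_measurable assms)

lemma continuous_compose_group:
  fixes u :: "'g \<Rightarrow> 'b::topological_space"
  assumes "continuous_on UNIV u"
  shows "continuous_on S (\<lambda>x. u (- x))" "continuous_on S (\<lambda>x. u (a + x))" "continuous_on S (\<lambda>x. u (a - x))"
  by (intro continuous_on_compose2[OF assms] continuous_intros; simp)+

text \<open>Invariance under inversion follows from translation invariance: integrating
  \<open>u (y - x)\<close> first in \<open>x\<close> or first in \<open>y\<close> gives the two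
  sides.\<close>

lemma integral_minus_continuous:
  fixes u :: "'g \<Rightarrow> complex"
  assumes u: "continuous_on UNIV u"
  shows "(\<integral>x. u (- x) \<partial>\<mu>) = (\<integral>x. u x \<partial>\<mu>)"
proof -
  have "(\<integral>y. (\<integral>x. u (y - x) \<partial>\<mu>) * 1 \<partial>\<mu>) = (\<integral>x. (\<integral>y. u (y - x) * 1 \<partial>\<mu>) \<partial>\<mu>)"
    by (rule swap_integral) (auto intro!: continuous_on_compose2[OF u] continuous_intros)
  moreover have "(\<integral>x. u (y - x) \<partial>\<mu>) = (\<integral>x. u (- x) \<partial>\<mu>)" for y
    using integral_translation_continuous[OF continuous_compose_group(1)[OF u], of "- y"] by simp
  moreover have "(\<integral>y. u (y - x) \<partial>\<mu>) = (\<integral>x. u x \<partial>\<mu>)" for x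
    using integral_translation_continuous[OF u, of "- x"] by simp
  ultimately show ?thesis by simp
qed

definition conv :: "('g \<Rightarrow> complex) \<Rightarrow> ('g \<Rightarrow> complex) \<Rightarrow> 'g \<Rightarrow> complex" (infixl "\<star>" 70)
  where "(u \<star> v) x = (\<integral>y. u y * v (x - y) \<partial>\<mu>)"

text \<open>The involution of the convolution algebra: it conjugates all Fourier coefficients, so
  \<open>adj u = u\<close> says that convolution by \<open>u\<close> is a self-adjoint operator on
  L2.\<close>

definition adj :: "('g \<Rightarrow> complex) \<Rightarrow> 'g \<Rightarrow> complex"
  where "adj u x = cnj (u (- x))"

lemma continuous_adj: "continuous_on UNIV u \<Longrightarrow> continuous_on UNIV (adj u)"
  unfolding adj_def[abs_def] by (intro continuous_intros continuous_compose_group)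

lemma adj_adj [simp]: "adj (adj u) = u"
  by (simp add: adj_def fun_eq_iff)

lemma continuous_conv:
  assumes h: "integrable \<mu> h" and k: "continuous_on UNIV k"
  shows "continuous_on UNIV (h \<star> k)"
  unfolding continuous_on_eq_continuous_at[OF open_UNIV] isCont_def
proof (intro ballI tendstoI)
  fix x0 and e :: real assume e: "e > 0"
  define H where "H = (\<integral>y. norm (h y) \<partial>\<mu>)"
  have H: "H \<ge> 0" unfolding H_def by simp
  have kk: "continuous_on (UNIV \<times> UNIV) (\<lambda>p. k (fst p - snd p))"
    by (intro continuous_on_compose2[OF k] continuous_intros) auto
  \<comment> \<open>A tube argument makes the approximation uniform in the integration variable.
    Dividing by \<open>H + 1\<close> covers \<open>H = 0\<close> and keeps the final estimate
    strict.\<close>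
  obtain X where X: "x0 \<in> X" "open X"
    "\<forall>x\<in>X \<inter> UNIV. \<forall>y\<in>UNIV. dist (k (fst (x, y) - snd (x, y))) (k (fst (x0, y) - snd (x0, y))) \<le> e / (H + 1)"
    by (rule continuous_on_prod_compactE[OF kk compact_univ, of x0 "e / (H + 1)"]) (use e H in auto)
  have int: "integrable \<mu> (\<lambda>y. h y * k (x - y))" for x
    by (intro integrable_mult_continuous h continuous_compose_group k)
  have "dist ((h \<star> k) x) ((h \<star> k) x0) < e" if "x \<in> X" for x
  proof -
    have "dist ((h \<star> k) x) ((h \<star> k) x0) = norm (\<integral>y. h y * (k (x - y) - k (x0 - y)) \<partial>\<mu>)"
      using int by (simp add: conv_def dist_norm algebra_simps)
    also have "\<dots> \<le> (\<integral>y. norm (h y * (k (x - y) - k (x0 - y))) \<partial>\<mu>)"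
      by (rule integral_norm_bound)
    also have "\<dots> \<le> (\<integral>y. norm (h y) * (e / (H + 1)) \<partial>\<mu>)"
    proof (rule integral_mono_AE)
      show "integrable \<mu> (\<lambda>y. norm (h y * (k (x - y) - k (x0 - y))))"
        using int by (intro integrable_norm) (simp add: algebra_simps)
      show "integrable \<mu> (\<lambda>y. norm (h y) * (e / (H + 1)))" using h by simp
    qed (use X(3) that in \<open>auto simp: norm_mult dist_norm simp del: times_divide_eq_right intro!: mult_left_mono AE_I2\<close>)
    also have "\<dots> = H * (e / (H + 1))" by (simp add: H_def)
    also have "\<dots> < e" using H e by (simp add: field_simps)
    finally show ?thesis .
  qed
  then show "\<forall>\<^sub>F x in at x0. dist ((h \<star> k) x) ((h \<star> k) x0) < e"
    using X(1,2) unfolding eventually_at_topological by blast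
qed

lemma conv_comm:
  assumes u: "continuous_on UNIV u" and v: "continuous_on UNIV v"
  shows "u \<star> v = v \<star> u"
proof
  fix x
  define F where "F y = u y * v (x - y)" for y
  have F: "continuous_on UNIV F"
    unfolding F_def[abs_def] by (intro continuous_intros u continuous_compose_group v)
  have "(\<integral>y. F (x + - y) \<partial>\<mu>) = (\<integral>y. F (x + y) \<partial>\<mu>)"
    using integral_minus_continuous[OF continuous_compose_group(2)[OF F]] .
  also have "\<dots> = (\<integral>y. F y \<partial>\<mu>)"
    by (rule integral_translation_continuous[OF F])
  finally show "(u \<star> v) x = (v \<star> u) x"
    by (simp add: F_def conv_def mult.commute)
qed

lemma conv_assoc:
  assumes h: "integrable \<mu> h" and v: "continuous_on UNIV v" and w: "continuous_on UNIV w"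
  shows "(h \<star> v) \<star> w = h \<star> (v \<star> w)"
proof
  fix x
  have "(\<integral>z. (\<integral>y. v (y - z) * w (x - y) \<partial>\<mu>) * h z \<partial>\<mu>) = (\<integral>y. (\<integral>z. v (y - z) * w (x - y) * h z \<partial>\<mu>) \<partial>\<mu>)"
    by (intro swap_integral h continuous_intros continuous_on_compose2[OF v] continuous_on_compose2[OF w]) auto
  moreover have "(\<integral>y. v (y - z) * w (x - y) \<partial>\<mu>) = (v \<star> w) (x - z)" for z
  proof -
    have "continuous_on UNIV (\<lambda>y. v (y - z) * w (x - y))"
      by (intro continuous_intros continuous_on_compose2[OF v] continuous_on_compose2[OF w]) auto
    from integral_translation_continuous[OF this, of z] show ?thesis
      by (simp add: conv_def algebra_simps)
  qed
  moreover have "(\<integral>z. v (y - z) * w (x - y) * h z \<partial>\<mu>) = (h \<star> v) y * w (x - y)" for y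
  proof -
    have "(\<integral>z. v (y - z) * w (x - y) * h z \<partial>\<mu>) = (\<integral>z. h z * v (y - z) * w (x - y) \<partial>\<mu>)"
      by (simp add: mult_ac)
    then show ?thesis by (simp add: conv_def)
  qed
  ultimately show "((h \<star> v) \<star> w) x = (h \<star> (v \<star> w)) x"
    by (simp add: conv_def mult.commute)
qed

lemma adj_conv:
  assumes u: "continuous_on UNIV u" and v: "continuous_on UNIV v"
  shows "adj (u \<star> v) = adj u \<star> adj v"
proof
  fix x
  have "continuous_on UNIV (\<lambda>y. cnj (u y * v (- x - y)))"
    by (intro continuous_intros u continuous_compose_group v)
  from integral_minus_continuous[OF this]
  have "(\<integral>y. cnj (u (- y)) * cnj (v (- (x - y))) \<partial>\<mu>) = (\<integral>y. cnj (u y * v (- x - y)) \<partial>\<mu>)"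
    by simp
  also have "\<dots> = cnj (\<integral>y. u y * v (- x - y) \<partial>\<mu>)"
    by (rule Bochner_Integration.integral_cnj)
  finally show "adj (u \<star> v) x = (adj u \<star> adj v) x"
    by (simp add: adj_def conv_def)
qed

lemma conv_add_left:
  assumes "continuous_on UNIV u" "continuous_on UNIV v" "continuous_on UNIV w"
  shows "(\<lambda>x. u x + v x) \<star> w = (\<lambda>x. (u \<star> w) x + (v \<star> w) x)"
proof
  fix x
  have "integrable \<mu> (\<lambda>y. u y * w (x - y))" "integrable \<mu> (\<lambda>y. v y * w (x - y))"
    by (intro continuous_integrable continuous_intros assms continuous_compose_group)+
  then show "((\<lambda>x. u x + v x) \<star> w) x = (u \<star> w) x + (v \<star> w) x"
    by (simp add: conv_def distrib_right)
qed

lemma conv_scale_left: "(\<lambda>x. c * u x) \<star> w = (\<lambda>x. c * (u \<star> w) x)"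
  by (simp add: conv_def fun_eq_iff mult.assoc)

lemma conv_scale_right: "u \<star> (\<lambda>x. c * w x) = (\<lambda>x. c * (u \<star> w) x)"
  by (simp add: conv_def fun_eq_iff mult.left_commute)

lemma conv_diff_left:
  assumes "continuous_on UNIV u" "continuous_on UNIV v" "continuous_on UNIV w"
  shows "(\<lambda>x. u x - v x) \<star> w = (\<lambda>x. (u \<star> w) x - (v \<star> w) x)"
proof
  fix x
  have "integrable \<mu> (\<lambda>y. u y * w (x - y))" "integrable \<mu> (\<lambda>y. v y * w (x - y))"
    by (intro continuous_integrable continuous_intros assms continuous_compose_group)+
  then show "((\<lambda>x. u x - v x) \<star> w) x = (u \<star> w) x - (v \<star> w) x"
    by (simp add: conv_def left_diff_distrib)
qed

text \<open>Convolution commutes with translation. Hence whatever absorbs a function also absorbs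
  all of its translates.\<close>

lemma conv_translate_right: "u \<star> (\<lambda>x. w (a + x)) = (\<lambda>x. (u \<star> w) (a + x))"
  by (simp add: conv_def fun_eq_iff algebra_simps)

section \<open>Squared norms and values at zero\<close>

definition sqnorm :: "('g \<Rightarrow> complex) \<Rightarrow> real"
  where "sqnorm u = (\<integral>x. (cmod (u x))\<^sup>2 \<partial>\<mu>)"

lemma sqnorm_nonneg [simp]: "0 \<le> sqnorm u"
  by (simp add: sqnorm_def)

text \<open>Evaluation at zero plays the role of a trace: squared L2 norms become identities in the
  convolution algebra.\<close>

lemma conv_adj_zero: "(u \<star> adj u) 0 = of_real (sqnorm u)"
  by (simp add: conv_def adj_def sqnorm_def flip: complex_norm_square integral_complex_of_real)

lemma sqnorm_reflect:
  assumes u: "continuous_on UNIV u"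
  shows "(\<integral>y. (cmod (u (x - y)))\<^sup>2 \<partial>\<mu>) = sqnorm u"
proof -
  have "continuous_on UNIV (\<lambda>y. complex_of_real ((cmod (u (x + y)))\<^sup>2))"
    by (intro continuous_intros continuous_compose_group u)
  from integral_minus_continuous[OF this]
  have "(\<integral>y. (cmod (u (x - y)))\<^sup>2 \<partial>\<mu>) = (\<integral>y. (cmod (u (x + y)))\<^sup>2 \<partial>\<mu>)"
    by (simp only: integral_complex_of_real of_real_eq_iff) simp
  also have "\<dots> = sqnorm u"
    unfolding sqnorm_def by (rule integral_translation_continuous) (intro continuous_intros u)
  finally show ?thesis .
qed

text \<open>Cauchy-Schwarz. This is the passage from L2 to uniform estimates: convolving with a
  fixed function turns L2 convergence into uniform convergence.\<close>

lemma conv_bound: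
  assumes u: "continuous_on UNIV u" and v: "continuous_on UNIV v"
  shows "(cmod ((u \<star> v) x))\<^sup>2 \<le> sqnorm u * sqnorm v"
proof -
  note c = continuous_compose_group(3)[OF v, of UNIV x]
  have "(cmod ((u \<star> v) x))\<^sup>2 \<le> (\<integral>y. (cmod (u y))\<^sup>2 \<partial>\<mu>) * (\<integral>y. (cmod (v (x - y)))\<^sup>2 \<partial>\<mu>)"
    unfolding conv_def by (rule Cauchy_Schwarz_integral) (auto intro!: u c continuous_intros continuous_integrable)
  then show ?thesis using sqnorm_reflect[OF v] by (simp add: sqnorm_def)
qed

text \<open>By compactness finitely many translates of a nonempty open set cover the group.\<close>
lemma emeasure_open_pos:
  assumes "open U" "U \<noteq> {}"
  shows "emeasure \<mu> U > 0"
proof (rule ccontr)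
  assume "\<not> emeasure \<mu> U > 0"
  then have U0: "emeasure \<mu> U = 0" by simp
  obtain x0 where x0: "x0 \<in> U" using assms by blast
  define V where "V a = (\<lambda>x. a + x) -` U" for a
  have opV: "open (V a)" for a
    unfolding V_def using assms(1) by (intro open_vimage continuous_intros)
  have V0: "emeasure \<mu> (V a) = 0" for a
  proof -
    have "V a = (+) (- a) ` U" unfolding V_def by (force simp: image_iff algebra_simps)
    then show ?thesis using emeasure_translation[of U "- a"] U0 assms(1) by simp
  qed
  have "UNIV \<subseteq> (\<Union>a\<in>UNIV. V a)"
  proof
    fix x
    have "x \<in> V (x0 - x)" using x0 by (simp add: V_def)
    then show "x \<in> (\<Union>a\<in>UNIV. V a)" by blast
  qed
  from compactE_image[OF compact_univ _ this] opV
  obtain F where F: "finite F" "UNIV \<subseteq> (\<Union>a\<in>F. V a)" by auto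
  have "emeasure \<mu> UNIV \<le> emeasure \<mu> (\<Union>a\<in>F. V a)"
    using F opV by (intro emeasure_mono) auto
  also have "\<dots> \<le> (\<Sum>a\<in>F. emeasure \<mu> (V a))"
    using F opV by (intro emeasure_subadditive_finite) auto
  finally show False by (simp add: V0)
qed

lemma sqnorm_pos:
  assumes u: "continuous_on UNIV u" and "u x \<noteq> 0"
  shows "sqnorm u > 0"
proof (rule ccontr)
  assume "\<not> sqnorm u > 0"
  then have "sqnorm u = 0" using sqnorm_nonneg[of u] by linarith
  then have "(\<integral>x. (cmod (u x))\<^sup>2 \<partial>\<mu>) = 0" by (simp add: sqnorm_def)
  then have "AE x in \<mu>. (cmod (u x))\<^sup>2 = 0"
    by (subst (asm) integral_nonneg_eq_0_iff_AE) (auto intro!: continuous_integrable continuous_intros u)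
  then have "AE x in \<mu>. x \<notin> u -` (- {0})" by auto
  moreover have "open (u -` (- {0}))" using u by (intro open_vimage) auto
  ultimately have "emeasure \<mu> (u -` (- {0})) = 0"
    by (subst (asm) AE_iff_measurable[OF _ refl]) (auto simp: vimage_def)
  with emeasure_open_pos[OF \<open>open (u -` (- {0}))\<close>] \<open>u x \<noteq> 0\<close> show False by auto
qed

end

subsection \<open>Idempotents and characters\<close>

context compact_haar
begin

text \<open>The \<open>n\<close>-th entry is the \<open>(n + 1)\<close>-st convolution power, as there is no unit for convolution.\<close>
primrec cpow :: "('g \<Rightarrow> complex) \<Rightarrow> nat \<Rightarrow> 'g \<Rightarrow> complex"
  where "cpow u 0 = u" | "cpow u (Suc n) = u \<star> cpow u n"

lemma continuous_conv': "continuous_on UNIV u \<Longrightarrow> continuous_on UNIV v \<Longrightarrow> continuous_on UNIV (u \<star> v)"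
  by (intro continuous_conv continuous_integrable)

lemma continuous_cpow: "continuous_on UNIV u \<Longrightarrow> continuous_on UNIV (cpow u n)"
  by (induction n) (auto intro: continuous_conv')

lemma cpow_conv_cpow:
  assumes "continuous_on UNIV u"
  shows "cpow u m \<star> cpow u n = cpow u (Suc (m + n))"
proof (induction m)
  case (Suc m)
  then show ?case
    by (simp add: conv_assoc continuous_integrable continuous_cpow assms)
qed simp

lemma adj_cpow:
  assumes u: "continuous_on UNIV u" and "adj u = u"
  shows "adj (cpow u n) = cpow u n"
proof (induction n)
  case (Suc n)
  then show ?case
    by (simp add: adj_conv u continuous_cpow assms(2))
qed (simp add: assms)

text \<open>Convolution by such a \<open>q\<close> is an orthogonal projection of L2; zero is
  excluded so that minimality can be stated among these functions.\<close>

definition idem :: "('g \<Rightarrow> complex) \<Rightarrow> bool"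
  where "idem q \<longleftrightarrow> continuous_on UNIV q \<and> adj q = q \<and> q \<star> q = q \<and> q \<noteq> (\<lambda>_. 0)"

text \<open>The spectral projection onto the top eigenvalue \<open>r\<close> of convolution by \<open>u \<star> u\<close> is the limit of
  the powers of \<open>u \<star> u / r\<close>. The squared \<open>L\<^sup>2\<close> norms \<open>c n\<close> of the powers of \<open>u\<close> are log-convex
  and submultiplicative, which gives \<open>r ^ (n + 1) \<le> c n\<close> and keeps the limit away from zero.\<close>
lemma idem_of_self_adjoint:
  assumes u: "continuous_on UNIV u" and sa: "adj u = u" and nz: "u \<noteq> (\<lambda>_. 0)"
  obtains r :: real and q where "r > 0" "idem q" "(u \<star> u) \<star> q = (\<lambda>x. of_real r * q x)"
proof -
  define U where "U = cpow u"
  define c where "c n = sqnorm (U n)" for n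
  have cU: "continuous_on UNIV (U n)" for n
    unfolding U_def by (rule continuous_cpow[OF u])
  have aU: "adj (U n) = U n" for n
    unfolding U_def by (rule adj_cpow[OF u sa])
  have UU: "U m \<star> U n = U (Suc (m + n))" for m n
    unfolding U_def by (rule cpow_conv_cpow[OF u])
  \<comment> \<open>The entry \<open>Suc (m + m)\<close> is the power of \<open>u\<close> with
    exponent \<open>2 * m + 2\<close>, the square of \<open>U m\<close>. By self-adjointness its
    value at zero is a squared norm.\<close>
  have U0: "U (Suc (m + m)) 0 = of_real (c m)" for m
    using conv_adj_zero[of "U m"] by (simp add: aU UU c_def)
  have bound: "(cmod (U (Suc (m + n)) x))\<^sup>2 \<le> c m * c n" for m n x
    using conv_bound[OF cU cU, of m n x] by (simp add: UU c_def)
  have bound1: "cmod (U (Suc (m + m)) x) \<le> c m" for m x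
    using bound[of m m x] by (simp add: c_def abs_le_square_iff[symmetric] flip: power2_eq_square)
  have c_nonneg: "c n \<ge> 0" for n unfolding c_def by simp
  \<comment> \<open>The left side is the value at zero of a convolution of two even powers, which
    are bounded pointwise by \<open>c m\<close> and \<open>c n\<close>; the total mass is
    one.\<close>
  have submult: "c (Suc (m + n)) \<le> c m * c n" for m n
  proof -
    have "U (Suc (m + m)) \<star> U (Suc (n + n)) = U (Suc (Suc (m + n) + Suc (m + n)))"
      by (simp add: UU algebra_simps)
    then have "of_real (c (Suc (m + n))) = (\<integral>y. U (Suc (m + m)) y * U (Suc (n + n)) (0 - y) \<partial>\<mu>)"
      using U0[of "Suc (m + n)"] by (metis conv_def)
    then have "c (Suc (m + n)) = norm (\<integral>y. U (Suc (m + m)) y * U (Suc (n + n)) (0 - y) \<partial>\<mu>)"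
      using c_nonneg by (metis abs_of_nonneg norm_of_real)
    also have "\<dots> \<le> (\<integral>y. norm (U (Suc (m + m)) y * U (Suc (n + n)) (0 - y)) \<partial>\<mu>)"
      by (rule integral_norm_bound)
    also have "\<dots> \<le> (\<integral>y. c m * c n \<partial>\<mu>)"
    proof (rule integral_mono)
      show "integrable \<mu> (\<lambda>y. norm (U (Suc (m + m)) y * U (Suc (n + n)) (0 - y)))"
        by (intro continuous_integrable continuous_intros cU continuous_compose_group)
      show "norm (U (Suc (m + m)) y * U (Suc (n + n)) (0 - y)) \<le> c m * c n" for y
        using mult_mono[OF bound1[of m y] bound1[of n "0 - y"]] c_nonneg by (simp add: norm_mult)
    qed simp
    finally show ?thesis by simp
  qed
  \<comment> \<open>The same even power is split evenly on the left, where it is a squared norm, and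
    as \<open>n\<close> and \<open>n + 2\<close> on the right, where Cauchy-Schwarz applies.\<close>
  have logconv: "(c (Suc n))\<^sup>2 \<le> c n * c (Suc (Suc n))" for n
  proof -
    have "U (Suc (Suc n + Suc n)) 0 = U (Suc (n + Suc (Suc n))) 0" by simp
    then show ?thesis using bound[of n "Suc (Suc n)" 0] U0[of "Suc n"] c_nonneg by simp
  qed
  have c0: "c 0 > 0"
    using nz sqnorm_pos[OF u] unfolding c_def U_def by force
  \<comment> \<open>Log-convexity links three consecutive terms, so the induction carries two. It
    starts because \<open>U 1\<close> takes the nonzero value \<open>c 0\<close> at zero.\<close>
  have c_pos: "c n > 0" for n
  proof -
    have "c n > 0 \<and> c (Suc n) > 0"
    proof (induction n)
      case 0
      have "U 1 0 \<noteq> 0" using U0[of 0] c0 by simp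
      then show ?case using c0 sqnorm_pos[OF cU] unfolding c_def by simp
    next
      case (Suc n)
      then have "0 < c n * c (Suc (Suc n))" using logconv[of n] by (smt (verit) zero_less_power)
      with Suc show ?case by (simp add: zero_less_mult_iff)
    qed
    then show ?thesis by simp
  qed
  \<comment> \<open>The quotients increase by log-convexity and stay below \<open>c 0\<close> by
    submultiplicativity; their limit \<open>r\<close> is the rescaling factor.\<close>
  define \<rho> where "\<rho> n = c (Suc n) / c n" for n
  have \<rho>_mono: "incseq \<rho>"
    unfolding \<rho>_def using logconv c_pos by (intro incseq_SucI) (simp add: field_simps power2_eq_square)
  have \<rho>_pos: "\<rho> n > 0" for n unfolding \<rho>_def using c_pos by simp
  have \<rho>_bdd: "\<rho> n \<le> c 0" for n
    unfolding \<rho>_def using submult[of 0 n] c_pos by (simp add: field_simps)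
  obtain r where r: "\<rho> \<longlonglongrightarrow> r" "\<And>n. \<rho> n \<le> r"
    using incseq_convergent[OF \<rho>_mono, of "c 0"] \<rho>_bdd by blast
  have r0: "r > 0" using r(2)[of 0] \<rho>_pos[of 0] by linarith
  have growth: "c j * \<rho> j ^ k \<le> c (j + k)" for j k
  proof (induction k)
    case (Suc k)
    have "c j * \<rho> j ^ Suc k \<le> c (j + k) * \<rho> j"
      using Suc \<rho>_pos[of j] by (simp add: mult_right_mono)
    also have "\<dots> \<le> c (j + k) * \<rho> (j + k)"
      using incseqD[OF \<rho>_mono, of j "j + k"] c_nonneg by (intro mult_left_mono) auto
    also have "\<dots> = c (j + Suc k)" unfolding \<rho>_def using c_pos[of "j + k"] by simp
    finally show ?case .
  qed simp
  have r_le: "r ^ Suc m \<le> c m" for m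
  proof -
    \<comment> \<open>For fixed \<open>j\<close>, growth at rate \<open>\<rho> j\<close> starting
      from \<open>c j\<close> is compared with submultiplicativity, and \<open>c j\<close> cancels.
      The claim for \<open>r\<close> is the limit in \<open>j\<close>.\<close>
    have "\<rho> j ^ Suc m \<le> c m" for j
    proof -
      have "c j * \<rho> j ^ Suc m \<le> c j * c m" using growth[of j "Suc m"] submult[of j m] by simp
      then show ?thesis using c_pos[of j] by (simp only: mult_le_cancel_left_pos)
    qed
    then show ?thesis
      using LIMSEQ_le_const2[OF tendsto_power[OF r(1), of "Suc m"]] by blast
  qed
  \<comment> \<open>The squared norms after rescaling. They decrease to some \<open>\<beta>\<close>
    that is at least one, and \<open>\<beta>\<close> will be the value of the idempotent at
    zero.\<close>
  define b where "b n = c n / r ^ Suc n" for n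
  have b_ge: "b n \<ge> 1" for n
    unfolding b_def using r_le[of n] r0 by simp
  have b_dec: "decseq b"
  proof (rule decseq_SucI)
    fix n
    have "b (Suc n) = b n * (\<rho> n / r)"
      unfolding b_def \<rho>_def using c_pos[of n] r0 by simp
    also have "\<dots> \<le> b n * 1"
      using r(2)[of n] r0 b_ge[of n] by (intro mult_left_mono) auto
    finally show "b (Suc n) \<le> b n" by simp
  qed
  obtain \<beta> where \<beta>: "b \<longlonglongrightarrow> \<beta>"
    using decseq_convergent[OF b_dec, of 1] b_ge by blast
  have \<beta>1: "\<beta> \<ge> 1" using LIMSEQ_le_const[OF \<beta>] b_ge by blast
  define Q where "Q n x = U (Suc (n + n)) x / of_real (r ^ Suc n)" for n x
  have Q_scale: "Q n = (\<lambda>x. of_real (inverse (r ^ Suc n)) * U (Suc (n + n)) x)" for n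
    by (simp add: Q_def fun_eq_iff divide_inverse mult.commute)
  have cQ: "continuous_on UNIV (Q n)" for n
    unfolding Q_scale by (intro continuous_intros cU)
  have QQ: "(Q m \<star> Q n) 0 = of_real (b (Suc (m + n)))" for m n
  proof -
    have "U (Suc (m + m)) \<star> U (Suc (n + n)) = U (Suc (Suc (m + n) + Suc (m + n)))"
      by (simp add: UU algebra_simps)
    then have "(U (Suc (m + m)) \<star> U (Suc (n + n))) 0 = of_real (c (Suc (m + n)))"
      using U0[of "Suc (m + n)"] by simp
    then show ?thesis
      unfolding Q_scale conv_scale_left conv_scale_right
      by (simp add: b_def power_add field_simps)
  qed
  have aQ: "adj (Q n) = Q n" for n
    using aU[of "Suc (n + n)"] by (simp add: Q_def adj_def fun_eq_iff)
  \<comment> \<open>The distances of the rescaled powers involve the sequence \<open>b\<close> only,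
    so its convergence makes them Cauchy in L2.\<close>
  have sq_diff: "sqnorm (\<lambda>x. Q m x - Q n x) = b (Suc (m + m)) - 2 * b (Suc (m + n)) + b (Suc (n + n))" for m n
  proof -
    define D where "D x = Q m x - Q n x" for x
    have cD: "continuous_on UNIV D" unfolding D_def[abs_def] by (intro continuous_intros cQ)
    have aD: "adj D = D"
      using aQ[of m] aQ[of n] by (simp add: D_def adj_def fun_eq_iff)
    have DD: "D \<star> D = (\<lambda>x. (Q m \<star> D) x - (Q n \<star> D) x)"
      by (subst (1) D_def[abs_def]) (intro conv_diff_left cQ cD)
    have QD: "Q k \<star> D = (\<lambda>x. (Q m \<star> Q k) x - (Q n \<star> Q k) x)" for k
      by (subst conv_comm[OF cQ cD]) (simp add: D_def[abs_def] conv_diff_left cQ)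
    have "complex_of_real (sqnorm D) = (D \<star> D) 0" using conv_adj_zero[of D] aD by simp
    also have "\<dots> = of_real (b (Suc (m + m)) - 2 * b (Suc (m + n)) + b (Suc (n + n)))"
      unfolding DD QD QQ by (simp add: add.commute[of n m])
    finally have "complex_of_real (sqnorm D) = of_real (b (Suc (m + m)) - 2 * b (Suc (m + n)) + b (Suc (n + n)))" .
    then show ?thesis unfolding D_def[symmetric] of_real_eq_iff .
  qed
  have PQ: "U 1 \<star> Q n = (\<lambda>x. of_real r * Q (Suc n) x)" for n
    unfolding Q_scale conv_scale_right UU using r0 by (simp add: fun_eq_iff field_simps)
  \<comment> \<open>One further convolution with \<open>U 1\<close>, which is
    \<open>u \<star> u\<close>, upgrades L2 closeness of the \<open>Q n\<close> to uniform
    closeness, at the price of the factor \<open>r\<close> and of the index shift to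
    \<open>Suc n\<close>.\<close>
  have uc: "uniformly_convergent_on UNIV (\<lambda>n. Q (Suc n))"
  proof (intro Cauchy_uniformly_convergent uniformly_Cauchy_onI)
    fix e :: real assume e: "e > 0"
    \<comment> \<open>Chosen so that \<open>c 1 * e'\<close> is the square of \<open>r * e\<close>,
      where \<open>c 1\<close> is the squared norm of \<open>U 1\<close>. The tolerance
      \<open>e' / 4\<close> is spent four times in \<open>sq_diff\<close>, whose middle term has
      coefficient 2.\<close>
    define e' where "e' = (r * e)\<^sup>2 / c 1"
    have e': "e' > 0" unfolding e'_def using e r0 c_pos by simp
    obtain M where M: "\<And>n. n \<ge> M \<Longrightarrow> \<bar>b n - \<beta>\<bar> < e' / 4"
      using LIMSEQ_D[OF \<beta>, of "e' / 4"] e' by auto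
    show "\<exists>M. \<forall>x\<in>UNIV. \<forall>m\<ge>M. \<forall>n\<ge>M. dist (Q (Suc m) x) (Q (Suc n) x) < e"
    proof (intro exI[of _ M] ballI allI impI)
      fix x m n assume mn: "M \<le> m" "M \<le> n"
      define D where "D x = Q m x - Q n x" for x
      have cD: "continuous_on UNIV D" unfolding D_def[abs_def] by (intro continuous_intros cQ)
      have "\<bar>b (Suc (m + m)) - \<beta>\<bar> < e' / 4" "\<bar>b (Suc (m + n)) - \<beta>\<bar> < e' / 4"
        "\<bar>b (Suc (n + n)) - \<beta>\<bar> < e' / 4" by (rule M, use mn in simp)+
      then have "sqnorm D < e'"
        unfolding D_def[abs_def] sq_diff abs_less_iff by linarith
      have "(U 1 \<star> D) x = (D \<star> U 1) x" using conv_comm[OF cU cD] by simp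
      also have "\<dots> = (Q m \<star> U 1) x - (Q n \<star> U 1) x"
        by (simp add: D_def[abs_def] conv_diff_left cQ cU)
      also have "\<dots> = of_real r * (Q (Suc m) x - Q (Suc n) x)"
        using PQ[of m] PQ[of n] by (simp add: conv_comm[OF cQ cU] algebra_simps)
      finally have "(r * dist (Q (Suc m) x) (Q (Suc n) x))\<^sup>2 = (cmod ((U 1 \<star> D) x))\<^sup>2"
        using r0 by (simp add: dist_norm norm_mult)
      also have "\<dots> \<le> c 1 * sqnorm D"
        using conv_bound[OF cU cD] by (simp add: c_def)
      also have "\<dots> < c 1 * e'" using \<open>sqnorm D < e'\<close> c_pos by simp
      also have "\<dots> = (r * e)\<^sup>2" unfolding e'_def using c_pos[of 1] by simp
      finally have "r * dist (Q (Suc m) x) (Q (Suc n) x) < r * e"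
        using e r0 by (intro power2_less_imp_less[of _ "r * e"]) auto
      then show "dist (Q (Suc m) x) (Q (Suc n) x) < e" using r0 by simp
    qed
  qed
  then obtain q where q: "uniform_limit UNIV (\<lambda>n. Q (Suc n)) q sequentially"
    unfolding uniformly_convergent_on_def by blast
  have cq: "continuous_on UNIV q"
    by (rule uniform_limit_theorem[OF _ q]) (auto intro: always_eventually cQ)
  have lim: "(\<lambda>n. Q (Suc n) x) \<longlonglongrightarrow> q x" for x
    using tendsto_uniform_limitI[OF q] by simp
  have aq: "adj q = q"
  proof
    fix x
    have "(\<lambda>n. cnj (Q (Suc n) (- x))) \<longlonglongrightarrow> cnj (q (- x))" by (intro tendsto_intros lim)
    moreover have "cnj (Q (Suc n) (- x)) = Q (Suc n) x" for n
      using aQ[of "Suc n"] by (metis adj_def)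
    ultimately have "(\<lambda>n. Q (Suc n) x) \<longlonglongrightarrow> adj q x" by (simp add: adj_def)
    then show "adj q x = q x" using lim LIMSEQ_unique by blast
  qed
  have conv_lim: "(\<lambda>n. (Q (Suc n) \<star> w) x) \<longlonglongrightarrow> (q \<star> w) x" if w: "continuous_on UNIV w" for w x
  proof -
    \<comment> \<open>Uniform convergence supplies a dominating function only from index
      \<open>N\<close> on, hence the shifted sequence.\<close>
    obtain N where N: "\<And>n y. n \<ge> N \<Longrightarrow> dist (Q (Suc n) y) (q y) < 1"
      using q unfolding uniform_limit_sequentially_iff by (metis UNIV_I zero_less_one)
    have "(\<lambda>n. (Q (Suc (n + N)) \<star> w) x) \<longlonglongrightarrow> (q \<star> w) x"
      unfolding conv_def
    proof (rule integral_dominated_convergence[where w="\<lambda>y. (norm (q y) + 1) * norm (w (x - y))"])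
      show "(\<lambda>y. q y * w (x - y)) \<in> borel_measurable \<mu>"
        by (intro continuous_measurable continuous_intros cq continuous_compose_group w)
      show "(\<lambda>y. Q (Suc (n + N)) y * w (x - y)) \<in> borel_measurable \<mu>" for n
        by (intro continuous_measurable continuous_intros cQ continuous_compose_group w)
      show "integrable \<mu> (\<lambda>y. (norm (q y) + 1) * norm (w (x - y)))"
        by (intro continuous_integrable continuous_intros cq continuous_compose_group w)
      show "AE y in \<mu>. (\<lambda>n. Q (Suc (n + N)) y * w (x - y)) \<longlonglongrightarrow> q y * w (x - y)"
        by (intro AE_I2 tendsto_intros LIMSEQ_ignore_initial_segment[OF lim])
      show "AE y in \<mu>. norm (Q (Suc (n + N)) y * w (x - y)) \<le> (norm (q y) + 1) * norm (w (x - y))" for n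
      proof (intro AE_I2)
        fix y
        have "norm (Q (Suc (n + N)) y) \<le> norm (q y) + 1"
          using N[of "n + N" y] norm_triangle_sub[of "Q (Suc (n + N)) y" "q y"]
          by (simp add: dist_norm)
        then show "norm (Q (Suc (n + N)) y * w (x - y)) \<le> (norm (q y) + 1) * norm (w (x - y))"
          by (simp add: norm_mult mult_right_mono)
      qed
    qed
    then show ?thesis by (rule LIMSEQ_offset)
  qed
  have Uq: "q \<star> U 1 = (\<lambda>x. of_real r * q x)"
  proof
    fix x
    have "(Q (Suc n) \<star> U 1) x = of_real r * Q (Suc (Suc n)) x" for n
      using PQ[of "Suc n"] by (simp add: conv_comm[OF cQ cU])
    then have "(\<lambda>n. of_real r * Q (Suc (Suc n)) x) \<longlonglongrightarrow> (q \<star> U 1) x"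
      using conv_lim[OF cU, of 1 x] by simp
    moreover have "(\<lambda>n. of_real r * Q (Suc (Suc n)) x) \<longlonglongrightarrow> of_real r * q x"
      by (intro tendsto_intros LIMSEQ_Suc[OF lim])
    ultimately show "(q \<star> U 1) x = of_real r * q x" by (rule LIMSEQ_unique)
  qed
  then have Pq: "U 1 \<star> q = (\<lambda>x. of_real r * q x)"
    using conv_comm[OF cq cU] by simp
  have Uq_pow: "U (Suc (n + n)) \<star> q = (\<lambda>x. of_real (r ^ Suc n) * q x)" for n
  proof (induction n)
    case 0
    then show ?case using Pq by simp
  next
    case (Suc n)
    have "U (Suc (Suc n + Suc n)) = U 1 \<star> U (Suc (n + n))" by (simp add: UU)
    then have "U (Suc (Suc n + Suc n)) \<star> q = U 1 \<star> (U (Suc (n + n)) \<star> q)"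
      by (simp only: conv_assoc continuous_integrable cU cq)
    also have "\<dots> = (\<lambda>x. of_real (r ^ Suc (Suc n)) * q x)"
      unfolding Suc conv_scale_right Pq by (simp add: fun_eq_iff)
    finally show ?case .
  qed
  \<comment> \<open>The limit is an eigenfunction of \<open>u \<star> u\<close> with eigenvalue
    \<open>r\<close>, so each rescaled power fixes it. Idempotence follows by letting
    \<open>n\<close> grow.\<close>
  have Qq: "Q n \<star> q = q" for n
    unfolding Q_scale conv_scale_left Uq_pow using r0 by (simp add: fun_eq_iff field_simps)
  have "q \<star> q = q"
    using conv_lim[OF cq] by (simp add: Qq fun_eq_iff LIMSEQ_const_iff)
  moreover have "q 0 = of_real \<beta>"
  proof -
    have "Q (Suc n) 0 = of_real (b (Suc n))" for n
      using U0[of "Suc n"] by (simp add: Q_def b_def)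
    then have "(\<lambda>n. complex_of_real (b (Suc n))) \<longlonglongrightarrow> q 0" using lim[of 0] by simp
    moreover have "(\<lambda>n. complex_of_real (b (Suc n))) \<longlonglongrightarrow> of_real \<beta>"
      by (intro tendsto_intros LIMSEQ_Suc \<beta>)
    ultimately show ?thesis by (rule LIMSEQ_unique)
  qed
  ultimately have "idem q"
    using cq aq \<beta>1 unfolding idem_def by force
  moreover have "u \<star> u = U 1" by (simp add: U_def)
  ultimately show thesis using that r0 Pq by metis
qed

text \<open>As \<open>r\<close> is invertible, \<open>q\<close> is a multiple of
  \<open>(u \<star> u) \<star> q\<close> and lies in the ideal generated by \<open>u\<close>, where
  \<open>e\<close> acts as the identity. This places the spectral idempotent of \<open>u\<close>
  below \<open>e\<close>.\<close>

lemma idem_of_absorbed: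
  assumes e: "continuous_on UNIV e" and u: "continuous_on UNIV u" and q: "continuous_on UNIV q"
    and eu: "e \<star> u = u" and "(u \<star> u) \<star> q = (\<lambda>x. of_real r * q x)" and "r > 0"
  shows "e \<star> q = q"
proof -
  have "e \<star> ((u \<star> u) \<star> q) = (u \<star> u) \<star> q"
    using eu by (metis conv_assoc continuous_conv' continuous_integrable e q u)
  then show ?thesis using assms(5,6) by (simp add: conv_scale_right fun_eq_iff)
qed

text \<open>Since \<open>q = q \<star> q\<close>, Cauchy-Schwarz bounds the squared modulus of
  \<open>q\<close> pointwise by the square of \<open>sqnorm q\<close>. Integrating over total mass
  one shows that the positive number \<open>sqnorm q\<close> is at most its own square.\<close>

lemma idem_zero:
  assumes "idem q"
  shows "q 0 = of_real (sqnorm q)" "sqnorm q \<ge> 1"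
proof -
  have q: "continuous_on UNIV q" "adj q = q" "q \<star> q = q" "q \<noteq> (\<lambda>_. 0)"
    using assms unfolding idem_def by auto
  show "q 0 = of_real (sqnorm q)" using conv_adj_zero[of q] q by simp
  have pos: "sqnorm q > 0" using sqnorm_pos[OF q(1)] q(4) by force
  have b: "(cmod (q x))\<^sup>2 \<le> (sqnorm q)\<^sup>2" for x
    using conv_bound[OF q(1) q(1), of x] q(3) by (simp add: power2_eq_square)
  have "sqnorm q \<le> (\<integral>x. (sqnorm q)\<^sup>2 \<partial>\<mu>)"
    unfolding sqnorm_def[of q]
    by (intro integral_mono continuous_integrable continuous_intros q b[unfolded sqnorm_def])
  then show "sqnorm q \<ge> 1" using pos by (simp add: power2_eq_square)
qed

text \<open>The hypothesis \<open>q \<star> p = p\<close> makes \<open>p\<close> a subprojection of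
  \<open>q\<close>. The complement is again a nonzero idempotent, values at zero add up, and the
  complement contributes at least one.\<close>

lemma idem_diff:
  assumes "idem q" "idem p" "q \<star> p = p" "p \<noteq> q"
  shows "idem (\<lambda>x. q x - p x)" "sqnorm p + 1 \<le> sqnorm q"
proof -
  have q: "continuous_on UNIV q" "adj q = q" "q \<star> q = q" and p: "continuous_on UNIV p" "adj p = p" "p \<star> p = p"
    using assms unfolding idem_def by auto
  define d where "d x = q x - p x" for x
  have cd: "continuous_on UNIV d" unfolding d_def[abs_def] by (intro continuous_intros q p)
  have pq: "p \<star> q = p" using assms(3) conv_comm p(1) q(1) by metis
  have "d \<star> d = (\<lambda>x. (q \<star> d) x - (p \<star> d) x)"
    by (subst (1) d_def[abs_def]) (intro conv_diff_left q p cd)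
  also have "q \<star> d = d"
    by (subst conv_comm[OF q(1) cd]) (simp add: d_def[abs_def] conv_diff_left p q pq)
  also have "p \<star> d = (\<lambda>x. 0)"
    by (subst conv_comm[OF p(1) cd]) (simp add: d_def[abs_def] conv_diff_left p q assms(3))
  finally have "d \<star> d = d" by simp
  moreover have "adj d = d"
    using fun_cong[OF q(2)] fun_cong[OF p(2)] by (simp add: d_def adj_def fun_eq_iff)
  moreover have "d \<noteq> (\<lambda>_. 0)" using assms(4) unfolding d_def fun_eq_iff by (metis eq_iff_diff_eq_0)
  ultimately have d: "idem d" using cd unfolding idem_def by blast
  then show "idem (\<lambda>x. q x - p x)" unfolding d_def[abs_def] .
  have "complex_of_real (sqnorm d) = of_real (sqnorm q - sqnorm p)"
    using idem_zero(1)[OF d] idem_zero(1)[OF assms(1)] idem_zero(1)[OF assms(2)] by (simp add: d_def)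
  then have "sqnorm d = sqnorm q - sqnorm p" by (simp only: of_real_eq_iff)
  then show "sqnorm p + 1 \<le> sqnorm q" using idem_zero(2)[OF d] by simp
qed

section \<open>Minimal idempotents and characters\<close>

definition minimal_idem :: "('g \<Rightarrow> complex) \<Rightarrow> bool"
  where "minimal_idem e \<longleftrightarrow> idem e \<and> (\<forall>p. idem p \<and> e \<star> p = p \<longrightarrow> p = e)"

text \<open>Descent on the integer part of the squared norm, which drops by at least one whenever an
  idempotent is replaced by a proper one below it.\<close>

lemma minimal_idem_below:
  assumes "idem q"
  shows "\<exists>e. minimal_idem e \<and> q \<star> e = e"
  using assms
proof (induction "nat \<lfloor>sqnorm q\<rfloor>" arbitrary: q rule: less_induct)
  case less
  show ?case
  proof (cases "minimal_idem q")
    case True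
    then show ?thesis using less.prems unfolding idem_def by blast
  next
    case False
    then obtain p where p: "idem p" "q \<star> p = p" "p \<noteq> q"
      using less.prems unfolding minimal_idem_def by blast
    have "sqnorm p + 1 \<le> sqnorm q" "sqnorm p \<ge> 1"
      using idem_diff(2)[OF less.prems p] idem_zero(2)[OF p(1)] by auto
    then have "nat \<lfloor>sqnorm p\<rfloor> < nat \<lfloor>sqnorm q\<rfloor>" by linarith
    then obtain e where e: "minimal_idem e" "p \<star> e = e" using less.hyps p(1) by blast
    have "q \<star> e = e"
    proof -
      have "(q \<star> p) \<star> e = q \<star> (p \<star> e)"
        using e(1) p(1) less.prems unfolding minimal_idem_def idem_def
        by (intro conv_assoc continuous_integrable) auto
      then show ?thesis using e(2) p(2) by simp
    qed
    then show ?thesis using e(1) by blast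
  qed
qed

text \<open>The spectral idempotent of \<open>u\<close> lies below \<open>e\<close> and equals
  \<open>e\<close> by minimality. Since \<open>e\<close> also absorbs \<open>u \<star> u\<close>,
  the eigenvalue equation exhibits \<open>u \<star> u\<close> itself as a multiple of
  \<open>e\<close>.\<close>

lemma minimal_idem_square:
  assumes e: "minimal_idem e" and u: "continuous_on UNIV u" "adj u = u" "e \<star> u = u"
  shows "\<exists>s. u \<star> u = (\<lambda>x. s * e x)"
proof (cases "u = (\<lambda>_. 0)")
  case True
  then show ?thesis by (auto simp: conv_def fun_eq_iff)
next
  case False
  obtain r q where q: "r > (0::real)" "idem q" "(u \<star> u) \<star> q = (\<lambda>x. of_real r * q x)"
    using idem_of_self_adjoint[OF u(1,2) False] .
  have ce: "continuous_on UNIV e" using e unfolding minimal_idem_def idem_def by blast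
  have cq: "continuous_on UNIV q" using q unfolding idem_def by blast
  have "e \<star> q = q" by (rule idem_of_absorbed[OF ce u(1) cq u(3) q(3,1)])
  then have "q = e" using e q(2) unfolding minimal_idem_def by blast
  moreover have "(u \<star> u) \<star> e = u \<star> u"
    using u ce by (metis conv_assoc conv_comm continuous_conv' continuous_integrable)
  ultimately show ?thesis using q(3) by auto
qed

text \<open>Polarisation: the square of \<open>u + e\<close> is \<open>u \<star> u\<close> plus
  \<open>2 u\<close> plus \<open>e\<close>. Both squares are multiples of \<open>e\<close> by
  \<open>minimal_idem_square\<close>, hence so is \<open>u\<close>.\<close>

lemma minimal_idem_scalar:
  assumes e: "minimal_idem e" and u: "continuous_on UNIV u" "adj u = u" "e \<star> u = u"
  shows "\<exists>s. u = (\<lambda>x. s * e x)"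
proof -
  have E: "continuous_on UNIV e" "adj e = e" "e \<star> e = e"
    using e unfolding minimal_idem_def idem_def by auto
  define v where "v x = u x + e x" for x
  have cv: "continuous_on UNIV v" unfolding v_def[abs_def] by (intro continuous_intros u E)
  have ue: "u \<star> e = u" using conv_comm[OF u(1) E(1)] u(3) by simp
  have av: "adj v = v"
    using fun_cong[OF u(2)] fun_cong[OF E(2)] by (simp add: v_def adj_def fun_eq_iff)
  have ev: "e \<star> v = v"
    by (subst conv_comm[OF E(1) cv]) (simp add: v_def[abs_def] conv_add_left u E ue)
  obtain s t where s: "u \<star> u = (\<lambda>x. s * e x)" and t: "v \<star> v = (\<lambda>x. t * e x)"
    using minimal_idem_square[OF e u] minimal_idem_square[OF e cv av ev] by blast
  have vv: "v \<star> v = (\<lambda>x. (u \<star> v) x + (e \<star> v) x)"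
    by (subst (1) v_def[abs_def]) (intro conv_add_left u E cv)
  have uv: "u \<star> v = (\<lambda>x. (u \<star> u) x + (e \<star> u) x)"
    by (subst conv_comm[OF u(1) cv]) (simp add: v_def[abs_def] conv_add_left u E)
  have "t * e x = s * e x + u x + (u x + e x)" for x
    using fun_cong[OF vv, of x] unfolding uv ev t s u(3) by (simp add: v_def)
  then have "u x = (t - s - 1) / 2 * e x" for x
    by (simp add: field_simps)
  then show ?thesis by blast
qed

text \<open>A translate of \<open>e\<close> is absorbed by \<open>e\<close> but need not be
  self-adjoint, its adjoint being the translate by the inverse element. The scalar lemma is
  therefore applied to self-adjoint combinations. Multiplicativity then holds after division by the
  value at zero, and a norm count shows that this value is one.\<close>

lemma minimal_idem_character:
  assumes e: "minimal_idem e"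
  shows "e \<in> dual_group"
proof -
  have E: "continuous_on UNIV e" "adj e = e" "e \<star> e = e" "idem e"
    using e unfolding minimal_idem_def idem_def by auto
  define N where "N = sqnorm e"
  have N: "N \<ge> 1" "e 0 = of_real N" unfolding N_def using idem_zero[OF E(4)] by auto
  have minus: "e (- x) = cnj (e x)" for x
    using fun_cong[OF E(2), of "- x"] by (simp add: adj_def)
  have trans: "\<exists>s. \<forall>x. e (a + x) = s * e x" for a
  proof -
    \<comment> \<open>Twice the real and, up to sign, twice the imaginary part of the translate with
      respect to \<open>adj\<close>; the translate is recovered as
      \<open>(v - \<i> * w) / 2\<close>.\<close>
    define v w where "v x = e (a + x) + e (x - a)" and "w x = \<i> * (e (a + x) - e (x - a))" for x
    have T: "e \<star> (\<lambda>x. e (b + x)) = (\<lambda>x. e (b + x))" for b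
      by (simp add: conv_translate_right E)
    have ct: "continuous_on UNIV (\<lambda>x. e (b + x))" for b by (rule continuous_compose_group[OF E(1)])
    have cv: "continuous_on UNIV v" "continuous_on UNIV w"
      unfolding v_def[abs_def] w_def[abs_def] using ct[of "- a"] ct[of a]
      by (auto intro!: continuous_intros)
    have "adj v = v" "adj w = w"
      using minus[of "a + _"] minus[of "_ - a"]
      by (auto simp: fun_eq_iff adj_def v_def w_def minus[symmetric] algebra_simps)
    moreover have "e \<star> v = v"
      using T[of a] T[of "- a"] ct[of a] ct[of "- a"]
      by (subst conv_comm[OF E(1) cv(1)])
         (simp add: v_def[abs_def] conv_add_left E conv_comm[OF _ E(1)])
    moreover have "e \<star> w = w"
      using T[of a] T[of "- a"] ct[of a] ct[of "- a"]
      by (subst conv_comm[OF E(1) cv(2)])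
         (simp add: w_def[abs_def] conv_scale_left conv_diff_left E conv_comm[OF _ E(1)])
    ultimately obtain s t where "\<And>x. v x = s * e x" "\<And>x. w x = t * e x"
      using minimal_idem_scalar[OF e] cv by metis
    moreover have "e (a + x) = (v x - \<i> * w x) / 2" for x
      by (simp add: v_def w_def algebra_simps)
    ultimately have "e (a + x) = (s * e x - \<i> * (t * e x)) / 2" for x
      by metis
    then have "e (a + x) = (s - \<i> * t) / 2 * e x" for x
      by (simp add: left_diff_distrib mult.assoc)
    then show ?thesis by blast
  qed
  define \<xi> where "\<xi> x = e x / of_real N" for x
  have mult: "\<xi> (x + y) = \<xi> x * \<xi> y" for x y
  proof -
    obtain s where s: "\<And>y. e (x + y) = s * e y" using trans by blast
    show ?thesis using s[of 0] s[of y] N by (simp add: \<xi>_def)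
  qed
  have e_bound: "cmod (e x) \<le> N" for x
  proof -
    have "(cmod (e x))\<^sup>2 \<le> N\<^sup>2"
      using conv_bound[OF E(1) E(1), of x] E(3) by (simp add: N_def power2_eq_square)
    then show ?thesis using N by (simp add: power2_le_iff_abs_le)
  qed
  have norm1: "cmod (\<xi> x) = 1" for x
  proof -
    have "\<xi> x * \<xi> (- x) = 1" using mult[of x "- x"] N by (simp add: \<xi>_def)
    moreover have "\<xi> (- x) = cnj (\<xi> x)" by (simp add: \<xi>_def minus)
    ultimately have "(cmod (\<xi> x))\<^sup>2 = 1"
      by (metis complex_norm_square of_real_eq_1_iff)
    then show ?thesis by (simp add: power2_eq_1_iff) (smt (verit) norm_ge_zero)
  qed
  \<comment> \<open>The function \<open>e\<close> has squared norm \<open>N\<close>, but it is also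
    \<open>N\<close> times a function of modulus one on a space of mass one. This forces
    \<open>N = 1\<close>.\<close>
  have "N = sqnorm (\<lambda>x. of_real N * \<xi> x)"
    using N by (simp add: N_def[symmetric] \<xi>_def)
  also have "\<dots> = N\<^sup>2"
    by (simp add: sqnorm_def norm_mult norm1)
  finally have "N = 1" using N by (simp add: power2_eq_square)
  then have "e = \<xi>" by (simp add: \<xi>_def fun_eq_iff)
  then show ?thesis using mult norm1 E(1) unfolding dual_group_def by auto
qed

end

subsection \<open>Uniqueness of Fourier coefficients\<close>

context compact_haar
begin

lemma dual_groupD:
  fixes \<xi> :: "'g \<Rightarrow> complex"
  assumes "\<xi> \<in> dual_group"
  shows "continuous_on UNIV \<xi>" "cmod (\<xi> x) = 1" "\<xi> (x + y) = \<xi> x * \<xi> y" "\<xi> 0 = 1" "\<xi> (- x) = cnj (\<xi> x)"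
proof -
  have "continuous_on UNIV \<xi> \<and> range \<xi> \<subseteq> sphere 0 1 \<and> (\<forall>x y. \<xi> (x + y) = \<xi> x * \<xi> y)"
    using assms unfolding dual_group_def by (rule CollectD)
  then show c: "continuous_on UNIV \<xi>" and n: "cmod (\<xi> x) = 1" and m: "\<xi> (x + y) = \<xi> x * \<xi> y" for x y
    by (blast, metis mem_sphere_0 range_subsetD, blast)
  have nz: "\<xi> x \<noteq> 0" for x using n[of x] by auto
  have "\<xi> 0 * \<xi> 0 = \<xi> 0 * 1" using m[of 0 0] by (simp only: add_0_left mult_1_right)
  then show 0: "\<xi> 0 = 1" by (simp only: mult_left_cancel[OF nz])
  have "\<xi> (- x) * \<xi> x = cnj (\<xi> x) * \<xi> x"
    using m[of "- x" x] 0 n[of x] by (simp add: complex_norm_square[symmetric] mult.commute)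
  then show "\<xi> (- x) = cnj (\<xi> x)" using nz[of x] by simp
qed

text \<open>Characters are eigenvectors of every convolution, with the Fourier coefficient as
  eigenvalue.\<close>

lemma conv_character:
  assumes "\<xi> \<in> dual_group"
  shows "h \<star> \<xi> = (\<lambda>x. fourier \<mu> h \<xi> * \<xi> x)"
proof
  fix x
  have "\<xi> (x - y) = \<xi> x * cnj (\<xi> y)" for y
    using dual_groupD(3,5)[OF assms] by (metis uminus_add_conv_diff add.commute)
  then have "(h \<star> \<xi>) x = (\<integral>y. (h y * cnj (\<xi> y)) * \<xi> x \<partial>\<mu>)"
    by (simp add: conv_def mult_ac)
  then show "(h \<star> \<xi>) x = fourier \<mu> h \<xi> * \<xi> x"
    by (simp add: fourier_def)
qed

text \<open>If \<open>v = h \<star> k\<close> were nonzero, the self-adjoint function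
  \<open>v \<star> adj v\<close> would have a spectral idempotent with positive eigenvalue, and a
  character below it. Convolution by \<open>v\<close> multiplies that character by the product of
  the coefficients of \<open>h\<close> and \<open>k\<close>, which vanishes.\<close>

lemma conv_eq_zero:
  assumes h: "integrable \<mu> h" and k: "continuous_on UNIV k"
    and fz: "\<And>\<xi>. \<xi> \<in> dual_group \<Longrightarrow> fourier \<mu> h \<xi> = 0"
  shows "h \<star> k = (\<lambda>_. 0)"
proof (rule ccontr)
  assume nz: "h \<star> k \<noteq> (\<lambda>_. 0)"
  define v where "v = h \<star> k"
  define u where "u = v \<star> adj v"
  have cv: "continuous_on UNIV v" unfolding v_def by (rule continuous_conv[OF h k])
  have cu: "continuous_on UNIV u" unfolding u_def by (intro continuous_conv' continuous_adj cv)
  have "adj u = u"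
    unfolding u_def using conv_comm[OF cv continuous_adj[OF cv]] by (simp add: adj_conv cv continuous_adj)
  moreover have "u 0 \<noteq> 0"
  proof -
    obtain x where "v x \<noteq> 0" using nz unfolding v_def by force
    then show ?thesis unfolding u_def conv_adj_zero using sqnorm_pos[OF cv] by (simp add: less_imp_neq[symmetric])
  qed
  then have "u \<noteq> (\<lambda>_. 0)" by force
  ultimately obtain r q where q: "r > (0::real)" "idem q" "(u \<star> u) \<star> q = (\<lambda>x. of_real r * q x)"
    using idem_of_self_adjoint[OF cu] by blast
  obtain \<xi> where \<xi>: "minimal_idem \<xi>" "q \<star> \<xi> = \<xi>" using minimal_idem_below[OF q(2)] by blast
  have d: "\<xi> \<in> dual_group" by (rule minimal_idem_character[OF \<xi>(1)])
  note c = dual_groupD(1)[OF d]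
  have cq: "continuous_on UNIV q" using q(2) unfolding idem_def by blast
  have "v \<star> \<xi> = (\<lambda>x. 0)"
    unfolding v_def conv_assoc[OF h k c] conv_character[OF d, of k] conv_scale_right
      conv_character[OF d, of h] using fz[OF d] by simp
  then have "u \<star> \<xi> = (\<lambda>x. 0)"
    unfolding u_def conv_comm[OF cv continuous_adj[OF cv]]
    by (subst conv_assoc) (auto intro!: continuous_integrable continuous_adj cv c simp: conv_def)
  then have "(u \<star> u) \<star> \<xi> = (\<lambda>x. 0)"
    by (subst conv_assoc) (auto intro!: continuous_integrable cu c simp: conv_def)
  \<comment> \<open>Inserting \<open>q\<close> costs nothing because it absorbs the character, and
    it turns \<open>u \<star> u\<close> into the scalar \<open>r\<close>; at zero this gives
    \<open>r\<close> instead of 0.\<close>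
  moreover have "(u \<star> u) \<star> \<xi> = ((u \<star> u) \<star> q) \<star> \<xi>"
    by (subst (2) conv_assoc) (auto intro!: continuous_integrable continuous_conv' cu c cq simp: \<xi>(2))
  then have "((u \<star> u) \<star> \<xi>) 0 = of_real r"
    unfolding q(3) conv_scale_left \<xi>(2) by (simp add: dual_groupD[OF d])
  ultimately show False using q(1) by simp
qed

text \<open>Convolution with a reflected continuous function, evaluated at zero, shows that
  \<open>h\<close> integrates to zero against every continuous function. Inner regularity and
  Urysohn functions carry this over to indicators of open sets, and the open sets form a pi-system
  generating the Borel sets.\<close>

theorem fourier_unique_zero:
  assumes h: "integrable \<mu> h" and fz: "\<And>\<xi>. \<xi> \<in> dual_group \<Longrightarrow> fourier \<mu> h \<xi> = 0"
  shows "AE x in \<mu>. h x = 0"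
proof -
  have [measurable]: "h \<in> borel_measurable \<mu>" using h by auto
  have k0: "(\<integral>x. h x * k x \<partial>\<mu>) = 0" if "continuous_on UNIV k" for k
    using fun_cong[OF conv_eq_zero[OF h continuous_compose_group(1)[OF that] fz], of 0]
    by (simp add: conv_def)
  have total: "(\<integral>x. h x \<partial>\<mu>) = 0" using k0[of "\<lambda>_. 1"] by simp
  have hA: "set_integrable \<mu> A h" if "A \<in> sets borel" for A
    using h that unfolding set_integrable_def by (intro integrable_mult_indicator) auto
  have op: "set_lebesgue_integral \<mu> U h = 0" if U: "open U" for U
  proof -
    have "emeasure \<mu> U = (SUP K\<in>{K. compact K \<and> K \<subseteq> U}. emeasure \<mu> K)"
      using haar U unfolding normalized_haar_def by (elim conjE allE[of _ U]) simp
    moreover have "{K. compact K \<and> K \<subseteq> U} \<noteq> {}" by (auto intro!: exI[of _ "{}"])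
    ultimately obtain g :: "nat \<Rightarrow> ennreal" where
      g: "range g \<subseteq> emeasure \<mu> ` {K. compact K \<and> K \<subseteq> U}" "emeasure \<mu> U = (SUP n. g n)"
      using ennreal_Sup_countable_SUP[of "emeasure \<mu> ` {K. compact K \<and> K \<subseteq> U}"] by auto
    then have "\<forall>n. \<exists>K. compact K \<and> K \<subseteq> U \<and> g n = emeasure \<mu> K" by blast
    then obtain K where K: "\<And>n. compact (K n) \<and> K n \<subseteq> U" "\<And>n. g n = emeasure \<mu> (K n)" by metis
    \<comment> \<open>With increasing unions, \<open>f n\<close> equals one on a fixed
      \<open>K m\<close> for all \<open>n \<ge> m\<close>, which gives pointwise convergence on the
      union of the \<open>K n\<close>.\<close>
    define L where "L n = (\<Union>i\<le>n. K i)" for n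
    have cK: "closed (K n)" for n using K(1) compact_imp_closed by blast
    have L: "closed (L n)" "L n \<subseteq> U" for n
      unfolding L_def using K(1) cK by auto
    have "\<exists>f. continuous_on UNIV f \<and> (\<forall>x. 0 \<le> f x \<and> f x \<le> (1::real)) \<and> (\<forall>x\<in>-U. f x = 0) \<and> (\<forall>x\<in>L n. f x = 1)" for n
      using urysohn[of "- U" "L n"] L[of n] U by (metis closed_Compl disjoint_eq_subset_Compl inf_commute double_compl)
    then obtain f where f: "\<And>n. continuous_on UNIV (f n)" "\<And>n x. 0 \<le> f n x \<and> f n x \<le> (1::real)"
      "\<And>n x. x \<notin> U \<Longrightarrow> f n x = 0" "\<And>n x. x \<in> L n \<Longrightarrow> f n x = 1" by (metis ComplI)
    have null: "AE x in \<mu>. x \<in> U \<longrightarrow> x \<in> (\<Union>n. K n)"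
    proof -
      have "emeasure \<mu> U \<le> emeasure \<mu> (\<Union>n. K n)"
        unfolding g(2) K(2) using cK by (intro SUP_least emeasure_mono) auto
      then have "emeasure \<mu> (U - (\<Union>n. K n)) = 0"
        using U cK K(1) by (subst emeasure_Diff) (auto intro!: borel_closed diff_eq_0_ennreal simp: less_top[symmetric])
      then show ?thesis
        using U cK by (intro AE_I[of _ _ "U - (\<Union>n. K n)"]) auto
    qed
    have "(\<lambda>n. \<integral>x. complex_of_real (f n x) * h x \<partial>\<mu>) \<longlonglongrightarrow> (\<integral>x. indicator U x *\<^sub>R h x \<partial>\<mu>)"
    proof (rule integral_dominated_convergence[where w="\<lambda>x. norm (h x)"])
      show "(\<lambda>x. indicator U x *\<^sub>R h x) \<in> borel_measurable \<mu>"
        using U h by (intro borel_measurable_scaleR borel_measurable_indicator) auto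
      show "(\<lambda>x. complex_of_real (f n x) * h x) \<in> borel_measurable \<mu>" for n
        using continuous_measurable(2)[OF f(1)[of n]] by auto
      show "AE x in \<mu>. norm (complex_of_real (f n x) * h x) \<le> norm (h x)" for n
        using f(2) by (auto simp: norm_mult mult_left_le_one_le)
      show "AE x in \<mu>. (\<lambda>n. complex_of_real (f n x) * h x) \<longlonglongrightarrow> indicator U x *\<^sub>R h x"
        using null
      proof eventually_elim
        case (elim x)
        have "(\<lambda>n. f n x) \<longlonglongrightarrow> indicator U x"
        proof (cases "x \<in> U")
          case True
          then obtain m where "x \<in> K m" using elim by blast
          then have "\<forall>n\<ge>m. f n x = 1" using f(4) unfolding L_def by blast
          then show ?thesis using True by (intro tendsto_eventually) (auto simp: eventually_sequentially)
        qed (simp add: f(3))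
        from tendsto_mult[OF tendsto_of_real[OF this] tendsto_const[of "h x"]]
        show ?case by (simp add: scaleR_conv_of_real)
      qed
    qed (use h in auto)
    moreover have "(\<integral>x. complex_of_real (f n x) * h x \<partial>\<mu>) = 0" for n
      using k0[of "\<lambda>x. complex_of_real (f n x)"] f(1)[of n] by (simp add: mult.commute continuous_intros)
    ultimately show ?thesis
      unfolding set_lebesgue_integral_def by (simp add: LIMSEQ_const_iff)
  qed
  have sets_borel: "sets (borel :: 'g measure) = sigma_sets UNIV {S. open S}"
    by (simp add: borel_def)
  have stable: "Int_stable {S :: 'g set. open S}" "{S :: 'g set. open S} \<subseteq> Pow UNIV"
    by (auto simp: Int_stable_def)
  have "set_lebesgue_integral \<mu> A h = 0" if "A \<in> sigma_sets UNIV {S. open S}" for A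
    using stable that
  proof (induction rule: sigma_sets_induct_disjoint)
    case (basic A)
    then show ?case using op by blast
  next
    case (compl A)
    then have A: "A \<in> sets borel" by (simp add: sets_borel)
    have "set_lebesgue_integral \<mu> (A \<union> (UNIV - A)) h = set_lebesgue_integral \<mu> A h + set_lebesgue_integral \<mu> (UNIV - A) h"
      using A by (intro set_integral_Un hA) auto
    then show ?case using compl(2) total by (simp add: set_lebesgue_integral_def)
  next
    case (union A)
    then have A: "A i \<in> sets borel" for i by (auto simp: sets_borel)
    have "set_lebesgue_integral \<mu> (\<Union>i. A i) h = (\<Sum>i. set_lebesgue_integral \<mu> (A i) h)"
      using A union(1) by (intro lebesgue_integral_countable_add hA) (auto simp: disjoint_family_on_def)
    then show ?case using union(3) by simp
  qed (simp add: set_lebesgue_integral_def)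
  then show ?thesis
    using h by (intro density_zero) (auto simp: sets_borel)
qed

end

subsection \<open>The Plancherel theorem\<close>

context compact_haar
begin

lemma L2_measurable: "h \<in> L2 \<mu> \<Longrightarrow> h \<in> borel_measurable \<mu>"
  and L2_square_integrable: "h \<in> L2 \<mu> \<Longrightarrow> integrable \<mu> (\<lambda>x. (cmod (h x))\<^sup>2)"
  by (auto simp: L2_def)

lemma L2_integrable:
  assumes "h \<in> L2 \<mu>"
  shows "integrable \<mu> h" "(\<integral>x. cmod (h x) \<partial>\<mu>)\<^sup>2 \<le> (\<integral>x. (cmod (h x))\<^sup>2 \<partial>\<mu>)"
  using Cauchy_Schwarz_integral[of h \<mu> "\<lambda>_. 1"] L2_measurable[OF assms] L2_square_integrable[OF assms]
  by auto

lemma continuous_L2: "continuous_on UNIV u \<Longrightarrow> u \<in> L2 \<mu>"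
  by (auto simp: L2_def intro!: continuous_integrable continuous_intros)

section \<open>Orthogonality of characters and Bessel's inequality\<close>

lemma character_mult_cnj:
  fixes \<xi> :: "'g \<Rightarrow> complex"
  assumes "\<xi> \<in> dual_group"
  shows "\<xi> x * cnj (\<xi> x) = 1" "cnj (\<xi> x) * \<xi> x = 1"
  using dual_groupD(2)[OF assms] by (simp_all add: complex_norm_square[symmetric] mult.commute)

lemma character_orthonormal:
  assumes \<xi>: "\<xi> \<in> dual_group" and \<eta>: "\<eta> \<in> dual_group"
  shows "fourier \<mu> \<xi> \<eta> = (if \<xi> = \<eta> then 1 else 0)"
proof (cases "\<xi> = \<eta>")
  case True
  then show ?thesis by (simp add: fourier_def character_mult_cnj[OF \<eta>])
next
  case False
  then obtain a where a: "\<xi> a \<noteq> \<eta> a" by (auto simp: fun_eq_iff)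
  define \<rho> where "\<rho> x = \<xi> x * cnj (\<eta> x)" for x
  have "\<rho> a * \<eta> a = \<xi> a" by (simp add: \<rho>_def mult.assoc character_mult_cnj[OF \<eta>])
  then have ne: "\<rho> a \<noteq> 1" using a by auto
  have "continuous_on UNIV \<rho>"
    unfolding \<rho>_def by (intro continuous_intros dual_groupD(1) \<xi> \<eta>)
  from integral_translation_continuous[OF this, of a]
  have "(\<integral>x. \<rho> a * \<rho> x \<partial>\<mu>) = (\<integral>x. \<rho> x \<partial>\<mu>)"
    by (simp add: \<rho>_def dual_groupD(3)[OF \<xi>] dual_groupD(3)[OF \<eta>] mult_ac)
  then have "(\<integral>x. \<rho> x \<partial>\<mu>) = 0" using ne by simp
  then show ?thesis using False by (simp add: fourier_def \<rho>_def)
qed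

definition trig :: "(('g \<Rightarrow> complex) \<Rightarrow> complex) \<Rightarrow> ('g \<Rightarrow> complex) set \<Rightarrow> 'g \<Rightarrow> complex"
  where "trig c S x = (\<Sum>\<xi>\<in>S. c \<xi> * \<xi> x)"

lemma continuous_trig: "S \<subseteq> dual_group \<Longrightarrow> continuous_on UNIV (trig c S)"
  unfolding trig_def by (intro continuous_intros dual_groupD(1)) auto

lemma fourier_trig:
  assumes "finite S" "S \<subseteq> dual_group" "\<eta> \<in> dual_group"
  shows "fourier \<mu> (trig c S) \<eta> = (if \<eta> \<in> S then c \<eta> else 0)"
proof -
  have "fourier \<mu> (trig c S) \<eta> = (\<integral>x. (\<Sum>\<xi>\<in>S. c \<xi> * (\<xi> x * cnj (\<eta> x))) \<partial>\<mu>)"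
    by (simp add: fourier_def trig_def sum_distrib_right mult.assoc)
  also have "\<dots> = (\<Sum>\<xi>\<in>S. \<integral>x. c \<xi> * (\<xi> x * cnj (\<eta> x)) \<partial>\<mu>)"
    using assms by (intro Bochner_Integration.integral_sum continuous_integrable continuous_intros dual_groupD(1)) auto
  also have "\<dots> = (\<Sum>\<xi>\<in>S. c \<xi> * fourier \<mu> \<xi> \<eta>)" by (simp add: fourier_def)
  also have "\<dots> = (\<Sum>\<xi>\<in>S. if \<xi> = \<eta> then c \<xi> else 0)"
    using assms by (intro sum.cong refl) (auto simp: character_orthonormal)
  finally show ?thesis using assms(1) by simp
qed

lemma integral_cnj_trig:
  assumes S: "S \<subseteq> dual_group" and h: "integrable \<mu> h"
  shows "(\<integral>x. h x * cnj (trig c S x) \<partial>\<mu>) = (\<Sum>\<xi>\<in>S. cnj (c \<xi>) * fourier \<mu> h \<xi>)"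
proof -
  have "(\<integral>x. h x * cnj (trig c S x) \<partial>\<mu>) = (\<integral>x. (\<Sum>\<xi>\<in>S. cnj (c \<xi>) * (h x * cnj (\<xi> x))) \<partial>\<mu>)"
    by (simp add: trig_def sum_distrib_left mult_ac)
  also have "\<dots> = (\<Sum>\<xi>\<in>S. \<integral>x. cnj (c \<xi>) * (h x * cnj (\<xi> x)) \<partial>\<mu>)"
    using S by (intro Bochner_Integration.integral_sum integrable_mult_right integrable_mult_continuous h
        continuous_intros dual_groupD(1)) auto
  finally show ?thesis by (simp add: fourier_def)
qed

lemma sqnorm_trig:
  assumes "finite S" "S \<subseteq> dual_group"
  shows "sqnorm (trig c S) = (\<Sum>\<xi>\<in>S. (cmod (c \<xi>))\<^sup>2)"
proof -
  have "complex_of_real (sqnorm (trig c S)) = (\<integral>x. trig c S x * cnj (trig c S x) \<partial>\<mu>)"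
    by (simp add: sqnorm_def flip: complex_norm_square integral_complex_of_real)
  also have "\<dots> = (\<Sum>\<xi>\<in>S. cnj (c \<xi>) * fourier \<mu> (trig c S) \<xi>)"
    by (intro integral_cnj_trig continuous_integrable continuous_trig assms)
  also have "\<dots> = (\<Sum>\<xi>\<in>S. complex_of_real ((cmod (c \<xi>))\<^sup>2))"
  proof (intro sum.cong refl)
    fix \<xi> assume "\<xi> \<in> S"
    then have "fourier \<mu> (trig c S) \<xi> = c \<xi>" using assms by (simp add: fourier_trig subsetD)
    then show "cnj (c \<xi>) * fourier \<mu> (trig c S) \<xi> = complex_of_real ((cmod (c \<xi>))\<^sup>2)"
      by (simp only: complex_norm_square mult.commute)
  qed
  finally show ?thesis by (simp only: of_real_sum[symmetric] of_real_eq_iff)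
qed

text \<open>Pairing \<open>h\<close> with its own partial sum gives the squared norm
  \<open>s\<close> of that sum, so Cauchy-Schwarz reads \<open>s * s \<le> C * s\<close>, where
  \<open>C\<close> is the squared norm of \<open>h\<close>.\<close>

lemma Bessel:
  assumes h: "h \<in> L2 \<mu>" and S: "finite S" "S \<subseteq> dual_group"
  shows "(\<Sum>\<xi>\<in>S. (cmod (fourier \<mu> h \<xi>))\<^sup>2) \<le> (\<integral>x. (cmod (h x))\<^sup>2 \<partial>\<mu>)"
proof -
  define T where "T = trig (fourier \<mu> h) S"
  define s where "s = (\<Sum>\<xi>\<in>S. (cmod (fourier \<mu> h \<xi>))\<^sup>2)"
  have cT: "continuous_on UNIV T" unfolding T_def by (rule continuous_trig[OF S(2)])
  have "(\<integral>x. h x * cnj (T x) \<partial>\<mu>) = (\<Sum>\<xi>\<in>S. complex_of_real ((cmod (fourier \<mu> h \<xi>))\<^sup>2))"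
    unfolding T_def integral_cnj_trig[OF S(2) L2_integrable(1)[OF h]]
    by (intro sum.cong refl) (simp add: complex_norm_square mult.commute del: of_real_power)
  then have eq: "(\<integral>x. h x * cnj (T x) \<partial>\<mu>) = of_real s"
    by (simp only: s_def of_real_sum)
  have "(cmod (\<integral>x. h x * cnj (T x) \<partial>\<mu>))\<^sup>2 \<le> (\<integral>x. (cmod (h x))\<^sup>2 \<partial>\<mu>) * (\<integral>x. (cmod (cnj (T x)))\<^sup>2 \<partial>\<mu>)"
    by (rule Cauchy_Schwarz_integral)
       (auto intro!: L2_measurable[OF h] L2_square_integrable[OF h] continuous_measurable(2)
          continuous_integrable continuous_intros cT)
  also have "(\<integral>x. (cmod (cnj (T x)))\<^sup>2 \<partial>\<mu>) = s"
    using sqnorm_trig[OF S] by (simp add: T_def sqnorm_def s_def)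
  finally have le: "s\<^sup>2 \<le> (\<integral>x. (cmod (h x))\<^sup>2 \<partial>\<mu>) * s" unfolding eq by simp
  have "s \<ge> 0" unfolding s_def by (intro sum_nonneg) auto
  show ?thesis unfolding s_def[symmetric]
  proof (cases "s = 0")
    case False
    then show "s \<le> (\<integral>x. (cmod (h x))\<^sup>2 \<partial>\<mu>)"
      using le \<open>s \<ge> 0\<close> by (simp add: power2_eq_square)
  qed simp
qed

text \<open>An increasing sequence of finite sets of characters is chosen so that the tails decay
  geometrically. The successive blocks then have summable L1 norms, so their series converges almost
  everywhere and its coefficients can be computed termwise.\<close>

lemma Riesz_Fischer:
  assumes sm: "(\<lambda>\<xi>. (cmod (c \<xi>))\<^sup>2) summable_on dual_group"
  obtains g where "g \<in> L2 \<mu>" "\<And>\<xi>. \<xi> \<in> dual_group \<Longrightarrow> fourier \<mu> g \<xi> = c \<xi>"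
    "(\<integral>x. (cmod (g x))\<^sup>2 \<partial>\<mu>) \<le> (\<Sum>\<^sub>\<infinity>\<xi>\<in>dual_group. (cmod (c \<xi>))\<^sup>2)"
proof -
  define w where "w \<xi> = (cmod (c \<xi>))\<^sup>2" for \<xi>
  define s where "s = infsum w dual_group"
  have w: "w summable_on dual_group" "\<And>\<xi>. w \<xi> \<ge> 0" using sm by (simp_all add: w_def[abs_def])
  have fin: "sum w T \<le> s" if "finite T" "T \<subseteq> dual_group" for T
    unfolding s_def using that w by (intro finite_sum_le_infsum) auto
  have small: "\<exists>F. finite F \<and> F \<subseteq> dual_group \<and> (\<forall>T. finite T \<longrightarrow> T \<subseteq> dual_group \<longrightarrow> T \<inter> F = {} \<longrightarrow> sum w T \<le> e)" if e: "e > 0" for e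
  proof -
    have "(w has_sum s) dual_group" unfolding s_def using w(1) by (rule has_sum_infsum)
    from has_sum_finite_approximation[OF this e]
    obtain F where F: "finite F" "F \<subseteq> dual_group" "dist (sum w F) s \<le> e" by blast
    have "sum w T \<le> e" if "finite T" "T \<subseteq> dual_group" "T \<inter> F = {}" for T
      using fin[of "F \<union> T"] that F sum.union_disjoint[of F T w] by (auto simp: dist_real_def Int_commute)
    then show ?thesis using F by blast
  qed
  \<comment> \<open>The tolerance is the square of \<open>(1/2) ^ Suc n\<close>: on a space of mass
    one the L1 norm of a block is at most its L2 norm, whose square is the sum of \<open>w\<close>
    over the block.\<close>
  have "\<forall>n. \<exists>F. finite F \<and> F \<subseteq> dual_group \<and>
      (\<forall>T. finite T \<longrightarrow> T \<subseteq> dual_group \<longrightarrow> T \<inter> F = {} \<longrightarrow> sum w T \<le> (1/4) ^ Suc n)"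
    by (intro allI small) simp
  then obtain F where F: "\<And>n. finite (F n)" "\<And>n. F n \<subseteq> dual_group"
    "\<And>n T. finite T \<Longrightarrow> T \<subseteq> dual_group \<Longrightarrow> T \<inter> F n = {} \<Longrightarrow> sum w T \<le> (1/4) ^ Suc n" by metis
  define S where "S n = (\<Union>i<n. F i)" for n
  have S: "finite (S n)" "S n \<subseteq> dual_group" "S n \<subseteq> S (Suc n)" for n
    unfolding S_def using F(1,2) by (auto simp: less_Suc_eq)
  define d where "d n = trig c (S (Suc n) - S n)" for n
  have cd: "continuous_on UNIV (d n)" for n
    unfolding d_def using S by (intro continuous_trig) blast
  have partial: "(\<Sum>n<N. d n x) = trig c (S N) x" for N x
  proof (induction N)
    case 0
    then show ?case by (simp add: S_def trig_def)
  next
    case (Suc N)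
    have "trig c (S (Suc N)) x = trig c (S (Suc N) - S N) x + trig c (S N) x"
      unfolding trig_def using S by (intro sum.subset_diff)
    then show ?case using Suc by (simp add: d_def)
  qed
  \<comment> \<open>The block \<open>d (Suc n)\<close> uses no character of \<open>F n\<close>,
    since \<open>F n\<close> is contained in \<open>S (Suc n)\<close>. The block \<open>d 0\<close>
    has no such bound and is a single extra term.\<close>
  have d_bound: "(\<integral>x. cmod (d (Suc n) x) \<partial>\<mu>) \<le> (1/2) ^ Suc n" for n
  proof -
    define T where "T = S (Suc (Suc n)) - S (Suc n)"
    have T: "finite T" "T \<subseteq> dual_group" "T \<inter> F n = {}"
      unfolding T_def using S(1,2)[of "Suc (Suc n)"] by (simp, blast, auto simp: S_def)
    have "(\<integral>x. cmod (d (Suc n) x) \<partial>\<mu>)\<^sup>2 \<le> sqnorm (d (Suc n))"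
      using L2_integrable(2)[OF continuous_L2[OF cd]] by (simp add: sqnorm_def)
    also have "\<dots> = sum w T" unfolding d_def T_def[symmetric] sqnorm_trig[OF T(1,2)] w_def ..
    also have "\<dots> \<le> (1/4) ^ Suc n" by (rule F(3)[OF T])
    also have "\<dots> = ((1/2) ^ Suc n)\<^sup>2" by (simp add: power2_eq_square power_mult_distrib[symmetric])
    finally show ?thesis by (rule power2_le_imp_le) simp
  qed
  have sumd: "summable (\<lambda>n. \<integral>x. cmod (d n x) \<partial>\<mu>)"
  proof (subst summable_Suc_iff[symmetric], rule summable_comparison_test')
    show "summable (\<lambda>n. (1/2::real) ^ Suc n)" by simp
    show "norm (\<integral>x. cmod (d (Suc n) x) \<partial>\<mu>) \<le> (1/2) ^ Suc n" if "n \<ge> 0" for n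
      using d_bound[of n] by simp
  qed
  have int_d: "integrable \<mu> (d n)" for n by (rule continuous_integrable[OF cd])
  have AE_sum: "AE x in \<mu>. summable (\<lambda>n. norm (d n x))"
  proof -
    have "(\<integral>\<^sup>+x. (\<Sum>n. ennreal (norm (d n x))) \<partial>\<mu>) = (\<Sum>n. \<integral>\<^sup>+x. ennreal (norm (d n x)) \<partial>\<mu>)"
      using int_d by (intro nn_integral_suminf) auto
    also have "\<dots> = (\<Sum>n. ennreal (\<integral>x. norm (d n x) \<partial>\<mu>))"
      by (subst nn_integral_eq_integral) (auto intro!: integrable_norm int_d)
    also have "\<dots> = ennreal (\<Sum>n. \<integral>x. norm (d n x) \<partial>\<mu>)"
      by (rule suminf_ennreal2[OF _ sumd]) simp
    finally have "(\<integral>\<^sup>+x. (\<Sum>n. ennreal (norm (d n x))) \<partial>\<mu>) \<noteq> \<infinity>" by simp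
    moreover have "(\<lambda>x. \<Sum>n. ennreal (norm (d n x))) \<in> borel_measurable \<mu>"
      using continuous_measurable(2)[OF cd] by measurable
    ultimately have "AE x in \<mu>. (\<Sum>n. ennreal (norm (d n x))) \<noteq> \<infinity>"
      by (intro nn_integral_PInf_AE)
    then show ?thesis
    proof eventually_elim
      case (elim x)
      then show ?case by (intro summable_suminf_not_top) auto
    qed
  qed
  define g where "g x = (\<Sum>n. d n x)" for x
  have int_g: "integrable \<mu> g"
    unfolding g_def using int_d AE_sum sumd by (rule integrable_suminf)
  have [measurable]: "g \<in> borel_measurable \<mu>" using int_g by auto
  have lim: "AE x in \<mu>. (\<lambda>N. trig c (S N) x) \<longlonglongrightarrow> g x"
    using AE_sum
  proof eventually_elim
    case (elim x)
    have "(\<lambda>N. \<Sum>n<N. d n x) \<longlonglongrightarrow> g x"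
      unfolding g_def by (rule summable_LIMSEQ[OF summable_norm_cancel[OF elim]])
    then show ?case by (simp add: partial)
  qed
  \<comment> \<open>Convergence almost everywhere carries the L2 bound of the partial sums over to
    the limit by Fatou's lemma.\<close>
  have nn: "(\<integral>\<^sup>+x. ennreal ((cmod (g x))\<^sup>2) \<partial>\<mu>) \<le> ennreal s"
  proof -
    have "(\<integral>\<^sup>+x. ennreal ((cmod (g x))\<^sup>2) \<partial>\<mu>) = (\<integral>\<^sup>+x. liminf (\<lambda>N. ennreal ((cmod (trig c (S N) x))\<^sup>2)) \<partial>\<mu>)"
    proof (rule nn_integral_cong_AE)
      show "AE x in \<mu>. ennreal ((cmod (g x))\<^sup>2) = liminf (\<lambda>N. ennreal ((cmod (trig c (S N) x))\<^sup>2))"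
        using lim
      proof eventually_elim
        case (elim x)
        have "(\<lambda>N. ennreal ((cmod (trig c (S N) x))\<^sup>2)) \<longlonglongrightarrow> ennreal ((cmod (g x))\<^sup>2)"
          by (intro tendsto_ennrealI tendsto_intros elim)
        then show ?case by (rule lim_imp_Liminf[OF sequentially_bot, symmetric])
      qed
    qed
    also have "\<dots> \<le> liminf (\<lambda>N. \<integral>\<^sup>+x. ennreal ((cmod (trig c (S N) x))\<^sup>2) \<partial>\<mu>)"
    proof (rule nn_integral_liminf)
      show "(\<lambda>x. ennreal ((cmod (trig c (S N) x))\<^sup>2)) \<in> borel_measurable \<mu>" for N
        using continuous_measurable(2)[OF continuous_trig[OF S(2)], of c N] by measurable
    qed
    also have "\<dots> \<le> ennreal s"
    proof (rule order_trans[OF Liminf_le_Limsup[OF sequentially_bot] Limsup_bounded], rule always_eventually, rule allI)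
      fix N
      have "(\<integral>\<^sup>+x. ennreal ((cmod (trig c (S N) x))\<^sup>2) \<partial>\<mu>) = ennreal (sqnorm (trig c (S N)))"
        unfolding sqnorm_def
        by (intro nn_integral_eq_integral continuous_integrable continuous_intros continuous_trig S) auto
      then show "(\<integral>\<^sup>+x. ennreal ((cmod (trig c (S N) x))\<^sup>2) \<partial>\<mu>) \<le> ennreal s"
        using fin[OF S(1,2), of N] by (simp add: sqnorm_trig S w_def ennreal_leI)
    qed
    finally show ?thesis .
  qed
  have sq: "integrable \<mu> (\<lambda>x. (cmod (g x))\<^sup>2)"
    using nn by (intro integrableI_bounded) (auto intro: le_less_trans)
  show thesis
  proof (rule that[of g])
    show "g \<in> L2 \<mu>" using sq by (simp add: L2_def)
    show "(\<integral>x. (cmod (g x))\<^sup>2 \<partial>\<mu>) \<le> (\<Sum>\<^sub>\<infinity>\<xi>\<in>dual_group. (cmod (c \<xi>))\<^sup>2)"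
    proof -
      have "ennreal (\<integral>x. (cmod (g x))\<^sup>2 \<partial>\<mu>) \<le> ennreal s"
        using nn nn_integral_eq_integral[OF sq] by simp
      moreover have "s \<ge> 0" using fin[of "{}"] by simp
      ultimately show ?thesis by (simp add: s_def w_def[abs_def])
    qed
  next
    fix \<xi> :: "'g \<Rightarrow> complex" assume \<xi>: "\<xi> \<in> dual_group"
    have n: "norm (d n x * cnj (\<xi> x)) = norm (d n x)" for n x
      using dual_groupD(2)[OF \<xi>] by (simp add: norm_mult)
    have "(\<lambda>n. \<integral>x. d n x * cnj (\<xi> x) \<partial>\<mu>) sums (\<integral>x. (\<Sum>n. d n x * cnj (\<xi> x)) \<partial>\<mu>)"
      using AE_sum sumd
      by (intro sums_integral integrable_mult_continuous int_d continuous_intros dual_groupD(1)[OF \<xi>]) (simp_all add: n)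
    moreover have "(\<integral>x. (\<Sum>n. d n x * cnj (\<xi> x)) \<partial>\<mu>) = fourier \<mu> g \<xi>"
      unfolding fourier_def
    proof (rule integral_cong_AE)
      show "(\<lambda>x. \<Sum>n. d n x * cnj (\<xi> x)) \<in> borel_measurable \<mu>"
        using AE_sum sumd
        by (intro borel_measurable_integrable integrable_suminf integrable_mult_continuous int_d
              continuous_intros dual_groupD(1)[OF \<xi>]) (simp_all add: n)
      show "(\<lambda>x. g x * cnj (\<xi> x)) \<in> borel_measurable \<mu>"
        by (intro borel_measurable_integrable integrable_mult_continuous int_g continuous_intros dual_groupD(1)[OF \<xi>])
      show "AE x in \<mu>. (\<Sum>n. d n x * cnj (\<xi> x)) = g x * cnj (\<xi> x)"
        using AE_sum by eventually_elim (simp add: g_def suminf_mult2[OF summable_norm_cancel])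
    qed
    ultimately have "(\<lambda>N. \<Sum>n<N. fourier \<mu> (d n) \<xi>) \<longlonglongrightarrow> fourier \<mu> g \<xi>"
      by (simp add: sums_def fourier_def)
    moreover have "(\<Sum>n<N. fourier \<mu> (d n) \<xi>) = (if \<xi> \<in> S N then c \<xi> else 0)" for N
    proof -
      have "(\<Sum>n<N. fourier \<mu> (d n) \<xi>) = (\<integral>x. (\<Sum>n<N. d n x * cnj (\<xi> x)) \<partial>\<mu>)"
        unfolding fourier_def
        by (intro Bochner_Integration.integral_sum[symmetric] integrable_mult_continuous int_d
              continuous_intros dual_groupD(1)[OF \<xi>])
      also have "\<dots> = fourier \<mu> (trig c (S N)) \<xi>"
        by (simp add: fourier_def partial sum_distrib_right[symmetric])
      finally show ?thesis by (simp add: fourier_trig S \<xi>)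
    qed
    ultimately have lim\<xi>: "(\<lambda>N. if \<xi> \<in> S N then c \<xi> else 0) \<longlonglongrightarrow> fourier \<mu> g \<xi>" by simp
    show "fourier \<mu> g \<xi> = c \<xi>"
    proof (cases "\<exists>m. \<xi> \<in> F m")
      case True
      then obtain m where "\<xi> \<in> F m" by blast
      then have "\<forall>N\<ge>Suc m. (if \<xi> \<in> S N then c \<xi> else 0) = c \<xi>" by (auto simp: S_def)
      then have "(\<lambda>N. if \<xi> \<in> S N then c \<xi> else 0) \<longlonglongrightarrow> c \<xi>"
        unfolding eventually_sequentially[symmetric] by (intro tendsto_eventually eventually_sequentiallyI[of "Suc m"]) blast
      then show ?thesis using lim\<xi> LIMSEQ_unique by blast
    next
      case False
      then have "(\<lambda>N. 0) \<longlonglongrightarrow> fourier \<mu> g \<xi>" using lim\<xi> by (simp add: S_def)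
      \<comment> \<open>The singleton of a character missed by every \<open>F n\<close> is one of
        the finite sets covered by each tail bound, so its weight is below every tolerance.\<close>
      moreover have "c \<xi> = 0"
      proof -
        have "w \<xi> \<le> (1/4) ^ Suc n" for n using F(3)[of "{\<xi>}" n] \<xi> False by simp
        moreover have "(\<lambda>n. (1/4::real) ^ Suc n) \<longlonglongrightarrow> 0" by (intro LIMSEQ_Suc LIMSEQ_power_zero) simp
        ultimately have "w \<xi> \<le> 0" using LIMSEQ_le_const by blast
        then show ?thesis by (simp add: w_def)
      qed
      ultimately show ?thesis by (simp add: LIMSEQ_const_iff)
    qed
  qed
qed

text \<open>Riesz-Fischer rebuilds from the coefficients of \<open>h\<close> a function whose
  squared norm is at most the coefficient sum. By uniqueness it equals \<open>h\<close> almost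
  everywhere, which reverses Bessel's inequality.\<close>

theorem Plancherel:
  assumes h: "h \<in> L2 \<mu>"
  shows "((\<lambda>\<xi>. (cmod (fourier \<mu> h \<xi>))\<^sup>2) has_sum (\<integral>x. (cmod (h x))\<^sup>2 \<partial>\<mu>)) dual_group"
proof -
  have sm: "(\<lambda>\<xi>. (cmod (fourier \<mu> h \<xi>))\<^sup>2) summable_on dual_group"
    using Bessel[OF h] by (intro nonneg_bdd_above_summable_on bdd_aboveI2) auto
  have le: "(\<Sum>\<^sub>\<infinity>\<xi>\<in>dual_group. (cmod (fourier \<mu> h \<xi>))\<^sup>2) \<le> (\<integral>x. (cmod (h x))\<^sup>2 \<partial>\<mu>)"
    using Bessel[OF h] by (intro infsum_le_finite_sums sm) auto
  obtain g where g: "g \<in> L2 \<mu>" "\<And>\<xi>. \<xi> \<in> dual_group \<Longrightarrow> fourier \<mu> g \<xi> = fourier \<mu> h \<xi>"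
    "(\<integral>x. (cmod (g x))\<^sup>2 \<partial>\<mu>) \<le> (\<Sum>\<^sub>\<infinity>\<xi>\<in>dual_group. (cmod (fourier \<mu> h \<xi>))\<^sup>2)"
    using Riesz_Fischer[OF sm] by blast
  note ih = L2_integrable(1)[OF h] and ig = L2_integrable(1)[OF g(1)]
  have "AE x in \<mu>. h x - g x = 0"
  proof (rule fourier_unique_zero)
    show "integrable \<mu> (\<lambda>x. h x - g x)" using ih ig by simp
    fix \<xi> :: "'g \<Rightarrow> complex" assume \<xi>: "\<xi> \<in> dual_group"
    have c: "continuous_on UNIV (\<lambda>x. cnj (\<xi> x))" by (intro continuous_intros dual_groupD(1)[OF \<xi>])
    have "fourier \<mu> (\<lambda>x. h x - g x) \<xi> = fourier \<mu> h \<xi> - fourier \<mu> g \<xi>"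
      unfolding fourier_def
      using integrable_mult_continuous[OF ih c] integrable_mult_continuous[OF ig c]
      by (simp add: left_diff_distrib)
    then show "fourier \<mu> (\<lambda>x. h x - g x) \<xi> = 0" using g(2)[OF \<xi>] by simp
  qed
  then have "(\<integral>x. (cmod (h x))\<^sup>2 \<partial>\<mu>) = (\<integral>x. (cmod (g x))\<^sup>2 \<partial>\<mu>)"
    using L2_measurable[OF h] L2_measurable[OF g(1)] by (intro integral_cong_AE) auto
  then show ?thesis using has_sum_infsum[OF sm] le g(3) by simp
qed

end

subsection \<open>Characters of Euclidean space\<close>

lemma has_vector_derivative_translate:
  fixes F :: "real \<Rightarrow> 'a::real_normed_vector"
  assumes "(F has_vector_derivative d) (at (x + t))"
  shows "((\<lambda>s. F (s + t)) has_vector_derivative d) (at x)"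
proof -
  have "((\<lambda>s. s + t) has_vector_derivative 1) (at x)"
    unfolding has_real_derivative_iff_has_vector_derivative[symmetric]
    by (auto intro!: derivative_eq_intros)
  from vector_diff_chain_at[OF this assms] show ?thesis by (simp add: o_def)
qed

text \<open>Differentiability comes from a primitive \<open>F\<close>: multiplicativity gives
  \<open>F (t + a) - F t = e t * (F a - F 0)\<close>, and some \<open>F a - F 0\<close> is nonzero,
  so \<open>e\<close> is a quotient of a differentiable function by a constant. It then solves a
  linear equation whose coefficient \<open>c\<close> is imaginary by the modulus condition.\<close>

lemma real_character:
  fixes e :: "real \<Rightarrow> complex"
  assumes cont: "continuous_on UNIV e" and mult: "\<And>s t. e (s + t) = e s * e t" and norm1: "\<And>t. cmod (e t) = 1"
  obtains k :: real where "\<And>t. e t = exp (\<i> * of_real (k * t))"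
proof -
  obtain F where F: "\<And>x. (F has_vector_derivative e x) (at x)"
    using einterval_antiderivative[of "-\<infinity>" "\<infinity>" e] cont by (auto simp: continuous_on_eq_continuous_at)
  have nz: "e t \<noteq> 0" for t using norm1[of t] by auto
  have e0: "e 0 = 1" using mult[of 0 0] nz[of 0] by simp
  have shift: "F (t + a) - F t = e t * (F a - F 0)" for t a
  proof -
    have "((\<lambda>s. F (t + s) - e t * F s) has_derivative (\<lambda>h. 0)) (at x within UNIV)" for x
    proof -
      have "((\<lambda>s. F (t + s)) has_vector_derivative e (t + x)) (at x)"
        using has_vector_derivative_translate[of F "e (t + x)" x t] F[of "t + x"]
        by (simp add: add.commute)
      moreover have "((\<lambda>s. e t * F s) has_vector_derivative e t * e x) (at x)"
        by (rule has_vector_derivative_mult_right[OF F])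
      ultimately have "((\<lambda>s. F (t + s) - e t * F s) has_vector_derivative 0) (at x)"
        using has_vector_derivative_diff mult[of t x] by fastforce
      then show ?thesis by (simp add: has_vector_derivative_def)
    qed
    from has_derivative_zero_unique[OF convex_UNIV this, of a 0]
    show ?thesis by (simp add: algebra_simps)
  qed
  have "\<exists>a. F a \<noteq> F 0"
  proof (rule ccontr)
    assume "\<nexists>a. F a \<noteq> F 0"
    then have "F = (\<lambda>_. F 0)" by auto
    then have "(F has_vector_derivative 0) (at 0)" by (metis has_vector_derivative_const)
    then show False using F[of 0] e0 vector_derivative_unique_at by (metis zero_neq_one)
  qed
  then obtain a where a: "F a \<noteq> F 0" by blast
  have e_eq: "e t = (F (t + a) - F t) / (F a - F 0)" for t
    using shift[of t a] a by simp
  define c where "c = (e a - e 0) / (F a - F 0)"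
  have de0: "(e has_vector_derivative c) (at 0)"
  proof -
    have "((\<lambda>s. F (s + a)) has_vector_derivative e (0 + a)) (at 0)"
      by (rule has_vector_derivative_translate[OF F])
    then have "((\<lambda>t. (F (t + a) - F t) / (F a - F 0)) has_vector_derivative (e (0 + a) - e 0) / (F a - F 0)) (at 0)"
      by (intro has_vector_derivative_divide has_vector_derivative_diff F)
    then show ?thesis unfolding e_eq[symmetric] c_def by simp
  qed
  have de: "(e has_vector_derivative c * e t) (at t)" for t
  proof -
    have "((\<lambda>s. e (s - t)) has_vector_derivative c) (at t)"
      using has_vector_derivative_translate[of e c t "- t"] de0 by simp
    then have "((\<lambda>s. e t * e (s - t)) has_vector_derivative e t * c) (at t)"
      by (rule has_vector_derivative_mult_right)
    then show ?thesis by (simp add: mult[symmetric] mult.commute)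
  qed
  have "((\<lambda>t. e t * exp (- c * of_real t)) has_derivative (\<lambda>h. 0)) (at x within UNIV)" for x
  proof -
    have "((\<lambda>t. exp (- c * of_real t)) has_vector_derivative - c * exp (- c * of_real x)) (at x)"
      by (rule has_vector_derivative_real_field[of "\<lambda>z. exp (- c * z)"]) (auto intro!: derivative_eq_intros)
    from has_vector_derivative_mult[OF de[of x] this]
    show ?thesis by (simp add: has_vector_derivative_def algebra_simps)
  qed
  from has_derivative_zero_unique[OF convex_UNIV this, of _ 0]
  have "e t * exp (- c * of_real t) = 1" for t using e0 by simp
  then have e_exp: "e t = exp (c * of_real t)" for t
    by (metis exp_minus_inverse mult.commute mult.left_commute mult.right_neutral mult_minus_left)
  have "exp (Re c) = 1" using norm1[of 1] unfolding e_exp by simp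
  then have "c = \<i> * of_real (Im c)" by (simp add: complex_eq_iff)
  then have "e t = exp (\<i> * of_real (Im c * t))" for t
    using e_exp[of t] by (metis mult.assoc of_real_mult)
  then show thesis by (rule that)
qed

text \<open>The character is determined on each coordinate axis by \<open>real_character\<close>,
  and the axes are combined by multiplicativity. Uniqueness is proved as well, because the definite
  description denotes the frequency only then.\<close>

lemma frequency_spec:
  fixes \<phi> :: "real^'n \<Rightarrow> 'g::{topological_space, plus}"
  assumes \<phi>: "continuous_hom \<phi>" and \<xi>: "\<xi> \<in> dual_group"
  shows "\<xi> (\<phi> x) = exp (2 * complex_of_real pi * \<i> * complex_of_real (frequency \<phi> \<xi> \<bullet> x))"
proof -
  have c\<xi>: "continuous_on UNIV \<xi>" and n\<xi>: "cmod (\<xi> a) = 1" and m\<xi>: "\<xi> (a + b) = \<xi> a * \<xi> b" for a b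
    using \<xi> unfolding dual_group_def by (auto simp: image_subset_iff)
  have c\<phi>: "continuous_on UNIV \<phi>" and m\<phi>: "\<phi> (a + b) = \<phi> a + \<phi> b" for a b
    using \<phi> unfolding continuous_hom_def by auto
  define E where "E x = \<xi> (\<phi> x)" for x
  have cE: "continuous_on UNIV E"
    unfolding E_def[abs_def] by (rule continuous_on_compose2[OF c\<xi> c\<phi>]) simp
  have mE: "E (a + b) = E a * E b" and nE: "cmod (E a) = 1" for a b
    unfolding E_def using m\<xi> m\<phi> n\<xi> by simp_all
  have E0: "E 0 = 1" using mE[of 0 0] nE[of 0] by auto
  have "\<exists>k. \<forall>t. E (t *\<^sub>R axis i 1) = exp (\<i> * of_real (k * t))" for i :: 'n
  proof -
    have "continuous_on UNIV (\<lambda>t. E (t *\<^sub>R axis i 1))"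
      by (rule continuous_on_compose2[OF cE]) (auto intro!: continuous_intros)
    then obtain k where "\<And>t. E (t *\<^sub>R axis i 1) = exp (\<i> * of_real (k * t))"
      using real_character[of "\<lambda>t. E (t *\<^sub>R axis i 1)"] by (auto simp: scaleR_add_left mE nE)
    then show ?thesis by blast
  qed
  then obtain k where k: "\<And>i t. E (t *\<^sub>R axis i 1) = exp (\<i> * of_real (k i * t))" by metis
  define y :: "real^'n" where "y = (\<chi> i. k i / (2 * pi))"
  have Esum: "E (\<Sum>i\<in>S. v i) = (\<Prod>i\<in>S. E (v i))" for S :: "'n set" and v
    by (induction S rule: infinite_finite_induct) (auto simp: E0 mE)
  have y: "E x = exp (2 * complex_of_real pi * \<i> * complex_of_real (y \<bullet> x))" for x
  proof -
    have "x = (\<Sum>i\<in>UNIV. (x $ i) *\<^sub>R axis i 1)"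
      using basis_expansion[of x] by (simp add: scalar_mult_eq_scaleR)
    then have "E x = E (\<Sum>i\<in>UNIV. (x $ i) *\<^sub>R axis i 1)" by simp
    also have "\<dots> = exp (\<Sum>i\<in>UNIV. \<i> * of_real (k i * x $ i))"
      by (simp add: Esum k exp_sum)
    also have "(\<Sum>i\<in>UNIV. \<i> * complex_of_real (k i * x $ i)) = 2 * complex_of_real pi * \<i> * complex_of_real (y \<bullet> x)"
      by (simp add: inner_vec_def y_def sum_distrib_left field_simps)
    finally show ?thesis .
  qed
  have uniq: "z = y" if z: "\<forall>x. E x = exp (2 * complex_of_real pi * \<i> * complex_of_real (z \<bullet> x))" for z
  proof (rule ccontr)
    assume "z \<noteq> y"
    define d where "d = z - y"
    have d: "d \<bullet> d > 0" using \<open>z \<noteq> y\<close> by (simp add: d_def)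
    \<comment> \<open>Scaled so that \<open>d \<bullet> x = 1 / 2\<close>: the two exponentials then
      differ by the factor -1.\<close>
    define x where "x = (1 / (2 * (d \<bullet> d))) *\<^sub>R d"
    have "exp (2 * complex_of_real pi * \<i> * complex_of_real (z \<bullet> x)) = exp (2 * complex_of_real pi * \<i> * complex_of_real (y \<bullet> x))"
      using z y by metis
    then have "exp (2 * complex_of_real pi * \<i> * complex_of_real (z \<bullet> x) - 2 * complex_of_real pi * \<i> * complex_of_real (y \<bullet> x)) = 1"
      by (simp add: exp_diff)
    moreover have "2 * complex_of_real pi * \<i> * complex_of_real (z \<bullet> x) - 2 * complex_of_real pi * \<i> * complex_of_real (y \<bullet> x) = \<i> * pi"
    proof -
      have "d \<bullet> x = 1 / 2" using d by (simp add: x_def)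
      then have "z \<bullet> x = y \<bullet> x + 1 / 2" by (simp add: d_def inner_diff_left)
      then show ?thesis by (simp add: algebra_simps)
    qed
    ultimately show False by (metis exp_pi_i' one_neq_neg_one)
  qed
  have "frequency \<phi> \<xi> = y"
    unfolding frequency_def by (rule the_equality) (use y uniq in \<open>auto simp: E_def\<close>)
  then show ?thesis using y[of x] by (simp add: E_def)
qed

subsection \<open>Test functions\<close>

lemma Ck_SucD: "Ck (Suc k) f \<Longrightarrow> Ck k f"
proof (induction k arbitrary: f)
  case 0
  then show ?case
    by (auto intro!: differentiable_imp_continuous_on simp: differentiable_on_def)
next
  case (Suc k)
  then show ?case by (metis Ck.simps(2))
qed

text \<open>Each term of the product rule keeps one factor undifferentiated, whose order has to be
  lowered by \<open>Ck_SucD\<close> before the induction hypothesis applies.\<close>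

lemma Ck_mult: "Ck k f \<Longrightarrow> Ck k g \<Longrightarrow> Ck k (\<lambda>x. f x * g x)"
proof (induction k arbitrary: f g)
  case 0
  then show ?case by (simp add: continuous_on_mult)
next
  case (Suc k)
  have d: "f differentiable (at x)" "g differentiable (at x)" for x using Suc.prems by simp_all
  have fd: "frechet_derivative (\<lambda>x. f x * g x) (at x) (axis i 1) =
      f x * frechet_derivative g (at x) (axis i 1) + frechet_derivative f (at x) (axis i 1) * g x" for x i
    using frechet_derivative_at[OF has_derivative_mult[OF d[THEN frechet_derivative_works[THEN iffD1]]], symmetric]
    by simp
  have add: "Ck k (\<lambda>x. f' x + g' x)" if "Ck k f'" "Ck k g'" for f' g' :: "real^'a \<Rightarrow> real" and k
    using that
  proof (induction k arbitrary: f' g')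
    case 0
    then show ?case by (simp add: continuous_on_add)
  next
    case (Suc k)
    have d: "f' differentiable (at x)" "g' differentiable (at x)" for x using Suc.prems by simp_all
    have "frechet_derivative (\<lambda>x. f' x + g' x) (at x) (axis i 1) =
        frechet_derivative f' (at x) (axis i 1) + frechet_derivative g' (at x) (axis i 1)" for x i
      using frechet_derivative_at[OF has_derivative_add[OF d[THEN frechet_derivative_works[THEN iffD1]]], symmetric]
      by simp
    then show ?case using Suc d by simp
  qed
  have "Ck k f" "Ck k g" using Suc.prems Ck_SucD by blast+
  then show ?case using Suc d by (simp add: fd add)
qed

text \<open>Partial derivatives of a ridge function are ridge functions for the next member of the
  family \<open>D\<close>, multiplied by a coordinate of \<open>a\<close>. The factor
  \<open>b\<close> makes this class closed, which is what the induction needs.\<close>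

lemma Ck_ridge:
  fixes D :: "nat \<Rightarrow> real \<Rightarrow> real" and a :: "real^'n"
  assumes D: "\<And>j t. (D j has_real_derivative D (Suc j) t) (at t)"
  shows "Ck k (\<lambda>x. b * D j (a \<bullet> x + c))"
proof (induction k arbitrary: b j)
  case 0
  have "continuous_on UNIV (D j)"
    using DERIV_isCont[OF D] by (simp add: continuous_on_eq_continuous_at)
  then show ?case
    by (auto intro!: continuous_intros continuous_on_compose2[of UNIV "D j"])
next
  case (Suc k)
  have d: "((\<lambda>x. b * D j (a \<bullet> x + c)) has_derivative (\<lambda>h. b * (D (Suc j) (a \<bullet> x + c) * (a \<bullet> h)))) (at x)" for x
  proof -
    have "((\<lambda>x. a \<bullet> x + c) has_derivative (\<lambda>h. a \<bullet> h + 0)) (at x)"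
      by (intro has_derivative_add has_derivative_inner_right has_derivative_ident has_derivative_const)
    from has_derivative_compose[OF this D[of j, THEN has_field_derivative_imp_has_derivative]]
    show ?thesis by (intro has_derivative_mult_right) simp
  qed
  have "frechet_derivative (\<lambda>x. b * D j (a \<bullet> x + c)) (at x) (axis i 1) = (b * (a $ i)) * D (Suc j) (a \<bullet> x + c)" for x i
    using frechet_derivative_at[OF d[of x], symmetric] by (simp add: inner_axis)
  then show ?case using d Suc by (auto simp: differentiable_def)
qed

definition smooth :: "(real^'n \<Rightarrow> real) \<Rightarrow> bool" where "smooth f \<longleftrightarrow> (\<forall>k. Ck k f)"

lemma smooth_mult: "smooth f \<Longrightarrow> smooth g \<Longrightarrow> smooth (\<lambda>x. f x * g x)"
  by (simp add: smooth_def Ck_mult)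

lemma smooth_ridge:
  fixes D :: "nat \<Rightarrow> real \<Rightarrow> real"
  assumes "\<And>j t. (D j has_real_derivative D (Suc j) t) (at t)"
  shows "smooth (\<lambda>x. D 0 (a \<bullet> x + c))"
  using Ck_ridge[where D=D and b=1 and j=0 and a=a and c=c, OF assms] by (simp add: smooth_def)

lemma smooth_const: "smooth (\<lambda>_. c)"
proof -
  have "((\<lambda>_. if j = 0 then c else 0) has_real_derivative (if Suc j = 0 then c else 0)) (at t)" for j t
    by simp
  from smooth_ridge[where D="\<lambda>j _. if j = 0 then c else 0", OF this] show ?thesis by simp
qed

lemma smooth_prod: "(\<And>i. i \<in> I \<Longrightarrow> smooth (f i)) \<Longrightarrow> smooth (\<lambda>x. \<Prod>i\<in>I. f i x)"
  by (induction I rule: infinite_finite_induct) (auto simp: smooth_const intro!: smooth_mult)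

text \<open>Successive derivatives of the cosine are its shifts by quarter periods, which form a
  family indexed by the order; the sine starts the same family a quarter period earlier.\<close>

lemma smooth_cos: "smooth (\<lambda>x. cos (a \<bullet> x))" and smooth_sin: "smooth (\<lambda>x. sin (a \<bullet> x))"
proof -
  have c: "((\<lambda>t. cos (t + real j * (pi / 2))) has_real_derivative cos (t + real (Suc j) * (pi / 2))) (at t)" for j t
  proof -
    have "cos (t + real (Suc j) * (pi / 2)) = - sin (t + real j * (pi / 2))"
      by (simp add: minus_sin_cos_eq algebra_simps add_divide_distrib)
    then show ?thesis by (auto intro!: derivative_eq_intros)
  qed
  show "smooth (\<lambda>x. cos (a \<bullet> x))" 
    using smooth_ridge[where D="\<lambda>j t. cos (t + real j * (pi / 2))" and a=a and c=0, OF c] by simp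
  show "smooth (\<lambda>x. sin (a \<bullet> x))" 
    using smooth_ridge[where D="\<lambda>j t. cos (t + real j * (pi / 2))" and a=a and c="- pi / 2", OF c]
    by (simp add: cos_diff)
qed

lemma smoothD:
  assumes "smooth f"
  shows "continuous_on UNIV f" "f differentiable (at x)"
    "continuous_on UNIV (\<lambda>x. frechet_derivative f (at x) (axis i 1))"
proof -
  have "Ck 0 f" "Ck (Suc 0) f" using assms unfolding smooth_def by blast+
  then show "continuous_on UNIV f" "f differentiable (at x)"
    "continuous_on UNIV (\<lambda>x. frechet_derivative f (at x) (axis i 1))" by auto
qed

lemma test_functions_iff: "\<psi> \<in> test_functions \<longleftrightarrow> smooth \<psi> \<and> bounded {x. \<psi> x \<noteq> 0}"
  by (auto simp: test_functions_def smooth_def compact_closure)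

lemma test_mult_smooth:
  "\<psi> \<in> test_functions \<Longrightarrow> smooth g \<Longrightarrow> (\<lambda>x. \<psi> x * g x) \<in> test_functions"
  unfolding test_functions_iff by (auto intro: smooth_mult elim!: bounded_subset)

text \<open>The derivatives of \<open>exp (- 1 / t)\<close> extended by zero are \<open>p (1 / t) exp (- 1 / t)\<close> with
  polynomials \<open>p\<close> obeying the recursion \<open>p \<mapsto> X\<^sup>2 (p - p')\<close>.\<close>
primrec bump_poly :: "nat \<Rightarrow> real poly"
  where "bump_poly 0 = 1"
  | "bump_poly (Suc j) = monom 1 2 * (bump_poly j - pderiv (bump_poly j))"

definition bump1 :: "nat \<Rightarrow> real \<Rightarrow> real"
  where "bump1 j t = (if t > 0 then poly (bump_poly j) (1 / t) * exp (- (1 / t)) else 0)"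

lemma poly_exp_tendsto_0: "((\<lambda>u::real. poly p u * exp (- u)) \<longlongrightarrow> 0) at_top"
proof -
  have "((\<lambda>u. \<Sum>i\<le>degree p. coeff p i * (u ^ i / exp u)) \<longlongrightarrow> (\<Sum>i\<le>degree p. coeff p i * 0)) at_top"
    by (intro tendsto_intros tendsto_power_div_exp_0)
  then show ?thesis
    by (simp add: poly_altdef sum_distrib_right exp_minus divide_inverse mult.assoc)
qed

text \<open>Only the origin is delicate. With \<open>u = 1 / h\<close> the difference quotient from
  the right is a polynomial in \<open>u\<close> times \<open>exp (- u)\<close>, the division by
  \<open>h\<close> merely multiplying the polynomial by \<open>u\<close>, so it tends to 0.\<close>

lemma bump1_derivative: "(bump1 j has_real_derivative bump1 (Suc j) t) (at t)"
proof -
  consider "t > 0" | "t < 0" | "t = 0" by linarith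
  then show ?thesis
  proof cases
    case 1
    have "((\<lambda>t. poly (bump_poly j) (1 / t) * exp (- (1 / t))) has_real_derivative bump1 (Suc j) t) (at t)"
      using 1 by (auto intro!: derivative_eq_intros DERIV_chain2[OF poly_DERIV]
          simp: bump1_def poly_monom field_simps power2_eq_square)
    then show ?thesis
    proof (rule DERIV_cong_ev[THEN iffD1, rotated 3])
      show "\<forall>\<^sub>F s in nhds t. poly (bump_poly j) (1 / s) * exp (- (1 / s)) = bump1 j s"
        using eventually_nhds_in_open[of "{0<..}" t] 1 by (auto elim!: eventually_mono simp: bump1_def)
    qed auto
  next
    case 2
    have "((\<lambda>t. 0) has_real_derivative bump1 (Suc j) t) (at t)"
      using 2 by (simp add: bump1_def)
    then show ?thesis
    proof (rule DERIV_cong_ev[THEN iffD1, rotated 3])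
      show "\<forall>\<^sub>F s in nhds t. 0 = bump1 j s"
        using eventually_nhds_in_open[of "{..<0}" t] 2 by (auto elim!: eventually_mono simp: bump1_def)
    qed auto
  next
    case 3
    have "((\<lambda>h. bump1 j h / h) \<longlongrightarrow> 0) (at 0)"
    proof (rule filterlim_split_at)
      have "((\<lambda>h. bump1 j h / h) \<longlongrightarrow> 0) (at_left 0) \<longleftrightarrow> ((\<lambda>h. 0::real) \<longlongrightarrow> 0) (at_left (0::real))"
        by (intro filterlim_cong refl) (auto simp: eventually_at_filter bump1_def)
      then show "((\<lambda>h. bump1 j h / h) \<longlongrightarrow> 0) (at_left 0)" by simp
      have "((\<lambda>h. poly ([:0, 1:] * bump_poly j) (inverse h) * exp (- inverse h)) \<longlongrightarrow> 0) (at_right 0)"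
        by (rule filterlim_compose[OF poly_exp_tendsto_0 filterlim_inverse_at_top_right])
      moreover have "((\<lambda>h. bump1 j h / h) \<longlongrightarrow> 0) (at_right 0) \<longleftrightarrow>
          ((\<lambda>h. poly ([:0, 1:] * bump_poly j) (inverse h) * exp (- inverse h)) \<longlongrightarrow> 0) (at_right 0)"
        by (intro filterlim_cong refl) (auto simp: eventually_at_filter bump1_def divide_inverse)
      ultimately show "((\<lambda>h. bump1 j h / h) \<longlongrightarrow> 0) (at_right 0)" by blast
    qed
    then show ?thesis using 3 by (simp add: has_field_derivative_iff bump1_def)
  qed
qed

text \<open>Each coordinate contributes \<open>bump1 0 (1 + t) * bump1 0 (1 - t)\<close>, which
  vanishes outside the interval from -1 to 1. The product is thus supported in a cube.\<close>

lemma exists_bump: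
  obtains \<psi> :: "real^'n \<Rightarrow> real"
  where "\<psi> \<in> test_functions" "\<And>x. \<psi> x \<ge> 0" "\<psi> 0 > 0"
proof -
  define \<psi> :: "real^'n \<Rightarrow> real"
    where "\<psi> x = (\<Prod>i\<in>UNIV. bump1 0 (axis i 1 \<bullet> x + 1) * bump1 0 (axis i (- 1) \<bullet> x + 1))" for x
  have nonneg: "bump1 0 t \<ge> 0" for t by (simp add: bump1_def)
  have "smooth \<psi>"
    unfolding \<psi>_def by (intro smooth_prod smooth_mult smooth_ridge[where D=bump1, OF bump1_derivative])
  moreover have "bounded {x. \<psi> x \<noteq> 0}"
  proof (rule bounded_subset[OF bounded_cbox[of "\<chi> i. - 1" "\<chi> i. 1"]], rule subsetI, simp add: mem_box_cart, rule allI)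
    fix x i assume "\<psi> x \<noteq> 0"
    then have "bump1 0 (axis i 1 \<bullet> x + 1) * bump1 0 (axis i (- 1) \<bullet> x + 1) \<noteq> 0"
      unfolding \<psi>_def by (metis (mono_tags, lifting) UNIV_I finite_class.finite_UNIV prod_zero_iff)
    then show "- 1 \<le> x $ i \<and> x $ i \<le> 1"
      by (auto simp: bump1_def inner_axis' split: if_splits)
  qed
  ultimately have "\<psi> \<in> test_functions" by (simp add: test_functions_iff)
  moreover have "\<psi> x \<ge> 0" for x unfolding \<psi>_def by (intro prod_nonneg) (simp add: nonneg)
  moreover have "\<psi> 0 > 0" unfolding \<psi>_def by (intro prod_pos) (simp add: bump1_def)
  ultimately show thesis by (rule that)
qed

subsection \<open>Integration by parts\<close>

abbreviation pderiv_at :: "'n \<Rightarrow> (real^'n \<Rightarrow> real) \<Rightarrow> real^'n \<Rightarrow> real"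
  where "pderiv_at i \<psi> x \<equiv> frechet_derivative \<psi> (at x) (axis i 1)"

lemma continuous_compact_support_integrable:
  fixes f :: "real^'n \<Rightarrow> 'b::{banach, second_countable_topology}"
  assumes "continuous_on UNIV f" "\<And>x. norm x > R \<Longrightarrow> f x = 0"
  shows "integrable lborel f"
proof -
  have "integrable lborel (\<lambda>x. indicator (cball 0 R) x *\<^sub>R f x)"
    using assms(1) by (intro borel_integrable_compact compact_cball) (rule continuous_on_subset, auto)
  also have "(\<lambda>x. indicator (cball 0 R) x *\<^sub>R f x) = f"
    using assms(2) by (force simp: indicator_def fun_eq_iff)
  finally show ?thesis .
qed

lemma test_functionD:
  fixes \<psi> :: "real^'n \<Rightarrow> real"
  assumes "\<psi> \<in> test_functions"
  shows "continuous_on UNIV \<psi>" "continuous_on UNIV (pderiv_at i \<psi>)" "\<psi> differentiable (at x)"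
    and "\<exists>R>0. \<forall>x. norm x > R \<longrightarrow> \<psi> x = 0 \<and> pderiv_at i \<psi> x = 0"
proof -
  have s: "smooth \<psi>" "bounded {x. \<psi> x \<noteq> 0}" using assms unfolding test_functions_iff by auto
  show "continuous_on UNIV \<psi>" "continuous_on UNIV (pderiv_at i \<psi>)" "\<psi> differentiable (at x)"
    using smoothD[OF s(1)] by auto
  obtain R where R: "R > 0" "\<And>x. \<psi> x \<noteq> 0 \<Longrightarrow> norm x \<le> R"
    using s(2) unfolding bounded_pos by auto
  have "pderiv_at i \<psi> x = 0" if "norm x > R" for x
  proof -
    have "((\<lambda>_. 0) has_derivative (\<lambda>_. 0)) (at x)" by simp
    then have "(\<psi> has_derivative (\<lambda>_. 0)) (at x)"
    proof (rule has_derivative_transform_within_open[of _ _ x UNIV "- cball 0 R"])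
      show "0 = \<psi> z" if "z \<in> - cball 0 R" for z using R(2)[of z] that by force
    qed (use that in auto)
    from frechet_derivative_at[OF this] show ?thesis by metis
  qed
  then show "\<exists>R>0. \<forall>x. norm x > R \<longrightarrow> \<psi> x = 0 \<and> pderiv_at i \<psi> x = 0"
    using R by (intro exI[of _ R]) force
qed

lemma test_function_integrable:
  fixes g :: "real^'n \<Rightarrow> complex"
  assumes "\<psi> \<in> test_functions" "continuous_on UNIV g"
  shows "integrable lborel (\<lambda>x. \<psi> x *\<^sub>R g x)" "integrable lborel (\<lambda>x. pderiv_at i \<psi> x *\<^sub>R g x)"
    "integrable lborel \<psi>" "integrable lborel (pderiv_at i \<psi>)"
proof -
  note t = test_functionD[OF assms(1)]
  obtain R where R: "\<And>x. norm x > R \<Longrightarrow> \<psi> x = 0 \<and> pderiv_at i \<psi> x = 0" using t(4) by blast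
  show "integrable lborel (\<lambda>x. \<psi> x *\<^sub>R g x)" "integrable lborel (\<lambda>x. pderiv_at i \<psi> x *\<^sub>R g x)"
    "integrable lborel \<psi>" "integrable lborel (pderiv_at i \<psi>)"
    using R by (auto intro!: continuous_compact_support_integrable[of _ R] continuous_intros assms(2) t)
qed

text \<open>The integrals of all difference quotients vanish by translation invariance, and so does their limit.\<close>
lemma integral_pderiv_at:
  fixes \<psi> :: "real^'n \<Rightarrow> real"
  assumes \<psi>: "\<psi> \<in> test_functions"
  shows "(\<integral>x. pderiv_at i \<psi> x \<partial>lborel) = 0"
proof -
  note t = test_functionD[OF \<psi>]
  obtain R where R: "R > 0" "\<And>x. norm x > R \<Longrightarrow> \<psi> x = 0 \<and> pderiv_at i \<psi> x = 0" using t(4) by blast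
  define e :: "real^'n" where "e = axis i 1"
  have e: "norm e = 1" by (simp add: e_def)
  have der: "((\<lambda>s. \<psi> (x + s *\<^sub>R e)) has_real_derivative pderiv_at i \<psi> (x + s *\<^sub>R e)) (at s)" for x s
  proof -
    have "((\<lambda>s. x + s *\<^sub>R e) has_derivative (\<lambda>h. 0 + h *\<^sub>R e)) (at s)"
      by (intro derivative_intros)
    from has_derivative_compose[OF this, of \<psi>] t(3)[of "x + s *\<^sub>R e"]
    have d: "((\<lambda>s. \<psi> (x + s *\<^sub>R e)) has_derivative (\<lambda>h. frechet_derivative \<psi> (at (x + s *\<^sub>R e)) (h *\<^sub>R e))) (at s)"
      by (simp add: frechet_derivative_works)
    have "linear (frechet_derivative \<psi> (at (x + s *\<^sub>R e)))"
      using t(3)[of "x + s *\<^sub>R e"] by (intro linear_frechet_derivative)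
    then have "frechet_derivative \<psi> (at (x + s *\<^sub>R e)) (h *\<^sub>R e) = pderiv_at i \<psi> (x + s *\<^sub>R e) * h" for h
      by (simp add: linear_scale e_def)
    then show ?thesis using d by (simp add: has_field_derivative_def)
  qed
  obtain M where M: "\<And>x. \<bar>pderiv_at i \<psi> x\<bar> \<le> M" "M \<ge> 0"
  proof -
    have "bounded (pderiv_at i \<psi> ` cball 0 R)"
      by (intro compact_imp_bounded compact_continuous_image continuous_on_subset[OF t(2)]) auto
    then have "\<exists>M>0. \<forall>x\<in>cball 0 R. \<bar>pderiv_at i \<psi> x\<bar> \<le> M"
      unfolding bounded_pos by simp
    then obtain M where "\<And>x. x \<in> cball 0 R \<Longrightarrow> \<bar>pderiv_at i \<psi> x\<bar> \<le> M" "M > 0" by blast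
    moreover from this have "\<bar>pderiv_at i \<psi> x\<bar> \<le> M" if "norm x > R" for x using R(2)[OF that] by simp
    ultimately show thesis by (intro that[of M]) (force simp: not_le[symmetric])+
  qed
  define q where "q n x = real (Suc n) * (\<psi> (x + (1 / real (Suc n)) *\<^sub>R e) - \<psi> x)" for n x
  have q_mvt: "\<exists>s. 0 < s \<and> s < 1 / real (Suc n) \<and> q n x = pderiv_at i \<psi> (x + s *\<^sub>R e)" for n x
  proof -
    have "0 < 1 / real (Suc n)" by simp
    from MVT2[OF this, of "\<lambda>s. \<psi> (x + s *\<^sub>R e)" "\<lambda>s. pderiv_at i \<psi> (x + s *\<^sub>R e)"] der
    obtain s where "0 < s" "s < 1 / real (Suc n)"
      "\<psi> (x + (1 / real (Suc n)) *\<^sub>R e) - \<psi> x = 1 / real (Suc n) * pderiv_at i \<psi> (x + s *\<^sub>R e)"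
      by auto
    then show ?thesis by (intro exI[of _ s]) (auto simp: q_def)
  qed
  have int\<psi>: "integrable lborel \<psi>" using test_function_integrable[OF \<psi>, of "\<lambda>_. 0"] by simp
  have shift: "integrable lborel (\<lambda>x. \<psi> (x + c)) \<and> (\<integral>x. \<psi> (x + c) \<partial>lborel) = (\<integral>x. \<psi> x \<partial>lborel)" for c
  proof -
    have m: "(+) c \<in> measurable lborel borel" by simp
    have b: "\<psi> \<in> borel_measurable borel" by (rule borel_measurable_continuous_onI[OF t(1)])
    have d: "distr lborel borel ((+) c) = (lborel :: (real^'n) measure)" by (rule lborel_distr_plus)
    have "integrable (distr lborel borel ((+) c)) \<psi>" unfolding d by (rule int\<psi>)
    then show ?thesis
      using integrable_distr_eq[OF m b] integral_distr[OF m b] by (simp add: d add.commute)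
  qed
  have q_int: "(\<integral>x. q n x \<partial>lborel) = 0" for n
    unfolding q_def using shift int\<psi> by simp
  \<comment> \<open>By the mean value theorem each quotient is a derivative taken within distance
    one of \<open>x\<close>. Hence all of them are bounded by \<open>M\<close> and vanish outside
    the ball of radius \<open>R + 1\<close>.\<close>
  have "(\<lambda>n. \<integral>x. q n x \<partial>lborel) \<longlonglongrightarrow> (\<integral>x. pderiv_at i \<psi> x \<partial>lborel)"
  proof (rule integral_dominated_convergence[where w="\<lambda>x. M * indicator (cball 0 (R + 1)) x"])
    show "pderiv_at i \<psi> \<in> borel_measurable lborel"
      using borel_measurable_continuous_onI[OF t(2)] by simp
    show "q n \<in> borel_measurable lborel" for n
      unfolding q_def using shift int\<psi> by (intro borel_measurable_integrable) simp
    have "integrable lborel (indicator (cball 0 (R + 1)) :: real^'n \<Rightarrow> real)"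
      using emeasure_compact_finite[OF compact_cball[of "0::real^'n" "R + 1"]]
      by (intro integrable_real_indicator) auto
    then show "integrable lborel (\<lambda>x::real^'n. M * indicator (cball 0 (R + 1)) x :: real)" by simp
    show "AE x in lborel. norm (q n x) \<le> M * indicator (cball 0 (R + 1)) x" for n
    proof (rule AE_I2)
      fix x :: "real^'n"
      obtain s where s: "0 < s" "s < 1 / real (Suc n)" "q n x = pderiv_at i \<psi> (x + s *\<^sub>R e)"
        using q_mvt by blast
      have "1 / real (Suc n) \<le> 1" by simp
      then have s1: "s \<le> 1" using s by linarith
      show "norm (q n x) \<le> M * indicator (cball 0 (R + 1)) x"
      proof (cases "norm x \<le> R + 1")
        case True
        then show ?thesis using M(1) by (simp add: s(3))
      next
        case False
        have "norm x \<le> norm (x + s *\<^sub>R e) + norm (s *\<^sub>R e)"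
          using norm_triangle_ineq4[of "x + s *\<^sub>R e" "s *\<^sub>R e"] by simp
        then have "norm (x + s *\<^sub>R e) > R" using False s(1) s1 e by simp
        then show ?thesis using R(2) s(3) M(2) by simp
      qed
    qed
    show "AE x in lborel. (\<lambda>n. q n x) \<longlonglongrightarrow> pderiv_at i \<psi> x"
    proof (rule AE_I2)
      fix x :: "real^'n"
      have "((\<lambda>h. (\<psi> (x + h *\<^sub>R e) - \<psi> x) / h) \<longlongrightarrow> pderiv_at i \<psi> x) (at 0)"
        using der[of x 0] by (simp add: has_field_derivative_iff)
      moreover have "filterlim (\<lambda>n. 1 / real (Suc n)) (at 0) sequentially"
        unfolding filterlim_at using LIMSEQ_inverse_real_of_nat by (auto simp: inverse_eq_divide)
      ultimately have "(\<lambda>n. (\<psi> (x + (1 / real (Suc n)) *\<^sub>R e) - \<psi> x) / (1 / real (Suc n))) \<longlonglongrightarrow> pderiv_at i \<psi> x"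
        by (rule filterlim_compose)
      then show "(\<lambda>n. q n x) \<longlonglongrightarrow> pderiv_at i \<psi> x"
        by (simp add: q_def mult.commute)
    qed
  qed
  then show ?thesis by (simp add: q_int LIMSEQ_const_iff)
qed

abbreviation wave :: "real^'n \<Rightarrow> real^'n \<Rightarrow> complex"
  where "wave y x \<equiv> exp (2 * complex_of_real pi * \<i> * complex_of_real (y \<bullet> x))"

lemma continuous_wave: "continuous_on S (wave y)"
  by (intro continuous_intros)

lemma wave_cos_sin: "wave y x = of_real (cos ((2 * pi) *\<^sub>R y \<bullet> x)) + \<i> * of_real (sin ((2 * pi) *\<^sub>R y \<bullet> x))"
proof -
  have "2 * complex_of_real pi * \<i> * complex_of_real (y \<bullet> x) = \<i> * of_real ((2 * pi) *\<^sub>R y \<bullet> x)"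
    by simp
  then show ?thesis by (simp only: exp_Euler cos_of_real sin_of_real)
qed

lemma pderiv_at_mult_ridge:
  assumes \<psi>: "\<psi> differentiable (at x)" and g: "(g has_real_derivative g') (at (a \<bullet> x))"
  shows "pderiv_at i (\<lambda>x. \<psi> x * g (a \<bullet> x)) x = pderiv_at i \<psi> x * g (a \<bullet> x) + \<psi> x * (a $ i * g')"
proof -
  have "((\<lambda>x. a \<bullet> x) has_derivative (\<lambda>h. a \<bullet> h)) (at x)"
    by (intro has_derivative_inner_right has_derivative_ident)
  from has_derivative_compose[OF this g[THEN has_field_derivative_imp_has_derivative]]
  have "((\<lambda>x. \<psi> x * g (a \<bullet> x)) has_derivative
      (\<lambda>h. \<psi> x * (g' * (a \<bullet> h)) + frechet_derivative \<psi> (at x) h * g (a \<bullet> x))) (at x)"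
    using \<psi> by (intro has_derivative_mult) (simp_all add: frechet_derivative_works)
  from frechet_derivative_at[OF this, symmetric] show ?thesis
    by (simp add: inner_axis)
qed

text \<open>The vanishing integral is applied to the real test functions \<open>\<psi>\<close> times
  cosine and \<open>\<psi>\<close> times sine; the product rule gives the two real identities that
  combine to the complex one.\<close>

lemma integral_pderiv_at_wave:
  fixes \<psi> :: "real^'n \<Rightarrow> real"
  assumes \<psi>: "\<psi> \<in> test_functions"
  shows "(\<integral>x. pderiv_at i \<psi> x *\<^sub>R wave y x \<partial>lborel) =
    - (2 * complex_of_real pi * \<i> * complex_of_real (y $ i)) * (\<integral>x. \<psi> x *\<^sub>R wave y x \<partial>lborel)"
proof -
  define a where "a = (2 * pi) *\<^sub>R y"
  note t = test_functionD[OF \<psi>]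
  obtain R where R: "\<And>x. norm x > R \<Longrightarrow> \<psi> x = 0 \<and> pderiv_at i \<psi> x = 0" using t(4) by blast
  have int: "integrable lborel (\<lambda>x. \<psi> x * cos (a \<bullet> x))" "integrable lborel (\<lambda>x. \<psi> x * sin (a \<bullet> x))"
    "integrable lborel (\<lambda>x. pderiv_at i \<psi> x * cos (a \<bullet> x))" "integrable lborel (\<lambda>x. pderiv_at i \<psi> x * sin (a \<bullet> x))"
    using R by (auto intro!: continuous_compact_support_integrable[of _ R] continuous_intros t)
  have c: "(\<integral>x. pderiv_at i \<psi> x * cos (a \<bullet> x) + \<psi> x * (a $ i * - sin (a \<bullet> x)) \<partial>lborel) = 0"
    using integral_pderiv_at[OF test_mult_smooth[OF \<psi> smooth_cos[of a]], of i]
    by (subst (asm) pderiv_at_mult_ridge[OF t(3) DERIV_cos])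
  have s: "(\<integral>x. pderiv_at i \<psi> x * sin (a \<bullet> x) + \<psi> x * (a $ i * cos (a \<bullet> x)) \<partial>lborel) = 0"
    using integral_pderiv_at[OF test_mult_smooth[OF \<psi> smooth_sin[of a]], of i]
    by (subst (asm) pderiv_at_mult_ridge[OF t(3) DERIV_sin])
  have eq: "(\<lambda>x. pderiv_at i \<psi> x * cos (a \<bullet> x) + \<psi> x * (a $ i * - sin (a \<bullet> x))) =
        (\<lambda>x. pderiv_at i \<psi> x * cos (a \<bullet> x) - a $ i * (\<psi> x * sin (a \<bullet> x)))"
      "(\<lambda>x. pderiv_at i \<psi> x * sin (a \<bullet> x) + \<psi> x * (a $ i * cos (a \<bullet> x))) =
        (\<lambda>x. pderiv_at i \<psi> x * sin (a \<bullet> x) + a $ i * (\<psi> x * cos (a \<bullet> x)))"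
    by (simp_all add: fun_eq_iff)
  have parts:
    "(\<integral>x. pderiv_at i \<psi> x * cos (a \<bullet> x) \<partial>lborel) = a $ i * (\<integral>x. \<psi> x * sin (a \<bullet> x) \<partial>lborel)"
    "(\<integral>x. pderiv_at i \<psi> x * sin (a \<bullet> x) \<partial>lborel) = - (a $ i * (\<integral>x. \<psi> x * cos (a \<bullet> x) \<partial>lborel))"
    using c[unfolded eq] s[unfolded eq] int by simp_all
  have split: "(\<integral>x. u x *\<^sub>R wave y x \<partial>lborel) =
      of_real (\<integral>x. u x * cos (a \<bullet> x) \<partial>lborel) + \<i> * of_real (\<integral>x. u x * sin (a \<bullet> x) \<partial>lborel)"
    if "integrable lborel (\<lambda>x. u x * cos (a \<bullet> x))" "integrable lborel (\<lambda>x. u x * sin (a \<bullet> x))" for u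
  proof -
    have "(\<integral>x. u x *\<^sub>R wave y x \<partial>lborel) =
        (\<integral>x. complex_of_real (u x * cos (a \<bullet> x)) + \<i> * complex_of_real (u x * sin (a \<bullet> x)) \<partial>lborel)"
      by (intro Bochner_Integration.integral_cong refl)
         (simp only: wave_cos_sin a_def[symmetric], simp add: scaleR_conv_of_real algebra_simps)
    also have "\<dots> = (\<integral>x. complex_of_real (u x * cos (a \<bullet> x)) \<partial>lborel) + (\<integral>x. \<i> * complex_of_real (u x * sin (a \<bullet> x)) \<partial>lborel)"
      using that by (intro Bochner_Integration.integral_add integrable_mult_right integrable_of_real)
    finally show ?thesis
      by (simp only: integral_complex_of_real integral_mult_right_zero)
  qed
  have ai: "complex_of_real (a $ i) = 2 * complex_of_real pi * complex_of_real (y $ i)"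
    by (simp add: a_def)
  show ?thesis
    unfolding split[OF int(1,2)] split[OF int(3,4)] parts
    by (simp add: ai algebra_simps)
qed

subsection \<open>Stationary functions and weak gradients\<close>

text \<open>The weight is split into two square roots. Working with nonnegative integrals spares
  integrability conditions when the square is moved inside an average over \<open>x\<close>.\<close>

lemma Cauchy_Schwarz_weighted_nn_integral:
  assumes [measurable]: "w \<in> borel_measurable M" "g \<in> borel_measurable M" and "\<And>x. w x \<ge> (0::real)" "\<And>x. g x \<ge> (0::real)"
  shows "(\<integral>\<^sup>+x. ennreal (w x * g x) \<partial>M)\<^sup>2 \<le> (\<integral>\<^sup>+x. ennreal (w x) \<partial>M) * (\<integral>\<^sup>+x. ennreal (w x * (g x)\<^sup>2) \<partial>M)"
proof -
  have "(\<integral>\<^sup>+x. ennreal (sqrt (w x)) * ennreal (sqrt (w x) * g x) \<partial>M)\<^sup>2 \<le>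
      (\<integral>\<^sup>+x. (ennreal (sqrt (w x)))\<^sup>2 \<partial>M) * (\<integral>\<^sup>+x. (ennreal (sqrt (w x) * g x))\<^sup>2 \<partial>M)"
    by (rule Cauchy_Schwarz_nn_integral) auto
  moreover have "ennreal (sqrt (w x)) * ennreal (sqrt (w x) * g x) = ennreal (w x * g x)"
    "(ennreal (sqrt (w x)))\<^sup>2 = ennreal (w x)" "(ennreal (sqrt (w x) * g x))\<^sup>2 = ennreal (w x * (g x)\<^sup>2)" for x
    using assms(3,4)[of x] by (simp_all add: ennreal_mult[symmetric] ennreal_power power_mult_distrib)
  ultimately show ?thesis by simp
qed

locale compact_haar_flow = compact_haar \<mu> for \<mu> :: "'g::{topological_ab_group_add, t2_space} measure" +
  fixes \<phi> :: "real^'n \<Rightarrow> 'g"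
  assumes hom: "continuous_hom \<phi>"
begin

sublocale P: pair_sigma_finite "lborel :: (real^'n) measure" \<mu> ..

lemma continuous_phi: "continuous_on UNIV \<phi>" and phi_add: "\<phi> (x + y) = \<phi> x + \<phi> y" and phi_0 [simp]: "\<phi> 0 = 0"
proof -
  show "continuous_on UNIV \<phi>" and *: "\<phi> (x + y) = \<phi> x + \<phi> y" for x y
    using hom unfolding continuous_hom_def by auto
  show "\<phi> 0 = 0" using *[of 0 0] by simp
qed

lemma character_phi: "\<xi> \<in> dual_group \<Longrightarrow> \<xi> (\<phi> x) = wave (frequency \<phi> \<xi>) x"
  by (rule frequency_spec[OF hom])

lemma flow_measurable [measurable]: "(\<lambda>p. \<phi> (fst p) + snd p) \<in> measurable (lborel \<Otimes>\<^sub>M \<mu>) \<mu>"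
proof -
  have sp: "sets (lborel \<Otimes>\<^sub>M \<mu>) = sets ((borel :: (real^'n) measure) \<Otimes>\<^sub>M (borel :: 'g measure))"
    by (intro sets_pair_measure_cong) auto
  have "(\<lambda>p. \<phi> (fst p) + snd p) \<in> borel_measurable (lborel \<Otimes>\<^sub>M \<mu>)"
  proof (rule borel_measurableI)
    fix S :: "'g set" assume "open S"
    then have "open ((\<lambda>p. \<phi> (fst p) + snd p) -` S)"
      by (intro open_vimage continuous_intros continuous_on_compose2[OF continuous_phi]) auto
    then show "(\<lambda>p. \<phi> (fst p) + snd p) -` S \<inter> space (lborel \<Otimes>\<^sub>M \<mu>) \<in> sets (lborel \<Otimes>\<^sub>M \<mu>)"
      unfolding sp by (simp add: space_pair_measure open_in_pair_measure)
  qed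
  then show ?thesis by (simp add: measurable_cong_sets[OF refl sets_haar])
qed

section \<open>Square integrability of stationary functions\<close>

lemma stationaryD:
  assumes "stationary \<mu> (flow \<phi>) f"
  shows "f \<in> borel_measurable (lborel \<Otimes>\<^sub>M \<mu>)" "AE \<omega> in \<mu>. f (x, \<omega>) = f (0, \<phi> x + \<omega>)"
proof -
  show "f \<in> borel_measurable (lborel \<Otimes>\<^sub>M \<mu>)" using assms unfolding stationary_def by simp
  have "AE \<omega> in \<mu>. f (0 + x, \<omega>) = f (0, flow \<phi> x \<omega>)" using assms unfolding stationary_def by blast
  then show "AE \<omega> in \<mu>. f (x, \<omega>) = f (0, \<phi> x + \<omega>)" by (simp add: flow_def)
qed

lemma section_measurable:
  assumes "f \<in> borel_measurable (lborel \<Otimes>\<^sub>M \<mu>)"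
  shows "(\<lambda>\<omega>. f (x, \<omega>)) \<in> borel_measurable \<mu>"
  using measurable_Pair2[OF assms, of x] by simp

lemma stationary_flow:
  assumes g: "g \<in> borel_measurable \<mu>"
  shows "stationary \<mu> (flow \<phi>) (\<lambda>p. g (\<phi> (fst p) + snd p))"
  unfolding stationary_def flow_def
  using measurable_compose[OF flow_measurable g] by (auto simp: phi_add add.assoc)

lemma stationary_nn_integral:
  fixes f :: "(real^'n) \<times> 'g \<Rightarrow> 'b::real_normed_vector"
  assumes f: "stationary \<mu> (flow \<phi>) f"
  shows "(\<integral>\<^sup>+\<omega>. ennreal ((norm (f (x, \<omega>)))\<^sup>2) \<partial>\<mu>) = (\<integral>\<^sup>+\<omega>. ennreal ((norm (f (0, \<omega>)))\<^sup>2) \<partial>\<mu>)"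
proof -
  note [measurable] = section_measurable[OF stationaryD(1)[OF f], of 0]
  have "(\<integral>\<^sup>+\<omega>. ennreal ((norm (f (x, \<omega>)))\<^sup>2) \<partial>\<mu>) = (\<integral>\<^sup>+\<omega>. ennreal ((norm (f (0, \<phi> x + \<omega>)))\<^sup>2) \<partial>\<mu>)"
    using stationaryD(2)[OF f, of x] by (intro nn_integral_cong_AE) (auto elim!: eventually_mono)
  also have "\<dots> = (\<integral>\<^sup>+\<omega>. ennreal ((norm (f (0, \<omega>)))\<^sup>2) \<partial>\<mu>)"
    by (rule nn_integral_translation[of "\<lambda>\<omega>. ennreal ((norm (f (0, \<omega>)))\<^sup>2)"])
       (simp add: measurable_cong_sets[OF sets_haar refl, symmetric])
  finally show ?thesis .
qed

text \<open>All sections have the same norm, so the integral over \<open>K\<close> is that constant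
  times the volume of \<open>K\<close>. The unit ball, of positive volume, gives the
  converse.\<close>

lemma stationary_L2_loc_iff:
  fixes f :: "(real^'n) \<times> 'g \<Rightarrow> 'b::real_normed_vector"
  assumes f: "stationary \<mu> (flow \<phi>) f"
  shows "f \<in> L2_loc \<mu> \<longleftrightarrow> (\<integral>\<^sup>+\<omega>. ennreal ((norm (f (0, \<omega>)))\<^sup>2) \<partial>\<mu>) < \<infinity>"
proof -
  define I where "I = (\<integral>\<^sup>+\<omega>. ennreal ((norm (f (0, \<omega>)))\<^sup>2) \<partial>\<mu>)"
  have const: "(\<integral>\<^sup>+\<omega>. ennreal ((norm (f (x, \<omega>)))\<^sup>2) \<partial>\<mu>) = I" for x
    unfolding I_def by (rule stationary_nn_integral[OF f])
  have eq: "(\<integral>\<^sup>+x\<in>K. (\<integral>\<^sup>+\<omega>. ennreal ((norm (f (x, \<omega>)))\<^sup>2) \<partial>\<mu>) \<partial>lborel) = I * emeasure lborel K"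
    if "compact K" for K :: "(real^'n) set"
    using borel_compact[OF that] by (simp add: const nn_integral_cmult_indicator)
  have "I < \<infinity>" if "f \<in> L2_loc \<mu>"
  proof -
    have "(\<integral>\<^sup>+x\<in>cball 0 1. (\<integral>\<^sup>+\<omega>. ennreal ((norm (f (x, \<omega>)))\<^sup>2) \<partial>\<mu>) \<partial>lborel) < \<infinity>"
      using that compact_cball unfolding L2_loc_def by blast
    then have "I * emeasure lborel (cball 0 1 :: (real^'n) set) < \<infinity>"
      by (simp only: eq[OF compact_cball])
    moreover have "emeasure lborel (cball 0 1 :: (real^'n) set) \<noteq> 0"
      using less_imp_neq[OF unit_ball_vol_pos, of "real CARD('n)"] by (simp add: emeasure_cball)
    ultimately show ?thesis by (auto simp: ennreal_mult_less_top)
  qed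
  moreover have "f \<in> L2_loc \<mu>" if "I < \<infinity>"
    using stationaryD(1)[OF f] that eq emeasure_compact_finite
    by (auto simp: L2_loc_def ennreal_mult_less_top)
  ultimately show ?thesis unfolding I_def by blast
qed

lemma L2_iff_nn_integral:
  assumes "h \<in> borel_measurable \<mu>"
  shows "h \<in> L2 \<mu> \<longleftrightarrow> (\<integral>\<^sup>+\<omega>. ennreal ((cmod (h \<omega>))\<^sup>2) \<partial>\<mu>) < \<infinity>"
proof -
  note [measurable] = assms
  have "(\<lambda>x. (cmod (h x))\<^sup>2) \<in> borel_measurable \<mu>" by measurable
  then show ?thesis using assms by (simp add: L2_def integrable_iff_bounded)
qed

lemma L2_loc_measurable: "f \<in> L2_loc \<mu> \<Longrightarrow> f \<in> borel_measurable (lborel \<Otimes>\<^sub>M \<mu>)"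
  by (simp add: L2_loc_def)

lemma L2_loc_component:
  fixes F :: "(real^'n) \<times> 'g \<Rightarrow> complex^'n"
  assumes F: "F \<in> L2_loc \<mu>"
  shows "(\<lambda>p. F p $ i) \<in> L2_loc \<mu>"
proof -
  note [measurable] = L2_loc_measurable[OF F]
  have nth: "(\<lambda>v :: complex^'n. v $ i) \<in> borel_measurable borel"
    by (intro borel_measurable_continuous_onI continuous_intros)
  have "(\<lambda>p. F p $ i) \<in> borel_measurable (lborel \<Otimes>\<^sub>M \<mu>)"
    using measurable_compose[OF L2_loc_measurable[OF F] nth] .
  moreover have "(\<integral>\<^sup>+x\<in>K. (\<integral>\<^sup>+\<omega>. ennreal ((norm (F (x, \<omega>) $ i))\<^sup>2) \<partial>\<mu>) \<partial>lborel) < \<infinity>" if "compact K" for K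
  proof (rule le_less_trans)
    show "(\<integral>\<^sup>+x\<in>K. (\<integral>\<^sup>+\<omega>. ennreal ((norm (F (x, \<omega>)))\<^sup>2) \<partial>\<mu>) \<partial>lborel) < \<infinity>"
      using F that unfolding L2_loc_def by blast
    show "(\<integral>\<^sup>+x\<in>K. (\<integral>\<^sup>+\<omega>. ennreal ((norm (F (x, \<omega>) $ i))\<^sup>2) \<partial>\<mu>) \<partial>lborel) \<le>
        (\<integral>\<^sup>+x\<in>K. (\<integral>\<^sup>+\<omega>. ennreal ((norm (F (x, \<omega>)))\<^sup>2) \<partial>\<mu>) \<partial>lborel)"
      by (intro nn_integral_mono mult_right_mono ennreal_leI power_mono Finite_Cartesian_Product.norm_nth_le) auto
  qed
  ultimately show ?thesis unfolding L2_loc_def by blast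
qed

text \<open>The estimate of a number by one plus its square, together with mass one, turns local
  square integrability into integrability. This licenses every use of Fubini below.\<close>

lemma integrable_test_product:
  fixes f :: "(real^'n) \<times> 'g \<Rightarrow> complex"
  assumes f: "f \<in> L2_loc \<mu>" and \<psi>: "continuous_on UNIV \<psi>" "\<And>x. norm x > R \<Longrightarrow> \<psi> x = 0"
    and u: "continuous_on UNIV u" "\<And>\<omega>. cmod (u \<omega>) \<le> 1"
  shows "integrable (lborel \<Otimes>\<^sub>M \<mu>) (\<lambda>(x, \<omega>). \<psi> x *\<^sub>R (f (x, \<omega>) * u \<omega>))"
proof (rule integrableI_bounded)
  note [measurable] = L2_loc_measurable[OF f] continuous_measurable(2)[OF u(1)]
    borel_measurable_continuous_onI[OF \<psi>(1)]
  show "(\<lambda>(x, \<omega>). \<psi> x *\<^sub>R (f (x, \<omega>) * u \<omega>)) \<in> borel_measurable (lborel \<Otimes>\<^sub>M \<mu>)" by measurable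
  have "bounded (\<psi> ` cball 0 R)"
    by (intro compact_imp_bounded compact_continuous_image continuous_on_subset[OF \<psi>(1)]) auto
  then have "\<exists>M>0. \<forall>x\<in>cball 0 R. \<bar>\<psi> x\<bar> \<le> M" unfolding bounded_pos by simp
  then obtain M where M: "M > 0" "\<And>x. x \<in> cball 0 R \<Longrightarrow> \<bar>\<psi> x\<bar> \<le> M" by blast
  define K where "K = (cball 0 R :: (real^'n) set)"
  have K: "compact K" "K \<in> sets borel" unfolding K_def by auto
  have "(\<integral>\<^sup>+p. ennreal (norm ((\<lambda>(x, \<omega>). \<psi> x *\<^sub>R (f (x, \<omega>) * u \<omega>)) p)) \<partial>(lborel \<Otimes>\<^sub>M \<mu>)) =
      (\<integral>\<^sup>+x. (\<integral>\<^sup>+\<omega>. ennreal (norm (\<psi> x *\<^sub>R (f (x, \<omega>) * u \<omega>))) \<partial>\<mu>) \<partial>lborel)"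
    by (subst nn_integral_fst[symmetric]) auto
  also have "\<dots> \<le> (\<integral>\<^sup>+x. ennreal M * (1 + (\<integral>\<^sup>+\<omega>. ennreal ((cmod (f (x, \<omega>)))\<^sup>2) \<partial>\<mu>)) * indicator K x \<partial>lborel)"
  proof (rule nn_integral_mono)
    fix x :: "real^'n"
    show "(\<integral>\<^sup>+\<omega>. ennreal (norm (\<psi> x *\<^sub>R (f (x, \<omega>) * u \<omega>))) \<partial>\<mu>) \<le>
        ennreal M * (1 + (\<integral>\<^sup>+\<omega>. ennreal ((cmod (f (x, \<omega>)))\<^sup>2) \<partial>\<mu>)) * indicator K x"
    proof (cases "norm x \<le> R")
      case True
      have "(\<integral>\<^sup>+\<omega>. ennreal (norm (\<psi> x *\<^sub>R (f (x, \<omega>) * u \<omega>))) \<partial>\<mu>) \<le> (\<integral>\<^sup>+\<omega>. ennreal M * (1 + ennreal ((cmod (f (x, \<omega>)))\<^sup>2)) \<partial>\<mu>)"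
      proof (rule nn_integral_mono)
        fix \<omega>
        have "cmod (f (x, \<omega>)) \<le> 1 + (cmod (f (x, \<omega>)))\<^sup>2"
        proof -
          have "2 * cmod (f (x, \<omega>)) \<le> 1 + (cmod (f (x, \<omega>)))\<^sup>2"
            using sum_squares_bound[of 1 "cmod (f (x, \<omega>))"] by simp
          then show ?thesis using norm_ge_zero[of "f (x, \<omega>)"] by linarith
        qed
        then have "cmod (f (x, \<omega>) * u \<omega>) \<le> 1 + (cmod (f (x, \<omega>)))\<^sup>2"
          using u(2)[of \<omega>] by (simp add: norm_mult) (meson mult_left_le norm_ge_zero order_trans)
        then have "norm (\<psi> x *\<^sub>R (f (x, \<omega>) * u \<omega>)) \<le> M * (1 + (cmod (f (x, \<omega>)))\<^sup>2)"
          using M True unfolding norm_scaleR by (intro mult_mono) auto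
        then have "ennreal (norm (\<psi> x *\<^sub>R (f (x, \<omega>) * u \<omega>))) \<le> ennreal (M * (1 + (cmod (f (x, \<omega>)))\<^sup>2))"
          by (rule ennreal_leI)
        also have "\<dots> = ennreal M * (1 + ennreal ((cmod (f (x, \<omega>)))\<^sup>2))"
          using M(1) by (simp add: ennreal_mult ennreal_plus[symmetric] flip: ennreal_1 del: ennreal_plus)
        finally show "ennreal (norm (\<psi> x *\<^sub>R (f (x, \<omega>) * u \<omega>))) \<le> ennreal M * (1 + ennreal ((cmod (f (x, \<omega>)))\<^sup>2))" .
      qed
      also have "\<dots> = ennreal M * (1 + (\<integral>\<^sup>+\<omega>. ennreal ((cmod (f (x, \<omega>)))\<^sup>2) \<partial>\<mu>))"
        using section_measurable[OF L2_loc_measurable[OF f], of x]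
        by (simp add: nn_integral_cmult nn_integral_add)
      finally show ?thesis using True by (simp add: K_def)
    qed (simp add: \<psi>(2))
  qed
  also have "\<dots> = (\<integral>\<^sup>+x. ennreal M * indicator K x + ennreal M * ((\<integral>\<^sup>+\<omega>. ennreal ((cmod (f (x, \<omega>)))\<^sup>2) \<partial>\<mu>) * indicator K x) \<partial>lborel)"
    by (intro nn_integral_cong) (simp add: distrib_left distrib_right mult.assoc)
  also have "\<dots> = ennreal M * emeasure lborel K + ennreal M * (\<integral>\<^sup>+x\<in>K. (\<integral>\<^sup>+\<omega>. ennreal ((cmod (f (x, \<omega>)))\<^sup>2) \<partial>\<mu>) \<partial>lborel)"
    using K(2) by (simp add: nn_integral_add nn_integral_cmult)
  also have "\<dots> < \<infinity>"
    using f K(1) emeasure_compact_finite[OF K(1)] unfolding L2_loc_def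
    by (auto simp: ennreal_mult_less_top)
  finally show "(\<integral>\<^sup>+p. ennreal (norm ((\<lambda>(x, \<omega>). \<psi> x *\<^sub>R (f (x, \<omega>) * u \<omega>)) p)) \<partial>(lborel \<Otimes>\<^sub>M \<mu>)) < \<infinity>" .
qed

text \<open>Averages in \<open>x\<close> commute with the Fourier transform in
  \<open>\<omega>\<close>. An identity between averages that holds for almost every
  \<open>\<omega>\<close> can thus be read off coefficient by coefficient.\<close>

lemma fourier_of_average:
  fixes f :: "(real^'n) \<times> 'g \<Rightarrow> complex"
  assumes f: "f \<in> L2_loc \<mu>" and \<psi>: "continuous_on UNIV \<psi>" "\<And>x. norm x > R \<Longrightarrow> \<psi> x = 0"
    and \<xi>: "\<xi> \<in> dual_group"
  shows "integrable \<mu> (\<lambda>\<omega>. \<integral>x. \<psi> x *\<^sub>R f (x, \<omega>) \<partial>lborel)"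
    and "fourier \<mu> (\<lambda>\<omega>. \<integral>x. \<psi> x *\<^sub>R f (x, \<omega>) \<partial>lborel) \<xi> = (\<integral>x. \<psi> x *\<^sub>R fourier \<mu> (\<lambda>\<omega>. f (x, \<omega>)) \<xi> \<partial>lborel)"
    and "integrable lborel (\<lambda>x. \<psi> x *\<^sub>R fourier \<mu> (\<lambda>\<omega>. f (x, \<omega>)) \<xi>)"
proof -
  have i1: "integrable (lborel \<Otimes>\<^sub>M \<mu>) (\<lambda>(x, \<omega>). \<psi> x *\<^sub>R (f (x, \<omega>) * 1))"
    by (rule integrable_test_product[OF f \<psi>]) auto
  have i2: "integrable (lborel \<Otimes>\<^sub>M \<mu>) (\<lambda>(x, \<omega>). \<psi> x *\<^sub>R (f (x, \<omega>) * cnj (\<xi> \<omega>)))"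
    by (rule integrable_test_product[OF f \<psi>])
       (auto intro!: continuous_intros dual_groupD(1)[OF \<xi>] simp: dual_groupD(2)[OF \<xi>])
  show "integrable \<mu> (\<lambda>\<omega>. \<integral>x. \<psi> x *\<^sub>R f (x, \<omega>) \<partial>lborel)"
    using P.integrable_snd[of "\<lambda>x \<omega>. \<psi> x *\<^sub>R f (x, \<omega>)"] i1 by simp
  have eq: "(\<integral>\<omega>. \<psi> x *\<^sub>R (f (x, \<omega>) * cnj (\<xi> \<omega>)) \<partial>\<mu>) = \<psi> x *\<^sub>R fourier \<mu> (\<lambda>\<omega>. f (x, \<omega>)) \<xi>" for x
    by (simp add: fourier_def)
  show "integrable lborel (\<lambda>x. \<psi> x *\<^sub>R fourier \<mu> (\<lambda>\<omega>. f (x, \<omega>)) \<xi>)"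
    using P.integrable_fst[OF i2] by (simp add: fourier_def)
  have "fourier \<mu> (\<lambda>\<omega>. \<integral>x. \<psi> x *\<^sub>R f (x, \<omega>) \<partial>lborel) \<xi> = (\<integral>\<omega>. (\<integral>x. \<psi> x *\<^sub>R (f (x, \<omega>) * cnj (\<xi> \<omega>)) \<partial>lborel) \<partial>\<mu>)"
    unfolding fourier_def
    by (simp only: integral_mult_left_zero[symmetric] mult_scaleR_left)
  also have "\<dots> = (\<integral>x. (\<integral>\<omega>. \<psi> x *\<^sub>R (f (x, \<omega>) * cnj (\<xi> \<omega>)) \<partial>\<mu>) \<partial>lborel)"
    by (rule P.Fubini_integral[OF i2])
  finally show "fourier \<mu> (\<lambda>\<omega>. \<integral>x. \<psi> x *\<^sub>R f (x, \<omega>) \<partial>lborel) \<xi> = (\<integral>x. \<psi> x *\<^sub>R fourier \<mu> (\<lambda>\<omega>. f (x, \<omega>)) \<xi> \<partial>lborel)"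
    unfolding eq .
qed

section \<open>Fourier coefficients along the flow\<close>

lemma cnj_character_measurable:
  fixes \<xi> :: "'g \<Rightarrow> complex"
  assumes "\<xi> \<in> dual_group"
  shows "(\<lambda>\<omega>. cnj (\<xi> \<omega>)) \<in> borel_measurable borel" "(\<lambda>\<omega>. cnj (\<xi> \<omega>)) \<in> borel_measurable \<mu>"
  by (intro continuous_measurable continuous_intros dual_groupD(1)[OF assms])+

lemma fourier_flow:
  assumes h: "h \<in> borel_measurable \<mu>" and \<xi>: "\<xi> \<in> dual_group"
  shows "fourier \<mu> (\<lambda>\<omega>. h (\<phi> x + \<omega>)) \<xi> = wave (frequency \<phi> \<xi>) x * fourier \<mu> h \<xi>"
proof -
  have [measurable]: "h \<in> borel_measurable borel" "(\<lambda>\<omega>. cnj (\<xi> \<omega>)) \<in> borel_measurable borel"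
    using h cnj_character_measurable(1)[OF \<xi>]
    by (simp_all add: measurable_cong_sets[OF sets_haar refl])
  have c: "cnj (\<xi> \<omega>) = \<xi> (\<phi> x) * cnj (\<xi> (\<phi> x + \<omega>))" for \<omega>
    by (simp add: dual_groupD(3)[OF \<xi>] mult.assoc[symmetric] character_mult_cnj[OF \<xi>])
  have "fourier \<mu> (\<lambda>\<omega>. h (\<phi> x + \<omega>)) \<xi> = (\<integral>\<omega>. \<xi> (\<phi> x) * (h (\<phi> x + \<omega>) * cnj (\<xi> (\<phi> x + \<omega>))) \<partial>\<mu>)"
    unfolding fourier_def by (subst c) (simp add: mult_ac)
  also have "\<dots> = \<xi> (\<phi> x) * (\<integral>\<omega>. h (\<phi> x + \<omega>) * cnj (\<xi> (\<phi> x + \<omega>)) \<partial>\<mu>)" by simp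
  also have "(\<integral>\<omega>. h (\<phi> x + \<omega>) * cnj (\<xi> (\<phi> x + \<omega>)) \<partial>\<mu>) = fourier \<mu> h \<xi>"
    unfolding fourier_def by (rule integral_translation[of "\<lambda>\<omega>. h \<omega> * cnj (\<xi> \<omega>)"]) simp
  finally show ?thesis by (simp add: character_phi[OF \<xi>])
qed

lemma fourier_cong_AE:
  assumes "AE \<omega> in \<mu>. f \<omega> = g \<omega>" "f \<in> borel_measurable \<mu>" "g \<in> borel_measurable \<mu>" "\<xi> \<in> dual_group"
  shows "fourier \<mu> f \<xi> = fourier \<mu> g \<xi>"
proof -
  note cnj_character_measurable(2)[OF assms(4)]
  then show ?thesis
    unfolding fourier_def using assms by (intro integral_cong_AE) auto
qed

lemma fourier_stationary:
  fixes f :: "(real^'n) \<times> 'g \<Rightarrow> complex"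
  assumes f: "stationary \<mu> (flow \<phi>) f" and \<xi>: "\<xi> \<in> dual_group"
  shows "fourier \<mu> (\<lambda>\<omega>. f (x, \<omega>)) \<xi> = wave (frequency \<phi> \<xi>) x * fourier \<mu> (\<lambda>\<omega>. f (0, \<omega>)) \<xi>"
proof -
  note m = section_measurable[OF stationaryD(1)[OF f]]
  have "fourier \<mu> (\<lambda>\<omega>. f (x, \<omega>)) \<xi> = fourier \<mu> (\<lambda>\<omega>. f (0, \<phi> x + \<omega>)) \<xi>"
    using measurable_compose[OF translation_measurable m[of 0], of "\<phi> x"]
    by (intro fourier_cong_AE stationaryD(2)[OF f] m \<xi>) simp
  then show ?thesis using fourier_flow[OF m[of 0] \<xi>] by simp
qed

section \<open>Fourier coefficients of weak gradients\<close>

definition gradient_coeff :: "('g \<Rightarrow> complex) \<Rightarrow> 'n \<Rightarrow> ('g \<Rightarrow> complex) \<Rightarrow> complex"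
  where "gradient_coeff h i \<xi> = 2 * complex_of_real pi * \<i> * complex_of_real (frequency \<phi> \<xi> $ i) * fourier \<mu> h \<xi>"

text \<open>Stationarity reduces the dependence of the coefficient on \<open>x\<close> to a plane
  wave, so the integration by parts involves that wave and not \<open>f\<close>.\<close>

lemma fourier_average_pderiv:
  fixes f :: "(real^'n) \<times> 'g \<Rightarrow> complex"
  assumes f: "stationary \<mu> (flow \<phi>) f" "f \<in> L2_loc \<mu>" and \<psi>: "\<psi> \<in> test_functions" and \<xi>: "\<xi> \<in> dual_group"
  shows "fourier \<mu> (\<lambda>\<omega>. \<integral>x. pderiv_at i \<psi> x *\<^sub>R f (x, \<omega>) \<partial>lborel) \<xi> =
    - gradient_coeff (\<lambda>\<omega>. f (0, \<omega>)) i \<xi> * (\<integral>x. \<psi> x *\<^sub>R wave (frequency \<phi> \<xi>) x \<partial>lborel)"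
proof -
  note t = test_functionD[OF \<psi>]
  obtain R where R: "\<And>x. norm x > R \<Longrightarrow> pderiv_at i \<psi> x = 0" using t(4) by blast
  have eq: "(\<lambda>x. pderiv_at i \<psi> x *\<^sub>R fourier \<mu> (\<lambda>\<omega>. f (x, \<omega>)) \<xi>) =
      (\<lambda>x. (pderiv_at i \<psi> x *\<^sub>R wave (frequency \<phi> \<xi>) x) * fourier \<mu> (\<lambda>\<omega>. f (0, \<omega>)) \<xi>)"
    by (rule ext, subst fourier_stationary[OF f(1) \<xi>]) (simp only: mult_scaleR_left)
  have "fourier \<mu> (\<lambda>\<omega>. \<integral>x. pderiv_at i \<psi> x *\<^sub>R f (x, \<omega>) \<partial>lborel) \<xi> =
      (\<integral>x. pderiv_at i \<psi> x *\<^sub>R fourier \<mu> (\<lambda>\<omega>. f (x, \<omega>)) \<xi> \<partial>lborel)"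
    by (rule fourier_of_average(2)[OF f(2) t(2) R \<xi>])
  also have "\<dots> = (\<integral>x. (pderiv_at i \<psi> x *\<^sub>R wave (frequency \<phi> \<xi>) x) * fourier \<mu> (\<lambda>\<omega>. f (0, \<omega>)) \<xi> \<partial>lborel)"
    unfolding eq ..
  also have "\<dots> = (\<integral>x. pderiv_at i \<psi> x *\<^sub>R wave (frequency \<phi> \<xi>) x \<partial>lborel) * fourier \<mu> (\<lambda>\<omega>. f (0, \<omega>)) \<xi>"
    by (rule integral_mult_left_zero)
  finally show ?thesis
    unfolding integral_pderiv_at_wave[OF \<psi>] by (simp add: gradient_coeff_def mult_ac)
qed

text \<open>The coefficients of \<open>F\<close> stay under the integral because \<open>F\<close> is
  an arbitrary weak gradient. The exceptional set depending on \<open>\<psi>\<close> is harmless,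
  since coefficients do not see null sets.\<close>

lemma weak_gradient_fourier:
  fixes f :: "(real^'n) \<times> 'g \<Rightarrow> complex"
  assumes f: "stationary \<mu> (flow \<phi>) f" "f \<in> L2_loc \<mu>" and F: "F \<in> L2_loc \<mu>" "weak_gradient \<mu> f F"
    and \<psi>: "\<psi> \<in> test_functions" and \<xi>: "\<xi> \<in> dual_group"
  shows "gradient_coeff (\<lambda>\<omega>. f (0, \<omega>)) i \<xi> * (\<integral>x. \<psi> x *\<^sub>R wave (frequency \<phi> \<xi>) x \<partial>lborel) =
    (\<integral>x. \<psi> x *\<^sub>R fourier \<mu> (\<lambda>\<omega>. F (x, \<omega>) $ i) \<xi> \<partial>lborel)"
proof -
  note t = test_functionD[OF \<psi>]
  obtain R where R: "\<And>x. norm x > R \<Longrightarrow> \<psi> x = 0 \<and> pderiv_at i \<psi> x = 0" using t(4) by blast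
  have R1: "\<And>x. norm x > R \<Longrightarrow> \<psi> x = 0" and R2: "\<And>x. norm x > R \<Longrightarrow> pderiv_at i \<psi> x = 0" using R by blast+
  note Fi = L2_loc_component[OF F(1), of i]
  have "AE \<omega> in \<mu>. (\<integral>x. pderiv_at i \<psi> x *\<^sub>R f (x, \<omega>) \<partial>lborel) = - (\<integral>x. \<psi> x *\<^sub>R (F (x, \<omega>) $ i) \<partial>lborel)"
    using F(2) \<psi> unfolding weak_gradient_def by blast
  then have "fourier \<mu> (\<lambda>\<omega>. \<integral>x. pderiv_at i \<psi> x *\<^sub>R f (x, \<omega>) \<partial>lborel) \<xi> =
      fourier \<mu> (\<lambda>\<omega>. - (\<integral>x. \<psi> x *\<^sub>R (F (x, \<omega>) $ i) \<partial>lborel)) \<xi>"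
    using fourier_of_average(1)[OF f(2) t(2) R2 \<xi>] fourier_of_average(1)[OF Fi t(1) R1 \<xi>] \<xi>
    by (intro fourier_cong_AE) auto
  also have "\<dots> = - (\<integral>x. \<psi> x *\<^sub>R fourier \<mu> (\<lambda>\<omega>. F (x, \<omega>) $ i) \<xi> \<partial>lborel)"
    using fourier_of_average(2)[OF Fi t(1) R1 \<xi>] by (simp add: fourier_def)
  finally show ?thesis
    unfolding fourier_average_pderiv[OF f \<psi> \<xi>] by simp
qed

end

subsection \<open>The isometry\<close>

lemma test_function_integral_pos:
  fixes \<psi> :: "real^'n \<Rightarrow> real"
  assumes \<psi>: "\<psi> \<in> test_functions" and nonneg: "\<And>x. \<psi> x \<ge> 0" and pos: "\<psi> 0 > 0"
  shows "(\<integral>x. \<psi> x \<partial>lborel) > 0"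
proof (rule ccontr)
  assume "\<not> (\<integral>x. \<psi> x \<partial>lborel) > 0"
  moreover have "(\<integral>x. \<psi> x \<partial>lborel) \<ge> 0" by (intro Bochner_Integration.integral_nonneg nonneg)
  ultimately have "(\<integral>x. \<psi> x \<partial>lborel) = 0" by linarith
  then have "AE x in lborel. \<psi> x = 0"
    using test_function_integrable(3)[OF \<psi>, of "\<lambda>_. 0"] nonneg
    by (subst (asm) integral_nonneg_eq_0_iff_AE) auto
  moreover have op: "open (\<psi> -` {0<..})"
    using test_functionD(1)[OF \<psi>] by (intro open_vimage) auto
  moreover have "0 \<in> \<psi> -` {0<..}" using pos by simp
  then obtain r where r: "r > 0" "ball 0 r \<subseteq> \<psi> -` {0<..}"
    using openE[OF op] by metis
  ultimately have "AE x in lborel. x \<notin> ball (0::real^'n) r" using r(2) by (auto elim!: eventually_mono)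
  then have "emeasure lborel (ball (0::real^'n) r) = 0"
    by (subst (asm) AE_iff_measurable[OF _ refl]) (auto simp: ball_def)
  then show False
    using r(1) less_imp_neq[OF unit_ball_vol_pos, of "real CARD('n)"] by (simp add: emeasure_ball)
qed

lemma integral_diff_i:
  fixes f g :: "'a \<Rightarrow> complex"
  assumes "integrable M f" "integrable M g"
  shows "integrable M (\<lambda>x. f x - \<i> * g x)" "(\<integral>x. f x \<partial>M) - \<i> * (\<integral>x. g x \<partial>M) = (\<integral>x. f x - \<i> * g x \<partial>M)"
  using assms by simp_all

lemma has_sum_finite_sum:
  fixes f :: "'i \<Rightarrow> 'a \<Rightarrow> 'b::topological_comm_monoid_add"
  assumes "\<And>i. i \<in> I \<Longrightarrow> (f i has_sum s i) A"
  shows "((\<lambda>x. \<Sum>i\<in>I. f i x) has_sum (\<Sum>i\<in>I. s i)) A"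
  using assms by (induction I rule: infinite_finite_induct) (auto intro!: has_sum_add)

text \<open>Products of \<open>\<psi>\<close> with \<open>cos\<close> and \<open>sin\<close> serve as the real and imaginary part of the complex
  test function \<open>\<psi>\<close> times the conjugate of \<open>wave y\<close>.\<close>
lemma test_mult_cnj_wave:
  fixes \<psi> :: "real^'n \<Rightarrow> real"
  assumes \<psi>: "\<psi> \<in> test_functions"
  obtains \<psi>c \<psi>s where "\<psi>c \<in> test_functions" "\<psi>s \<in> test_functions"
    "\<And>x z. \<psi>c x *\<^sub>R z - \<i> * (\<psi>s x *\<^sub>R z) = \<psi> x *\<^sub>R (cnj (wave y x) * z)"
proof -
  define a where "a = (2 * pi) *\<^sub>R y"
  define \<psi>c \<psi>s where "\<psi>c x = \<psi> x * cos (a \<bullet> x)" and "\<psi>s x = \<psi> x * sin (a \<bullet> x)" for x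
  have "\<psi>c \<in> test_functions" "\<psi>s \<in> test_functions"
    unfolding \<psi>c_def \<psi>s_def by (intro test_mult_smooth[OF \<psi>] smooth_cos smooth_sin)+
  moreover have "\<psi>c x *\<^sub>R z - \<i> * (\<psi>s x *\<^sub>R z) = \<psi> x *\<^sub>R (cnj (wave y x) * z)" for x z
  proof -
    have "cnj (wave y x) = of_real (cos (a \<bullet> x)) - \<i> * of_real (sin (a \<bullet> x))"
      unfolding wave_cos_sin a_def[symmetric] by simp
    then show ?thesis
      by (simp only:) (simp add: \<psi>c_def \<psi>s_def scaleR_conv_of_real algebra_simps)
  qed
  ultimately show thesis by (rule that)
qed

lemma norm_wave: "cmod (wave y x) = 1"
  by (simp add: norm_exp_eq_Re)

lemma cnj_wave_mult: "cnj (wave y x) * wave y x = 1"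
  using complex_norm_square[of "wave y x"] by (simp only: norm_wave mult.commute) simp

text \<open>For a bump \<open>\<psi>\<close>, the cosine and sine parts of \<open>\<psi>\<close>
  times the conjugate wave pair with the wave to give the positive integral of
  \<open>\<psi>\<close>. Hence at least one of these two real functions pairs nontrivially.\<close>

lemma exists_test_wave:
  obtains \<psi> :: "real^'n \<Rightarrow> real" where "\<psi> \<in> test_functions" "(\<integral>x. \<psi> x *\<^sub>R wave y x \<partial>lborel) \<noteq> 0"
proof -
  obtain \<psi> :: "real^'n \<Rightarrow> real" where \<psi>: "\<psi> \<in> test_functions" "\<And>x. \<psi> x \<ge> 0" "\<psi> 0 > 0"
    using exists_bump by blast
  obtain \<psi>c \<psi>s where t: "\<psi>c \<in> test_functions" "\<psi>s \<in> test_functions"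
    and eq: "\<And>x z. \<psi>c x *\<^sub>R z - \<i> * (\<psi>s x *\<^sub>R z) = \<psi> x *\<^sub>R (cnj (wave y x) * z)"
    using test_mult_cnj_wave[OF \<psi>(1), of y] by blast
  have "(\<integral>x. \<psi>c x *\<^sub>R wave y x \<partial>lborel) - \<i> * (\<integral>x. \<psi>s x *\<^sub>R wave y x \<partial>lborel) =
      (\<integral>x. \<psi>c x *\<^sub>R wave y x - \<i> * (\<psi>s x *\<^sub>R wave y x) \<partial>lborel)"
    by (intro integral_diff_i(2) test_function_integrable(1) t continuous_wave)
  also have "\<dots> = (\<integral>x. complex_of_real (\<psi> x) \<partial>lborel)"
    unfolding eq cnj_wave_mult by (simp add: scaleR_conv_of_real)
  also have "\<dots> = of_real (\<integral>x. \<psi> x \<partial>lborel)" by simp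
  finally have "(\<integral>x. \<psi>c x *\<^sub>R wave y x \<partial>lborel) \<noteq> 0 \<or> (\<integral>x. \<psi>s x *\<^sub>R wave y x \<partial>lborel) \<noteq> 0"
    using test_function_integral_pos[OF \<psi>] by auto
  then show thesis using that t by blast
qed

text \<open>Connects the integral over counting measure in \<open>H1_gamma\<close> with the
  unordered sums of \<open>Plancherel\<close>.\<close>

lemma has_sum_count_space:
  fixes g :: "'a \<Rightarrow> real"
  assumes nonneg: "\<And>x. g x \<ge> 0"
  shows "integrable (count_space A) g \<longleftrightarrow> g summable_on A"
    and "(g has_sum s) A \<Longrightarrow> (\<integral>x. g x \<partial>count_space A) = s"
proof -
  show eq: "integrable (count_space A) g \<longleftrightarrow> g summable_on A"
    using abs_summable_equivalent[of g A] nonneg by (simp add: Infinite_Set_Sum.abs_summable_on_def)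
  assume s: "(g has_sum s) A"
  then have "integrable (count_space A) g" using eq summable_on_def by blast
  then have "Infinite_Set_Sum.abs_summable_on g A" by (simp add: Infinite_Set_Sum.abs_summable_on_def)
  then have "infsetsum g A = infsum g A" by (rule infsetsum_infsum)
  then show "(\<integral>x. g x \<partial>count_space A) = s"
    using s by (simp add: infsetsum_def infsumI)
qed

lemma power2_norm_vec: "(norm v)\<^sup>2 = (\<Sum>i\<in>UNIV. (norm (v $ i))\<^sup>2)"
  by (simp add: norm_vec_def L2_set_def sum_nonneg)

lemma borel_measurable_vec:
  fixes g :: "'n::finite \<Rightarrow> 'a \<Rightarrow> complex"
  assumes "\<And>i. g i \<in> borel_measurable M"
  shows "(\<lambda>x. \<chi> i. g i x) \<in> borel_measurable M"
proof -
  have "(\<lambda>x. (\<chi> i. g i x) \<bullet> axis i u) \<in> borel_measurable M" for i u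
  proof -
    have "(\<lambda>x. (\<chi> i. g i x) \<bullet> axis i u) = (\<lambda>x. g i x \<bullet> u)" by (simp add: inner_axis)
    then show ?thesis using assms by simp
  qed
  then show ?thesis
    by (subst borel_measurable_euclidean_space) (auto simp: Basis_vec_def)
qed

context compact_haar_flow
begin

section \<open>Summability of the gradient coefficients\<close>

lemma norm_gradient_coeff:
  "(cmod (gradient_coeff h i \<xi>))\<^sup>2 = (2 * pi)\<^sup>2 * (frequency \<phi> \<xi> $ i)\<^sup>2 * (cmod (fourier \<mu> h \<xi>))\<^sup>2"
  by (simp add: gradient_coeff_def norm_mult power_mult_distrib)

text \<open>Expanding the Euclidean norm of the frequency splits the weighted sum into one sum for
  the function and one per partial derivative, each within reach of
  \<open>Plancherel\<close>.\<close>

lemma H1_weight_eq: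
  "(1 + (gamma_of \<phi> \<xi>)\<^sup>2) * (cmod (fourier \<mu> h \<xi>))\<^sup>2 =
    (cmod (fourier \<mu> h \<xi>))\<^sup>2 + (\<Sum>i\<in>UNIV. (cmod (gradient_coeff h i \<xi>))\<^sup>2)"
  by (simp add: norm_gradient_coeff gamma_of_def power_mult_distrib power2_norm_vec
      sum_distrib_left[symmetric] sum_distrib_right[symmetric] distrib_right)

text \<open>The extended form also covers sections outside L2, where the right side is infinite. It
  can therefore be applied at every \<open>x\<close> to an arbitrary representative of the
  gradient.\<close>

lemma Bessel_nn_integral:
  assumes h: "h \<in> borel_measurable \<mu>" and S: "finite S" "S \<subseteq> dual_group"
  shows "(\<Sum>\<xi>\<in>S. ennreal ((cmod (fourier \<mu> h \<xi>))\<^sup>2)) \<le> (\<integral>\<^sup>+\<omega>. ennreal ((cmod (h \<omega>))\<^sup>2) \<partial>\<mu>)"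
proof (cases "h \<in> L2 \<mu>")
  case True
  have "(\<Sum>\<xi>\<in>S. ennreal ((cmod (fourier \<mu> h \<xi>))\<^sup>2)) = ennreal (\<Sum>\<xi>\<in>S. (cmod (fourier \<mu> h \<xi>))\<^sup>2)"
    by (simp add: sum_ennreal)
  also have "\<dots> \<le> ennreal (\<integral>\<omega>. (cmod (h \<omega>))\<^sup>2 \<partial>\<mu>)"
    by (intro ennreal_leI Bessel True S)
  also have "\<dots> = (\<integral>\<^sup>+\<omega>. ennreal ((cmod (h \<omega>))\<^sup>2) \<partial>\<mu>)"
    using L2_square_integrable[OF True] by (simp add: nn_integral_eq_integral)
  finally show ?thesis .
next
  case False
  then show ?thesis using L2_iff_nn_integral[OF h] by (simp add: less_top[symmetric])
qed

text \<open>Testing with \<open>\<psi>\<close> times the conjugate wave cancels the oscillation on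
  the left exactly and leaves the integral of \<open>\<psi>\<close>; on the right the phase has
  modulus one and disappears.\<close>

lemma gradient_coeff_bound:
  fixes f :: "(real^'n) \<times> 'g \<Rightarrow> complex" and F :: "(real^'n) \<times> 'g \<Rightarrow> complex^'n" and \<psi> :: "real^'n \<Rightarrow> real"
  assumes f: "stationary \<mu> (flow \<phi>) f" "f \<in> L2_loc \<mu>" and F: "F \<in> L2_loc \<mu>" "weak_gradient \<mu> f F"
    and \<psi>: "\<psi> \<in> test_functions" "\<And>x. \<psi> x \<ge> 0" and \<xi>: "\<xi> \<in> dual_group"
  shows "ennreal (cmod (gradient_coeff (\<lambda>\<omega>. f (0, \<omega>)) i \<xi>) * (\<integral>x. \<psi> x \<partial>lborel)) \<le>
    (\<integral>\<^sup>+x. ennreal (\<psi> x * cmod (fourier \<mu> (\<lambda>\<omega>. F (x, \<omega>) $ i) \<xi>)) \<partial>lborel)"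
proof -
  define y where "y = frequency \<phi> \<xi>"
  define c where "c = gradient_coeff (\<lambda>\<omega>. f (0, \<omega>)) i \<xi>"
  define H where "H x = fourier \<mu> (\<lambda>\<omega>. F (x, \<omega>) $ i) \<xi>" for x
  obtain \<psi>c \<psi>s where t: "\<psi>c \<in> test_functions" "\<psi>s \<in> test_functions"
    and eq: "\<And>x z. \<psi>c x *\<^sub>R z - \<i> * (\<psi>s x *\<^sub>R z) = \<psi> x *\<^sub>R (cnj (wave y x) * z)"
    using test_mult_cnj_wave[OF \<psi>(1), of y] by blast
  have intH: "integrable lborel (\<lambda>x. \<eta> x *\<^sub>R H x)" if \<eta>: "\<eta> \<in> test_functions" for \<eta>
  proof -
    obtain R where "\<And>x. norm x > R \<Longrightarrow> \<eta> x = 0" using test_functionD(4)[OF \<eta>] by blast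
    then show ?thesis
      unfolding H_def
      by (rule fourier_of_average(3)[OF L2_loc_component[OF F(1)] test_functionD(1)[OF \<eta>] _ \<xi>])
  qed
  have wg: "c * (\<integral>x. \<eta> x *\<^sub>R wave y x \<partial>lborel) = (\<integral>x. \<eta> x *\<^sub>R H x \<partial>lborel)" if "\<eta> \<in> test_functions" for \<eta>
    unfolding c_def y_def H_def by (rule weak_gradient_fourier[OF f F that \<xi>])
  have diff: "(\<integral>x. \<psi>c x *\<^sub>R G x \<partial>lborel) - \<i> * (\<integral>x. \<psi>s x *\<^sub>R G x \<partial>lborel) = (\<integral>x. \<psi> x *\<^sub>R (cnj (wave y x) * G x) \<partial>lborel)"
    "integrable lborel (\<lambda>x. \<psi> x *\<^sub>R (cnj (wave y x) * G x))"
    if i: "integrable lborel (\<lambda>x. \<psi>c x *\<^sub>R G x)" "integrable lborel (\<lambda>x. \<psi>s x *\<^sub>R G x)" for G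
  proof -
    have "(\<integral>x. \<psi>c x *\<^sub>R G x \<partial>lborel) - \<i> * (\<integral>x. \<psi>s x *\<^sub>R G x \<partial>lborel) = (\<integral>x. \<psi>c x *\<^sub>R G x - \<i> * (\<psi>s x *\<^sub>R G x) \<partial>lborel)"
      by (rule integral_diff_i(2)[OF i])
    then show "(\<integral>x. \<psi>c x *\<^sub>R G x \<partial>lborel) - \<i> * (\<integral>x. \<psi>s x *\<^sub>R G x \<partial>lborel) = (\<integral>x. \<psi> x *\<^sub>R (cnj (wave y x) * G x) \<partial>lborel)"
      unfolding eq .
    have "integrable lborel (\<lambda>x. \<psi>c x *\<^sub>R G x - \<i> * (\<psi>s x *\<^sub>R G x))" by (rule integral_diff_i(1)[OF i])
    then show "integrable lborel (\<lambda>x. \<psi> x *\<^sub>R (cnj (wave y x) * G x))" unfolding eq .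
  qed
  have "c * of_real (\<integral>x. \<psi> x \<partial>lborel) = c * (\<integral>x. \<psi> x *\<^sub>R (cnj (wave y x) * wave y x) \<partial>lborel)"
    unfolding cnj_wave_mult by (simp add: scaleR_conv_of_real)
  also have "\<dots> = c * ((\<integral>x. \<psi>c x *\<^sub>R wave y x \<partial>lborel) - \<i> * (\<integral>x. \<psi>s x *\<^sub>R wave y x \<partial>lborel))"
    by (subst diff(1)) (auto intro!: test_function_integrable(1) t continuous_wave)
  also have "\<dots> = (\<integral>x. \<psi>c x *\<^sub>R H x \<partial>lborel) - \<i> * (\<integral>x. \<psi>s x *\<^sub>R H x \<partial>lborel)"
    unfolding wg[OF t(1), symmetric] wg[OF t(2), symmetric] by (simp add: algebra_simps)
  also have "\<dots> = (\<integral>x. \<psi> x *\<^sub>R (cnj (wave y x) * H x) \<partial>lborel)"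
    by (intro diff(1) intH t)
  finally have main: "c * of_real (\<integral>x. \<psi> x \<partial>lborel) = (\<integral>x. \<psi> x *\<^sub>R (cnj (wave y x) * H x) \<partial>lborel)" .
  have "(\<integral>x. \<psi> x \<partial>lborel) \<ge> 0" by (intro Bochner_Integration.integral_nonneg \<psi>)
  then have "cmod c * (\<integral>x. \<psi> x \<partial>lborel) = cmod (c * of_real (\<integral>x. \<psi> x \<partial>lborel))"
    by (simp add: norm_mult)
  then have "ennreal (cmod c * (\<integral>x. \<psi> x \<partial>lborel)) = ennreal (cmod (\<integral>x. \<psi> x *\<^sub>R (cnj (wave y x) * H x) \<partial>lborel))"
    by (simp only: main)
  also have "\<dots> \<le> (\<integral>\<^sup>+x. ennreal (cmod (\<psi> x *\<^sub>R (cnj (wave y x) * H x))) \<partial>lborel)"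
    by (intro integral_norm_bound_ennreal diff(2) intH t)
  also have "\<dots> = (\<integral>\<^sup>+x. ennreal (\<psi> x * cmod (H x)) \<partial>lborel)"
    using \<psi>(2) by (simp add: norm_mult norm_wave)
  finally show ?thesis unfolding c_def H_def .
qed

text \<open>A weighted Cauchy-Schwarz inequality squares the bound for a single coefficient.
  Bessel's inequality in each section then controls all coefficients together by a
  \<open>\<psi>\<close>-average of section norms, finite because \<open>\<psi>\<close> is bounded
  with compact support.\<close>

lemma gradient_coeff_summable:
  fixes f :: "(real^'n) \<times> 'g \<Rightarrow> complex" and F :: "(real^'n) \<times> 'g \<Rightarrow> complex^'n"
  assumes f: "stationary \<mu> (flow \<phi>) f" "f \<in> L2_loc \<mu>" and F: "F \<in> L2_loc \<mu>" "weak_gradient \<mu> f F"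
  shows "(\<lambda>\<xi>. (cmod (gradient_coeff (\<lambda>\<omega>. f (0, \<omega>)) i \<xi>))\<^sup>2) summable_on dual_group"
proof -
  define c where "c = gradient_coeff (\<lambda>\<omega>. f (0, \<omega>)) i"
  define H where "H \<xi> x = fourier \<mu> (\<lambda>\<omega>. F (x, \<omega>) $ i) \<xi>" for \<xi> x
  obtain \<psi> :: "real^'n \<Rightarrow> real" where \<psi>: "\<psi> \<in> test_functions" "\<And>x. \<psi> x \<ge> 0" "\<psi> 0 > 0"
    using exists_bump by blast
  define I where "I = (\<integral>x. \<psi> x \<partial>lborel)"
  have I: "I > 0" unfolding I_def by (rule test_function_integral_pos[OF \<psi>])
  have nnI: "(\<integral>\<^sup>+x. ennreal (\<psi> x) \<partial>lborel) = ennreal I"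
    unfolding I_def using test_function_integrable(3)[OF \<psi>(1), of "\<lambda>_. 0"] \<psi>(2)
    by (simp add: nn_integral_eq_integral)
  note Fi = L2_loc_component[OF F(1), of i]
  note [measurable] = L2_loc_measurable[OF Fi] borel_measurable_continuous_onI[OF test_functionD(1)[OF \<psi>(1)]]
  define J where "J = (\<integral>\<^sup>+x. ennreal (\<psi> x) * (\<integral>\<^sup>+\<omega>. ennreal ((cmod (F (x, \<omega>) $ i))\<^sup>2) \<partial>\<mu>) \<partial>lborel)"
  have J: "J < \<infinity>"
  proof -
    obtain R where R: "\<And>x. norm x > R \<Longrightarrow> \<psi> x = 0" using test_functionD(4)[OF \<psi>(1)] by blast
    have "bounded (\<psi> ` cball 0 R)"
      by (intro compact_imp_bounded compact_continuous_image continuous_on_subset[OF test_functionD(1)[OF \<psi>(1)]]) auto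
    then have "\<exists>M>0. \<forall>x\<in>cball 0 R. \<bar>\<psi> x\<bar> \<le> M" unfolding bounded_pos by simp
    then obtain M where M: "M > 0" "\<And>x. x \<in> cball 0 R \<Longrightarrow> \<bar>\<psi> x\<bar> \<le> M" by blast
    have "J \<le> (\<integral>\<^sup>+x. ennreal M * ((\<integral>\<^sup>+\<omega>. ennreal ((cmod (F (x, \<omega>) $ i))\<^sup>2) \<partial>\<mu>) * indicator (cball 0 R) x) \<partial>lborel)"
      unfolding J_def
    proof (rule nn_integral_mono)
      fix x :: "real^'n"
      show "ennreal (\<psi> x) * (\<integral>\<^sup>+\<omega>. ennreal ((cmod (F (x, \<omega>) $ i))\<^sup>2) \<partial>\<mu>) \<le>
          ennreal M * ((\<integral>\<^sup>+\<omega>. ennreal ((cmod (F (x, \<omega>) $ i))\<^sup>2) \<partial>\<mu>) * indicator (cball 0 R) x)"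
      proof (cases "norm x \<le> R")
        case True
        then have "ennreal (\<psi> x) \<le> ennreal M" using M(2)[of x] by (intro ennreal_leI) auto
        then show ?thesis using True by (simp add: mult_right_mono)
      qed (simp add: R)
    qed
    also have "\<dots> = ennreal M * (\<integral>\<^sup>+x\<in>cball 0 R. (\<integral>\<^sup>+\<omega>. ennreal ((cmod (F (x, \<omega>) $ i))\<^sup>2) \<partial>\<mu>) \<partial>lborel)"
      using borel_closed[OF closed_cball[of "0::real^'n" R]]
      by (intro nn_integral_cmult borel_measurable_times_ennreal borel_measurable_indicator) auto
    also have "\<dots> < \<infinity>"
      using Fi compact_cball[of "0::real^'n" R] unfolding L2_loc_def by (auto simp: ennreal_mult_less_top)
    finally show ?thesis .
  qed
  have H_meas: "H \<xi> \<in> borel_measurable lborel" if "\<xi> \<in> dual_group" for \<xi>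
  proof -
    note [measurable] = cnj_character_measurable(2)[OF that]
    show ?thesis unfolding H_def fourier_def by measurable
  qed
  have bound: "ennreal ((cmod (c \<xi>) * I)\<^sup>2) \<le> ennreal I * (\<integral>\<^sup>+x. ennreal (\<psi> x * (cmod (H \<xi> x))\<^sup>2) \<partial>lborel)"
    if \<xi>: "\<xi> \<in> dual_group" for \<xi>
  proof -
    note [measurable] = H_meas[OF \<xi>]
    have "ennreal ((cmod (c \<xi>) * I)\<^sup>2) = (ennreal (cmod (c \<xi>) * I))\<^sup>2"
      using I by (simp add: ennreal_power)
    also have "\<dots> \<le> (\<integral>\<^sup>+x. ennreal (\<psi> x * cmod (H \<xi> x)) \<partial>lborel)\<^sup>2"
      unfolding c_def I_def H_def by (intro power_mono gradient_coeff_bound f F \<psi> \<xi>) simp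
    also have "\<dots> \<le> (\<integral>\<^sup>+x. ennreal (\<psi> x) \<partial>lborel) * (\<integral>\<^sup>+x. ennreal (\<psi> x * (cmod (H \<xi> x))\<^sup>2) \<partial>lborel)"
      by (intro Cauchy_Schwarz_weighted_nn_integral \<psi>) auto
    finally show ?thesis unfolding nnI .
  qed
  \<comment> \<open>Exchanging the finite sum with the integral puts Bessel's inequality inside,
    separately at every \<open>x\<close>. The resulting bound is independent of \<open>S\<close>,
    which yields summability over the whole dual.\<close>
  have total: "(\<Sum>\<xi>\<in>S. (cmod (c \<xi>))\<^sup>2) \<le> enn2real (ennreal I * J) / I\<^sup>2" if S: "finite S" "S \<subseteq> dual_group" for S
  proof -
    have "ennreal (\<Sum>\<xi>\<in>S. (cmod (c \<xi>) * I)\<^sup>2) = (\<Sum>\<xi>\<in>S. ennreal ((cmod (c \<xi>) * I)\<^sup>2))"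
      by (simp add: sum_ennreal)
    also have "\<dots> \<le> (\<Sum>\<xi>\<in>S. ennreal I * (\<integral>\<^sup>+x. ennreal (\<psi> x * (cmod (H \<xi> x))\<^sup>2) \<partial>lborel))"
      using S by (intro sum_mono bound) auto
    also have "\<dots> = ennreal I * (\<Sum>\<xi>\<in>S. \<integral>\<^sup>+x. ennreal (\<psi> x * (cmod (H \<xi> x))\<^sup>2) \<partial>lborel)"
      by (simp add: sum_distrib_left)
    also have "(\<Sum>\<xi>\<in>S. \<integral>\<^sup>+x. ennreal (\<psi> x * (cmod (H \<xi> x))\<^sup>2) \<partial>lborel) =
        (\<integral>\<^sup>+x. (\<Sum>\<xi>\<in>S. ennreal (\<psi> x * (cmod (H \<xi> x))\<^sup>2)) \<partial>lborel)"
    proof (rule nn_integral_sum[symmetric])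
      fix \<xi> assume "\<xi> \<in> S"
      then have [measurable]: "H \<xi> \<in> borel_measurable lborel" using H_meas S by blast
      show "(\<lambda>x. ennreal (\<psi> x * (cmod (H \<xi> x))\<^sup>2)) \<in> borel_measurable lborel" by measurable
    qed
    also have "\<dots> \<le> J"
      unfolding J_def
    proof (rule nn_integral_mono)
      fix x :: "real^'n"
      have "(\<Sum>\<xi>\<in>S. ennreal (\<psi> x * (cmod (H \<xi> x))\<^sup>2)) = ennreal (\<psi> x) * (\<Sum>\<xi>\<in>S. ennreal ((cmod (H \<xi> x))\<^sup>2))"
        unfolding sum_distrib_left using \<psi>(2) by (intro sum.cong refl) (simp add: ennreal_mult)
      also have "\<dots> \<le> ennreal (\<psi> x) * (\<integral>\<^sup>+\<omega>. ennreal ((cmod (F (x, \<omega>) $ i))\<^sup>2) \<partial>\<mu>)"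
        unfolding H_def
        by (intro mult_left_mono Bessel_nn_integral S section_measurable[OF L2_loc_measurable[OF Fi]]) simp
      finally show "(\<Sum>\<xi>\<in>S. ennreal (\<psi> x * (cmod (H \<xi> x))\<^sup>2)) \<le> ennreal (\<psi> x) * (\<integral>\<^sup>+\<omega>. ennreal ((cmod (F (x, \<omega>) $ i))\<^sup>2) \<partial>\<mu>)" .
    qed
    finally have le: "ennreal (\<Sum>\<xi>\<in>S. (cmod (c \<xi>) * I)\<^sup>2) \<le> ennreal I * J"
      by (simp add: mult_left_mono)
    have "(\<Sum>\<xi>\<in>S. (cmod (c \<xi>) * I)\<^sup>2) \<le> enn2real (ennreal I * J)"
      using enn2real_mono[OF le] J by (simp add: ennreal_mult_less_top sum_nonneg)
    moreover have "(\<Sum>\<xi>\<in>S. (cmod (c \<xi>) * I)\<^sup>2) = (\<Sum>\<xi>\<in>S. (cmod (c \<xi>))\<^sup>2) * I\<^sup>2"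
      by (simp add: power_mult_distrib sum_distrib_right)
    ultimately show ?thesis using I by (simp add: field_simps)
  qed
  have "(\<lambda>\<xi>. (cmod (c \<xi>))\<^sup>2) summable_on dual_group"
    using total by (intro nonneg_bdd_above_summable_on bdd_aboveI2[where M="enn2real (ennreal I * J) / I\<^sup>2"]) auto
  then show ?thesis unfolding c_def .
qed

text \<open>The candidate is a vector of Riesz-Fischer functions transported along the flow. For
  each test function the two sides of the weak identity are integrable in \<open>\<omega>\<close>
  with opposite coefficients, so their sum vanishes almost everywhere by
  \<open>fourier_unique_zero\<close>.\<close>

lemma weak_gradient_of_summable:
  fixes f :: "(real^'n) \<times> 'g \<Rightarrow> complex"
  assumes f: "stationary \<mu> (flow \<phi>) f" "f \<in> L2_loc \<mu>"
    and sm: "\<And>i. (\<lambda>\<xi>. (cmod (gradient_coeff (\<lambda>\<omega>. f (0, \<omega>)) i \<xi>))\<^sup>2) summable_on dual_group"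
  shows "\<exists>F. F \<in> L2_loc \<mu> \<and> weak_gradient \<mu> f F \<and> stationary \<mu> (flow \<phi>) F"
proof -
  have "\<exists>g. g \<in> L2 \<mu> \<and> (\<forall>\<xi>\<in>dual_group. fourier \<mu> g \<xi> = gradient_coeff (\<lambda>\<omega>. f (0, \<omega>)) i \<xi>)" for i
    by (rule Riesz_Fischer[OF sm[of i]]) blast
  then obtain g where g: "\<And>i. g i \<in> L2 \<mu>"
    "\<And>i \<xi>. \<xi> \<in> dual_group \<Longrightarrow> fourier \<mu> (g i) \<xi> = gradient_coeff (\<lambda>\<omega>. f (0, \<omega>)) i \<xi>" by metis
  define G :: "'g \<Rightarrow> complex^'n" where "G \<omega> = (\<chi> i. g i \<omega>)" for \<omega>
  have mG: "G \<in> borel_measurable \<mu>"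
    unfolding G_def by (intro borel_measurable_vec L2_measurable g)
  define F where "F = (\<lambda>p. G (\<phi> (fst p) + snd p))"
  have F: "stationary \<mu> (flow \<phi>) F" unfolding F_def by (rule stationary_flow[OF mG])
  have "(\<integral>\<^sup>+\<omega>. ennreal ((norm (G \<omega>))\<^sup>2) \<partial>\<mu>) = (\<Sum>i\<in>UNIV. \<integral>\<^sup>+\<omega>. ennreal ((cmod (g i \<omega>))\<^sup>2) \<partial>\<mu>)"
  proof -
    have "(\<integral>\<^sup>+\<omega>. ennreal ((norm (G \<omega>))\<^sup>2) \<partial>\<mu>) = (\<integral>\<^sup>+\<omega>. (\<Sum>i\<in>UNIV. ennreal ((cmod (g i \<omega>))\<^sup>2)) \<partial>\<mu>)"
      by (simp add: power2_norm_vec G_def sum_ennreal)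
    also have "\<dots> = (\<Sum>i\<in>UNIV. \<integral>\<^sup>+\<omega>. ennreal ((cmod (g i \<omega>))\<^sup>2) \<partial>\<mu>)"
      using L2_measurable[OF g(1)] by (intro nn_integral_sum) auto
    finally show ?thesis .
  qed
  also have "\<dots> < \<infinity>"
    using g(1) L2_iff_nn_integral[OF L2_measurable[OF g(1)]] by (simp add: less_top)
  finally have FL: "F \<in> L2_loc \<mu>"
    unfolding stationary_L2_loc_iff[OF F] by (simp add: F_def)
  have "weak_gradient \<mu> f F"
    unfolding weak_gradient_def
  proof (intro ballI allI)
    fix \<psi> :: "real^'n \<Rightarrow> real" and i assume \<psi>: "\<psi> \<in> test_functions"
    note t = test_functionD[OF \<psi>]
    obtain R where R: "\<And>x. norm x > R \<Longrightarrow> \<psi> x = 0 \<and> pderiv_at i \<psi> x = 0" using t(4) by blast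
    then have R1: "\<And>x. norm x > R \<Longrightarrow> \<psi> x = 0" and R2: "\<And>x. norm x > R \<Longrightarrow> pderiv_at i \<psi> x = 0" by blast+
    note Fi = L2_loc_component[OF FL, of i]
    define A B where "A \<omega> = (\<integral>x. pderiv_at i \<psi> x *\<^sub>R f (x, \<omega>) \<partial>lborel)"
      and "B \<omega> = (\<integral>x. \<psi> x *\<^sub>R (F (x, \<omega>) $ i) \<partial>lborel)" for \<omega>
    \<comment> \<open>The trivial character is supplied to the shared premise of
      \<open>fourier_of_average\<close>.\<close>
    have one: "(\<lambda>_. 1) \<in> (dual_group :: ('g \<Rightarrow> complex) set)" unfolding dual_group_def by auto
    have iA: "integrable \<mu> A" unfolding A_def by (rule fourier_of_average(1)[OF f(2) t(2) R2 one])
    have iB: "integrable \<mu> B" unfolding B_def by (rule fourier_of_average(1)[OF Fi t(1) R1 one])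
    have "AE \<omega> in \<mu>. A \<omega> + B \<omega> = 0"
    proof (rule fourier_unique_zero)
      show "integrable \<mu> (\<lambda>\<omega>. A \<omega> + B \<omega>)" using iA iB by simp
      fix \<xi> :: "'g \<Rightarrow> complex" assume \<xi>: "\<xi> \<in> dual_group"
      have c: "continuous_on UNIV (\<lambda>\<omega>. cnj (\<xi> \<omega>))" by (intro continuous_intros dual_groupD(1)[OF \<xi>])
      have "fourier \<mu> (\<lambda>\<omega>. A \<omega> + B \<omega>) \<xi> = fourier \<mu> A \<xi> + fourier \<mu> B \<xi>"
        unfolding fourier_def
        using integrable_mult_continuous[OF iA c] integrable_mult_continuous[OF iB c]
        by (simp add: distrib_right)
      moreover have "fourier \<mu> A \<xi> = - gradient_coeff (\<lambda>\<omega>. f (0, \<omega>)) i \<xi> * (\<integral>x. \<psi> x *\<^sub>R wave (frequency \<phi> \<xi>) x \<partial>lborel)"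
        unfolding A_def by (rule fourier_average_pderiv[OF f \<psi> \<xi>])
      moreover have "fourier \<mu> B \<xi> = gradient_coeff (\<lambda>\<omega>. f (0, \<omega>)) i \<xi> * (\<integral>x. \<psi> x *\<^sub>R wave (frequency \<phi> \<xi>) x \<partial>lborel)"
      proof -
        have w: "fourier \<mu> (\<lambda>\<omega>. F (x, \<omega>) $ i) \<xi> = wave (frequency \<phi> \<xi>) x * gradient_coeff (\<lambda>\<omega>. f (0, \<omega>)) i \<xi>" for x
          using fourier_flow[OF L2_measurable[OF g(1)] \<xi>, of i x] g(2)[OF \<xi>] by (simp add: F_def G_def)
        have "fourier \<mu> B \<xi> = (\<integral>x. \<psi> x *\<^sub>R fourier \<mu> (\<lambda>\<omega>. F (x, \<omega>) $ i) \<xi> \<partial>lborel)"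
          unfolding B_def by (rule fourier_of_average(2)[OF Fi t(1) R1 \<xi>])
        also have "\<dots> = (\<integral>x. (\<psi> x *\<^sub>R wave (frequency \<phi> \<xi>) x) * gradient_coeff (\<lambda>\<omega>. f (0, \<omega>)) i \<xi> \<partial>lborel)"
          by (simp only: w mult_scaleR_left)
        also have "\<dots> = (\<integral>x. \<psi> x *\<^sub>R wave (frequency \<phi> \<xi>) x \<partial>lborel) * gradient_coeff (\<lambda>\<omega>. f (0, \<omega>)) i \<xi>"
          by (rule integral_mult_left_zero)
        finally show ?thesis by (simp only: mult.commute[of "gradient_coeff _ _ _"])
      qed
      ultimately show "fourier \<mu> (\<lambda>\<omega>. A \<omega> + B \<omega>) \<xi> = 0" by simp
    qed
    then show "AE \<omega> in \<mu>. (\<integral>x. pderiv_at i \<psi> x *\<^sub>R f (x, \<omega>) \<partial>lborel) = - (\<integral>x. \<psi> x *\<^sub>R (F (x, \<omega>) $ i) \<partial>lborel)"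
      unfolding A_def B_def by eventually_elim (simp add: eq_neg_iff_add_eq_0)
  qed
  then show ?thesis using F FL by blast
qed

lemma stationary_component:
  fixes F :: "(real^'n) \<times> 'g \<Rightarrow> complex^'n"
  assumes F: "F \<in> L2_loc \<mu>" "stationary \<mu> (flow \<phi>) F"
  shows "stationary \<mu> (flow \<phi>) (\<lambda>p. F p $ i)"
  unfolding stationary_def
proof (intro conjI allI)
  show "(\<lambda>p. F p $ i) \<in> borel_measurable (lborel \<Otimes>\<^sub>M \<mu>)"
    by (rule L2_loc_measurable[OF L2_loc_component[OF F(1)]])
  fix x k
  have "AE \<omega> in \<mu>. F (x + k, \<omega>) = F (x, flow \<phi> k \<omega>)" using F(2) unfolding stationary_def by blast
  then show "AE \<omega> in \<mu>. F (x + k, \<omega>) $ i = F (x, flow \<phi> k \<omega>) $ i" by eventually_elim simp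
qed

text \<open>For a stationary gradient both sides of \<open>weak_gradient_fourier\<close> contain the
  same pairing of \<open>\<psi>\<close> with the wave. It cancels once \<open>\<psi>\<close>, chosen
  for the given \<open>\<xi>\<close>, makes it nonzero.\<close>

lemma fourier_stationary_gradient:
  fixes f :: "(real^'n) \<times> 'g \<Rightarrow> complex" and F :: "(real^'n) \<times> 'g \<Rightarrow> complex^'n"
  assumes f: "stationary \<mu> (flow \<phi>) f" "f \<in> L2_loc \<mu>"
    and F: "F \<in> L2_loc \<mu>" "weak_gradient \<mu> f F" "stationary \<mu> (flow \<phi>) F" and \<xi>: "\<xi> \<in> dual_group"
  shows "fourier \<mu> (\<lambda>\<omega>. F (0, \<omega>) $ i) \<xi> = gradient_coeff (\<lambda>\<omega>. f (0, \<omega>)) i \<xi>"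
proof -
  obtain \<psi> :: "real^'n \<Rightarrow> real" where \<psi>: "\<psi> \<in> test_functions"
    and nz: "(\<integral>x. \<psi> x *\<^sub>R wave (frequency \<phi> \<xi>) x \<partial>lborel) \<noteq> 0"
    using exists_test_wave by blast
  note Fi = stationary_component[OF F(1,3), of i]
  have eq: "(\<lambda>x. \<psi> x *\<^sub>R fourier \<mu> (\<lambda>\<omega>. F (x, \<omega>) $ i) \<xi>) =
      (\<lambda>x. (\<psi> x *\<^sub>R wave (frequency \<phi> \<xi>) x) * fourier \<mu> (\<lambda>\<omega>. F (0, \<omega>) $ i) \<xi>)"
    by (rule ext, subst fourier_stationary[OF Fi \<xi>]) (simp only: mult_scaleR_left)
  have "gradient_coeff (\<lambda>\<omega>. f (0, \<omega>)) i \<xi> * (\<integral>x. \<psi> x *\<^sub>R wave (frequency \<phi> \<xi>) x \<partial>lborel) =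
      (\<integral>x. \<psi> x *\<^sub>R wave (frequency \<phi> \<xi>) x \<partial>lborel) * fourier \<mu> (\<lambda>\<omega>. F (0, \<omega>) $ i) \<xi>"
    unfolding weak_gradient_fourier[OF f F(1,2) \<psi> \<xi>] eq by (rule integral_mult_left_zero)
  then have "(\<integral>x. \<psi> x *\<^sub>R wave (frequency \<phi> \<xi>) x \<partial>lborel) * gradient_coeff (\<lambda>\<omega>. f (0, \<omega>)) i \<xi> =
      (\<integral>x. \<psi> x *\<^sub>R wave (frequency \<phi> \<xi>) x \<partial>lborel) * fourier \<mu> (\<lambda>\<omega>. F (0, \<omega>) $ i) \<xi>"
    by (subst mult.commute)
  then show ?thesis by (simp only: mult_left_cancel[OF nz])
qed

section \<open>Equality of the spaces and of the norms\<close>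

lemma section_L2:
  fixes f :: "(real^'n) \<times> 'g \<Rightarrow> complex"
  assumes "stationary \<mu> (flow \<phi>) f"
  shows "(\<lambda>\<omega>. f (0, \<omega>)) \<in> L2 \<mu> \<longleftrightarrow> f \<in> L2_loc \<mu>"
  unfolding stationary_L2_loc_iff[OF assms]
  by (rule L2_iff_nn_integral[OF section_measurable[OF stationaryD(1)[OF assms]]])

theorem stat_space_iff:
  fixes f :: "(real^'n) \<times> 'g \<Rightarrow> complex"
  assumes f: "stationary \<mu> (flow \<phi>) f"
  shows "f \<in> stat_space \<mu> (flow \<phi>) \<longleftrightarrow> (\<lambda>\<omega>. f (0, \<omega>)) \<in> H1_gamma \<mu> (gamma_of \<phi>)"
proof
  assume "f \<in> stat_space \<mu> (flow \<phi>)"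
  then obtain F where F: "f \<in> L2_loc \<mu>" "F \<in> L2_loc \<mu>" "weak_gradient \<mu> f F"
    unfolding stat_space_def H1_loc_def by blast
  have h: "(\<lambda>\<omega>. f (0, \<omega>)) \<in> L2 \<mu>" using section_L2[OF f] F(1) by blast
  have "(\<lambda>\<xi>. (cmod (fourier \<mu> (\<lambda>\<omega>. f (0, \<omega>)) \<xi>))\<^sup>2 + (\<Sum>i\<in>UNIV. (cmod (gradient_coeff (\<lambda>\<omega>. f (0, \<omega>)) i \<xi>))\<^sup>2)) summable_on dual_group"
    using has_sum_add[OF Plancherel[OF h] has_sum_finite_sum[where I=UNIV, OF has_sum_infsum[OF gradient_coeff_summable[OF f F]]]]
    by (rule has_sum_imp_summable)
  then show "(\<lambda>\<omega>. f (0, \<omega>)) \<in> H1_gamma \<mu> (gamma_of \<phi>)"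
    unfolding H1_gamma_def using h
    by (simp add: has_sum_count_space(1) H1_weight_eq[symmetric])
next
  assume "(\<lambda>\<omega>. f (0, \<omega>)) \<in> H1_gamma \<mu> (gamma_of \<phi>)"
  then have h: "(\<lambda>\<omega>. f (0, \<omega>)) \<in> L2 \<mu>"
    and sm: "(\<lambda>\<xi>. (1 + (gamma_of \<phi> \<xi>)\<^sup>2) * (cmod (fourier \<mu> (\<lambda>\<omega>. f (0, \<omega>)) \<xi>))\<^sup>2) summable_on dual_group"
    unfolding H1_gamma_def by (auto simp: has_sum_count_space(1))
  have fL: "f \<in> L2_loc \<mu>" using section_L2[OF f] h by blast
  \<comment> \<open>Each gradient term is one of the nonnegative summands into which
    \<open>H1_weight_eq\<close> splits the weight.\<close>
  have "(\<lambda>\<xi>. (cmod (gradient_coeff (\<lambda>\<omega>. f (0, \<omega>)) i \<xi>))\<^sup>2) summable_on dual_group" for i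
  proof (rule summable_on_comparison_test[OF sm])
    show "(cmod (gradient_coeff (\<lambda>\<omega>. f (0, \<omega>)) i \<xi>))\<^sup>2 \<le>
        (1 + (gamma_of \<phi> \<xi>)\<^sup>2) * (cmod (fourier \<mu> (\<lambda>\<omega>. f (0, \<omega>)) \<xi>))\<^sup>2" for \<xi>
      unfolding H1_weight_eq
      using member_le_sum[of i UNIV "\<lambda>i. (cmod (gradient_coeff (\<lambda>\<omega>. f (0, \<omega>)) i \<xi>))\<^sup>2"]
      by (simp add: add_increasing)
  qed simp
  then show "f \<in> stat_space \<mu> (flow \<phi>)"
    using weak_gradient_of_summable[OF f fL] f fL unfolding stat_space_def H1_loc_def by blast
qed

text \<open>Membership first yields summable coefficients and hence a stationary gradient, so the
  choice in \<open>stat_grad\<close> satisfies its specification. Any such choice has the same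
  coefficients at zero, and \<open>Plancherel\<close> is applied to each component.\<close>

theorem stat_norm_eq:
  fixes f :: "(real^'n) \<times> 'g \<Rightarrow> complex"
  assumes f: "stationary \<mu> (flow \<phi>) f" and "f \<in> stat_space \<mu> (flow \<phi>)"
  shows "stat_norm \<mu> (flow \<phi>) f = H1_gamma_norm \<mu> (gamma_of \<phi>) (\<lambda>\<omega>. f (0, \<omega>))"
proof -
  obtain F' where F': "f \<in> L2_loc \<mu>" "F' \<in> L2_loc \<mu>" "weak_gradient \<mu> f F'"
    using assms(2) unfolding stat_space_def H1_loc_def by blast
  define F where "F = stat_grad \<mu> (flow \<phi>) f"
  have "F \<in> L2_loc \<mu> \<and> weak_gradient \<mu> f F \<and> stationary \<mu> (flow \<phi>) F"
    unfolding F_def stat_grad_def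
    by (rule someI_ex[OF weak_gradient_of_summable[OF f F'(1) gradient_coeff_summable[OF f F']]])
  then have F: "F \<in> L2_loc \<mu>" "weak_gradient \<mu> f F" "stationary \<mu> (flow \<phi>) F" by auto
  have h: "(\<lambda>\<omega>. f (0, \<omega>)) \<in> L2 \<mu>" using section_L2[OF f] F'(1) by blast
  have Fi: "(\<lambda>\<omega>. F (0, \<omega>) $ i) \<in> L2 \<mu>" for i
    using section_L2[OF stationary_component[OF F(1,3)]] L2_loc_component[OF F(1)] by blast
  have "((\<lambda>\<xi>. (cmod (gradient_coeff (\<lambda>\<omega>. f (0, \<omega>)) i \<xi>))\<^sup>2) has_sum (\<integral>\<omega>. (cmod (F (0, \<omega>) $ i))\<^sup>2 \<partial>\<mu>)) dual_group" for i
    using Plancherel[OF Fi[of i]] fourier_stationary_gradient[OF f F'(1) F]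
    by (subst has_sum_cong[of dual_group _ "\<lambda>\<xi>. (cmod (fourier \<mu> (\<lambda>\<omega>. F (0, \<omega>) $ i) \<xi>))\<^sup>2"]) simp_all
  then have "((\<lambda>\<xi>. (cmod (fourier \<mu> (\<lambda>\<omega>. f (0, \<omega>)) \<xi>))\<^sup>2 + (\<Sum>i\<in>UNIV. (cmod (gradient_coeff (\<lambda>\<omega>. f (0, \<omega>)) i \<xi>))\<^sup>2))
      has_sum ((\<integral>\<omega>. (cmod (f (0, \<omega>)))\<^sup>2 \<partial>\<mu>) + (\<Sum>i\<in>UNIV. \<integral>\<omega>. (cmod (F (0, \<omega>) $ i))\<^sup>2 \<partial>\<mu>))) dual_group"
    using Plancherel[OF h] by (intro has_sum_add has_sum_finite_sum)
  also have "(\<Sum>i\<in>UNIV. \<integral>\<omega>. (cmod (F (0, \<omega>) $ i))\<^sup>2 \<partial>\<mu>) = (\<integral>\<omega>. (norm (F (0, \<omega>)))\<^sup>2 \<partial>\<mu>)"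
    unfolding power2_norm_vec
    by (intro Bochner_Integration.integral_sum[symmetric] L2_square_integrable Fi)
  finally have "(\<integral>\<xi>. (1 + (gamma_of \<phi> \<xi>)\<^sup>2) * (cmod (fourier \<mu> (\<lambda>\<omega>. f (0, \<omega>)) \<xi>))\<^sup>2 \<partial>count_space dual_group) =
      (\<integral>\<omega>. (cmod (f (0, \<omega>)))\<^sup>2 \<partial>\<mu>) + (\<integral>\<omega>. (norm (F (0, \<omega>)))\<^sup>2 \<partial>\<mu>)"
    unfolding H1_weight_eq[symmetric] by (intro has_sum_count_space(2)) simp
  then show ?thesis
    unfolding stat_norm_def H1_gamma_norm_def F_def[symmetric] by simp
qed

end

theorem theorem3p5:
  fixes \<mu> :: "'g::{topological_ab_group_add, t2_space} measure"
    and \<phi> :: "real^'n \<Rightarrow> 'g"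
    and f :: "(real^'n) \<times> 'g \<Rightarrow> complex"
  assumes "compact (UNIV :: 'g set)"
    and "normalized_haar \<mu>"
    and "continuous_hom \<phi>"
    and "closure (range \<phi>) = UNIV"
    and "stationary \<mu> (flow \<phi>) f"
  shows "(f \<in> stat_space \<mu> (flow \<phi>) \<longleftrightarrow> (\<lambda>\<omega>. f (0, \<omega>)) \<in> H1_gamma \<mu> (gamma_of \<phi>)) \<and>
         (f \<in> stat_space \<mu> (flow \<phi>) \<longrightarrow>
            stat_norm \<mu> (flow \<phi>) f = H1_gamma_norm \<mu> (gamma_of \<phi>) (\<lambda>\<omega>. f (0, \<omega>)))"
proof -
  interpret compact_haar_flow \<mu> \<phi>
    using assms by unfold_locales
  show ?thesis using stat_space_iff[OF assms(5)] stat_norm_eq[OF assms(5)] by blast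
qed

end
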